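(* Let $X_\bullet$ and $Y_\bullet$ be finitely generated $\mathrm{FI}$--sets, $k$ a field of characteristic zero, and $R_\bullet$ a relation between them with associated maps $r_n:kX_n\to kY_n$, $r_n(e_x)=\sum_{(x,y)\in R_n}e_y$. For each partition $\lambda$ and $n$ large, let $r_{n,\lambda}:(kX_\bullet)_\lambda\to(kY_\bullet)_\lambda$ be the map induced by $r_n$ on $\lambda[n]$--isotypic multiplicity spaces via the canonical isomorphisms $(kX_n)_{\lambda[n]}\cong(kX_\bullet)_\lambda$, $(kY_n)_{\lambda[n]}\cong(kY_\bullet)_\lambda$. Then in any bases for the vector spaces $(k X_{\bullet})_{\lambda}$ and $(k Y_{\bullet})_{\lambda}$, the entries of $r_{n,\lambda}$ depend polynomially on $n$.
   Context: $\mathrm{FI}$ is the category of finite sets $[n]$ and injections; an $\mathrm{FI}$--set is a functor from $\mathrm{FI}$ to finite sets, and a relation between $\mathrm{FI}$--sets $X_\bullet,Y_\bullet$ is an $\mathrm{FI}$--subset $R_\bullet$ of $X_\bullet\times Y_\bullet$. $kX_\bullet$ is the linearization (free $k$-vector space on $X_n$ in degree $n$). For an $\mathfrak{S}_n$-representation $W$ and partition $\mu$ of $n$, $W_\mu=\mathrm{Hom}_{\mathfrak{S}_n}(\mathrm{Sp}(\mu),W)$ with $\mathrm{Sp}(\mu)$ the Specht module. For a partition $\lambda=(\lambda_1,\dots)$ of $m$, $\lambda[n]=(n-m,\lambda_1,\dots)$. For a finitely generated $\mathrm{FI}$--module $V_\bullet$, $(V_\bullet)_\lambda=\lim_n \mathrm{Hom}_{\mathrm{FI}}(M(\lambda[n]),V_\bullet)$,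 where $M(\lambda[n])$ is the free $\mathrm{FI}$--module on $\mathrm{Sp}(\lambda[n])$; for $n$ large this limit is canonically isomorphic to $(V_n)_{\lambda[n]}$. *)

theory Defs
  imports
    "Jordan_Normal_Form.VS_Connect"
    "HOL-Combinatorics.Permutations"
    "HOL-Computational_Algebra.Polynomial"
begin

section \<open>The category FI and FI-sets\<close>

text \<open>A morphism from \<open>[m] = {1..m}\<close> to \<open>[n]\<close> is an extensional injection, so that equality of
  morphisms is equality of functions; morphisms are composed by \<^const>\<open>compose\<close>. The endomorphisms
  \<open>FI_hom n n\<close> are the elements of the symmetric group of degree \<open>n\<close>.\<close>

definition FI_hom :: "nat \<Rightarrow> nat \<Rightarrow> (nat \<Rightarrow> nat) set" where
  "FI_hom m n = {f \<in> {1..m} \<rightarrow>\<^sub>E {1..n}. inj_on f {1..m}}"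

definition sym_inv :: "nat \<Rightarrow> (nat \<Rightarrow> nat) \<Rightarrow> nat \<Rightarrow> nat" where
  "sym_inv n \<sigma> = restrict (inv_into {1..n} \<sigma>) {1..n}"

record 'a FI_set =
  elems :: "nat \<Rightarrow> 'a set"
  push :: "nat \<Rightarrow> nat \<Rightarrow> (nat \<Rightarrow> nat) \<Rightarrow> 'a \<Rightarrow> 'a"

locale FI_set =
  fixes X :: "'a FI_set"
  assumes finite_elems: "finite (elems X n)"
    and push_closed: "f \<in> FI_hom m n \<Longrightarrow> x \<in> elems X m \<Longrightarrow> push X m n f x \<in> elems X n"
    and push_id: "x \<in> elems X n \<Longrightarrow> push X n n (restrict id {1..n}) x = x"
    and push_compose: "f \<in> FI_hom l m \<Longrightarrow> g \<in> FI_hom m n \<Longrightarrow> x \<in> elems X l \<Longrightarrow>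
      push X l n (compose {1..l} g f) x = push X m n g (push X l m f x)"

definition FI_subset :: "(nat \<Rightarrow> 'a set) \<Rightarrow> 'a FI_set \<Rightarrow> bool" where
  "FI_subset Z X \<longleftrightarrow> (\<forall>n. Z n \<subseteq> elems X n) \<and>
     (\<forall>m n. \<forall>f\<in>FI_hom m n. \<forall>x\<in>Z m. push X m n f x \<in> Z n)"

definition finitely_generated :: "'a FI_set \<Rightarrow> bool" where
  "finitely_generated X \<longleftrightarrow>
     (\<exists>G. finite G \<and> G \<subseteq> Sigma UNIV (elems X) \<and>
       (\<forall>Z. FI_subset Z X \<and> G \<subseteq> Sigma UNIV Z \<longrightarrow> Z = elems X))"

definition FI_prod :: "'a FI_set \<Rightarrow> 'b FI_set \<Rightarrow> ('a \<times> 'b) FI_set" where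
  "FI_prod X Y = \<lparr>elems = (\<lambda>n. elems X n \<times> elems Y n),
     push = (\<lambda>m n f. map_prod (push X m n f) (push Y m n f))\<rparr>"

definition FI_relation :: "'a FI_set \<Rightarrow> 'b FI_set \<Rightarrow> (nat \<Rightarrow> ('a \<times> 'b) set) \<Rightarrow> bool" where
  "FI_relation X Y R \<longleftrightarrow> FI_subset R (FI_prod X Y)"


section \<open>Representations, FI-modules and their morphisms\<close>

text \<open>Vector spaces over the field type \<open>'k\<close> are module records over \<^term>\<open>class_ring\<close>; linear maps
  are extensional on the carrier of their source.\<close>

record ('k, 'v) sym_rep =
  space :: "('k, 'v) module"
  act :: "(nat \<Rightarrow> nat) \<Rightarrow> 'v \<Rightarrow> 'v"

record ('k, 'v) FI_module =
  obj :: "nat \<Rightarrow> ('k, 'v) module"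
  arr :: "nat \<Rightarrow> nat \<Rightarrow> (nat \<Rightarrow> nat) \<Rightarrow> 'v \<Rightarrow> 'v"

definition rep_at :: "('k, 'v) FI_module \<Rightarrow> nat \<Rightarrow> ('k, 'v) sym_rep" where
  "rep_at V n = \<lparr>space = obj V n, act = arr V n n\<rparr>"

definition linear_maps :: "('k::field, 'v) module \<Rightarrow> ('k, 'w) module \<Rightarrow> ('v \<Rightarrow> 'w) set" where
  "linear_maps V W = LinearCombinations.module_hom class_ring V W \<inter> extensional (carrier V)"

definition sym_Hom :: "nat \<Rightarrow> ('k::field, 'v) sym_rep \<Rightarrow> ('k, 'w) sym_rep \<Rightarrow> ('v \<Rightarrow> 'w) set" where
  "sym_Hom n U W = {\<phi> \<in> linear_maps (space U) (space W).
     \<forall>\<sigma>\<in>FI_hom n n. \<forall>u\<in>carrier (space U). \<phi> (act U \<sigma> u) = act W \<sigma> (\<phi> u)}"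

definition FI_Hom ::
    "('k::field, 'v) FI_module \<Rightarrow> ('k, 'w) FI_module \<Rightarrow> ('k, nat \<Rightarrow> 'v \<Rightarrow> 'w) module" where
  "FI_Hom V W = \<lparr>
     carrier = {\<phi>. (\<forall>m. \<phi> m \<in> linear_maps (obj V m) (obj W m)) \<and>
       (\<forall>m n. \<forall>f\<in>FI_hom m n. \<forall>v\<in>carrier (obj V m).
          \<phi> n (arr V m n f v) = arr W m n f (\<phi> m v))},
     mult = undefined, one = undefined,
     zero = (\<lambda>m. \<lambda>v\<in>carrier (obj V m). \<zero>\<^bsub>obj W m\<^esub>),
     add = (\<lambda>\<phi> \<psi> m. \<lambda>v\<in>carrier (obj V m). \<phi> m v \<oplus>\<^bsub>obj W m\<^esub> \<psi> m v),
     smult = (\<lambda>c \<phi> m. \<lambda>v\<in>carrier (obj V m). c \<odot>\<^bsub>obj W m\<^esub> \<phi> m v)\<rparr>"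

definition FI_comp ::
    "('k, 'u) FI_module \<Rightarrow> (nat \<Rightarrow> 'v \<Rightarrow> 'w) \<Rightarrow> (nat \<Rightarrow> 'u \<Rightarrow> 'v) \<Rightarrow> nat \<Rightarrow> 'u \<Rightarrow> 'w" where
  "FI_comp U \<phi> \<psi> = (\<lambda>m. compose (carrier (obj U m)) (\<phi> m) (\<psi> m))"

text \<open>The free vector space on a finite set \<open>S\<close> is the space of functions \<open>S \<rightarrow> 'k\<close>, the basis vector
  \<open>e\<^sub>x\<close> being the indicator function of \<open>x\<close>. Thus \<open>arr (linearization X) m n f\<close> sends \<open>e\<^sub>x\<close> to
  \<open>e\<^sub>y\<close> with \<open>y = push X m n f x\<close>, and \<open>rel_map X Y R n\<close> sends \<open>e\<^sub>x\<close> to the sum of all \<open>e\<^sub>y\<close> with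
  \<open>(x, y) \<in> R n\<close>.\<close>

definition linearization :: "'a FI_set \<Rightarrow> ('k::field, 'a \<Rightarrow> 'k) FI_module" where
  "linearization X = \<lparr>obj = (\<lambda>n. class_ring.func_space (elems X n)),
     arr = (\<lambda>m n f v. \<lambda>y\<in>elems X n. \<Sum>x\<in>{x \<in> elems X m. push X m n f x = y}. v x)\<rparr>"

definition rel_map ::
    "'a FI_set \<Rightarrow> 'b FI_set \<Rightarrow> (nat \<Rightarrow> ('a \<times> 'b) set) \<Rightarrow> nat \<Rightarrow> ('a \<Rightarrow> 'k::field) \<Rightarrow> 'b \<Rightarrow> 'k" where
  "rel_map X Y R n v = (\<lambda>y\<in>elems Y n. \<Sum>x\<in>{x \<in> elems X n. (x, y) \<in> R n}. v x)"


section \<open>Specht modules\<close>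

definition is_partition :: "nat list \<Rightarrow> bool" where
  "is_partition \<nu> \<longleftrightarrow> sorted_wrt (\<ge>) \<nu> \<and> 0 \<notin> set \<nu>"

text \<open>Boxes are pairs (row, column), counted from 0.\<close>

definition diagram :: "nat list \<Rightarrow> (nat \<times> nat) set" where
  "diagram \<mu> = {(i, j). i < length \<mu> \<and> j < \<mu> ! i}"

definition tableaux :: "nat \<Rightarrow> nat list \<Rightarrow> (nat \<times> nat \<Rightarrow> nat) set" where
  "tableaux n \<mu> = {T \<in> extensional (diagram \<mu>). bij_betw T (diagram \<mu>) {1..n}}"

text \<open>The tabloid of \<open>T\<close>, i.e. its class under permutations of the entries within each row, is
  encoded by the function sending each entry to its row. The permutation \<open>\<sigma>\<close> then maps the tabloid
  \<open>t\<close> to \<open>t \<circ> \<sigma>\<^sup>-\<^sup>1\<close>, hence acts on functions \<open>v\<close> of tabloids by \<open>(\<sigma> v) t = v (t \<circ> \<sigma>)\<close>.\<close>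

definition tabloid :: "nat \<Rightarrow> nat list \<Rightarrow> (nat \<times> nat \<Rightarrow> nat) \<Rightarrow> nat \<Rightarrow> nat" where
  "tabloid n \<mu> T = (\<lambda>k\<in>{1..n}. fst (inv_into (diagram \<mu>) T k))"

definition tabloids :: "nat \<Rightarrow> nat list \<Rightarrow> (nat \<Rightarrow> nat) set" where
  "tabloids n \<mu> = tabloid n \<mu> ` tableaux n \<mu>"

definition column_stabilizer ::
    "nat \<Rightarrow> nat list \<Rightarrow> (nat \<times> nat \<Rightarrow> nat) \<Rightarrow> (nat \<Rightarrow> nat) set" where
  "column_stabilizer n \<mu> T = {\<sigma> \<in> FI_hom n n.
     \<forall>b\<in>diagram \<mu>. snd (inv_into (diagram \<mu>) T (\<sigma> (T b))) = snd b}"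

text \<open>The alternating sum of the tabloids of \<open>\<sigma> T\<close> over the column stabilizer of \<open>T\<close>, written as a
  function of tabloids.\<close>

definition polytabloid ::
    "nat \<Rightarrow> nat list \<Rightarrow> (nat \<times> nat \<Rightarrow> nat) \<Rightarrow> (nat \<Rightarrow> nat) \<Rightarrow> 'k::field" where
  "polytabloid n \<mu> T = (\<lambda>t\<in>tabloids n \<mu>.
     \<Sum>\<sigma>\<in>{\<sigma> \<in> column_stabilizer n \<mu> T. tabloid n \<mu> (compose (diagram \<mu>) \<sigma> T) = t}.
       of_int (sign_on {1..n} \<sigma>))"

definition Specht :: "nat \<Rightarrow> nat list \<Rightarrow> ('k::field, (nat \<Rightarrow> nat) \<Rightarrow> 'k) sym_rep" where
  "Specht n \<mu> = \<lparr>
     space = (class_ring.func_space (tabloids n \<mu>))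
       \<lparr>carrier := LinearCombinations.module.span class_ring (class_ring.func_space (tabloids n \<mu>))
          (polytabloid n \<mu> ` tableaux n \<mu>)\<rparr>,
     act = (\<lambda>\<sigma> v. \<lambda>t\<in>tabloids n \<mu>. v (compose {1..n} t \<sigma>))\<rparr>"


section \<open>Free FI-modules\<close>

text \<open>The value at \<open>[m]\<close> of the free FI-module on a representation \<open>W\<close> of the symmetric group of
  degree \<open>n\<close> is \<open>k[FI_hom n m] \<otimes> W\<close>, the tensor product being over the group algebra. An element of
  it is represented by the function \<open>F\<close> on \<open>FI_hom n m\<close> with \<open>F (f \<circ> \<sigma>) = \<sigma>\<^sup>-\<^sup>1 F(f)\<close>: the tensor
  \<open>f \<otimes> w\<close> corresponds to the function that sends \<open>f \<circ> \<sigma>\<close> to \<open>\<sigma>\<^sup>-\<^sup>1 w\<close> and is 0 off the orbit of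
  \<open>f\<close>. Under this identification \<open>g : [m] \<rightarrow> [p]\<close> maps \<open>f \<otimes> w\<close> to \<open>(g \<circ> f) \<otimes> w\<close>, and \<open>free_unit\<close>
  is the map \<open>w \<mapsto> id \<otimes> w\<close>.\<close>

definition free_FI_module ::
    "nat \<Rightarrow> ('k::field, 'w) sym_rep \<Rightarrow> ('k, (nat \<Rightarrow> nat) \<Rightarrow> 'w) FI_module" where
  "free_FI_module n W = \<lparr>
     obj = (\<lambda>m. \<lparr>
       carrier = {F \<in> FI_hom n m \<rightarrow>\<^sub>E carrier (space W).
         \<forall>f\<in>FI_hom n m. \<forall>\<sigma>\<in>FI_hom n n. act W \<sigma> (F (compose {1..n} f \<sigma>)) = F f},
       mult = undefined, one = undefined,
       zero = (\<lambda>f\<in>FI_hom n m. \<zero>\<^bsub>space W\<^esub>),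
       add = (\<lambda>F G. \<lambda>f\<in>FI_hom n m. F f \<oplus>\<^bsub>space W\<^esub> G f),
       smult = (\<lambda>c F. \<lambda>f\<in>FI_hom n m. c \<odot>\<^bsub>space W\<^esub> F f)\<rparr>),
     arr = (\<lambda>m p g F. \<lambda>h\<in>FI_hom n p.
       if h \<in> compose {1..n} g ` FI_hom n m
       then F (inv_into (FI_hom n m) (compose {1..n} g) h) else \<zero>\<^bsub>space W\<^esub>)\<rparr>"

definition free_unit :: "nat \<Rightarrow> ('k, 'w) sym_rep \<Rightarrow> 'w \<Rightarrow> (nat \<Rightarrow> nat) \<Rightarrow> 'w" where
  "free_unit n W w = (\<lambda>\<sigma>\<in>FI_hom n n. act W (sym_inv n \<sigma>) w)"

text \<open>The isomorphism from morphisms of FI-modules out of the free module on \<open>W\<close> to equivariant maps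
  out of \<open>W\<close>.\<close>

definition free_restrict ::
    "nat \<Rightarrow> ('k, 'w) sym_rep \<Rightarrow> (nat \<Rightarrow> ((nat \<Rightarrow> nat) \<Rightarrow> 'w) \<Rightarrow> 'v) \<Rightarrow> 'w \<Rightarrow> 'v" where
  "free_restrict n W \<phi> = compose (carrier (space W)) (\<phi> n) (free_unit n W)"


section \<open>Direct limits of sequences of vector spaces\<close>

text \<open>The direct limit of \<open>H N \<rightarrow> H (N + 1) \<rightarrow> \<dots>\<close> with transition maps \<open>t n : H n \<rightarrow> H (n + 1)\<close>:
  pairs \<open>(n, x)\<close> with \<open>x\<close> in \<open>H n\<close>, two of them being identified if they have the same image in
  some \<open>H p\<close>.\<close>

primrec transport :: "(nat \<Rightarrow> 'h \<Rightarrow> 'h) \<Rightarrow> nat \<Rightarrow> nat \<Rightarrow> 'h \<Rightarrow> 'h" where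
  "transport t n 0 x = x"
| "transport t n (Suc d) x = t (n + d) (transport t n d x)"

definition limit_rel ::
    "nat \<Rightarrow> (nat \<Rightarrow> ('k, 'h) module) \<Rightarrow> (nat \<Rightarrow> 'h \<Rightarrow> 'h) \<Rightarrow> ((nat \<times> 'h) \<times> (nat \<times> 'h)) set" where
  "limit_rel N H t = {((m, x), (n, y)). N \<le> m \<and> N \<le> n \<and> x \<in> carrier (H m) \<and> y \<in> carrier (H n) \<and>
     (\<exists>p. m \<le> p \<and> n \<le> p \<and> transport t m (p - m) x = transport t n (p - n) y)}"

definition limit_class ::
    "nat \<Rightarrow> (nat \<Rightarrow> ('k, 'h) module) \<Rightarrow> (nat \<Rightarrow> 'h \<Rightarrow> 'h) \<Rightarrow> nat \<Rightarrow> 'h \<Rightarrow> (nat \<times> 'h) set" where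
  "limit_class N H t n x = limit_rel N H t `` {(n, x)}"

text \<open>Any two classes have representatives in a common \<open>H p\<close>; the unions below are unions of copies
  of one and the same class.\<close>

definition direct_limit ::
    "nat \<Rightarrow> (nat \<Rightarrow> ('k, 'h) module) \<Rightarrow> (nat \<Rightarrow> 'h \<Rightarrow> 'h) \<Rightarrow> ('k, (nat \<times> 'h) set) module" where
  "direct_limit N H t = \<lparr>
     carrier = Sigma {N..} (\<lambda>n. carrier (H n)) // limit_rel N H t,
     mult = undefined, one = undefined,
     zero = limit_class N H t N \<zero>\<^bsub>H N\<^esub>,
     add = (\<lambda>A B. \<Union>{limit_class N H t p (x \<oplus>\<^bsub>H p\<^esub> y) | p x y. (p, x) \<in> A \<and> (p, y) \<in> B}),
     smult = (\<lambda>c A. \<Union>{limit_class N H t p (c \<odot>\<^bsub>H p\<^esub> x) | p x. (p, x) \<in> A})\<rparr>"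


section \<open>Stable multiplicity spaces\<close>

text \<open>For a partition \<open>\<nu>\<close> of \<open>m\<close>, the list \<open>padded \<nu> n\<close> is \<open>(n - m, \<nu>\<^sub>1, \<nu>\<^sub>2, \<dots>)\<close>. It is a
  partition of \<open>n\<close> if \<open>n \<ge> pad_bound \<nu> = m + \<nu>\<^sub>1\<close>; only such \<open>n\<close> enter the limit.\<close>

definition padded :: "nat list \<Rightarrow> nat \<Rightarrow> nat list" where
  "padded \<nu> n = (n - sum_list \<nu>) # \<nu>"

definition pad_bound :: "nat list \<Rightarrow> nat" where
  "pad_bound \<nu> = sum_list \<nu> + (if \<nu> = [] then 0 else hd \<nu>)"

type_synonym 'k free_Specht_elem = "(nat \<Rightarrow> nat) \<Rightarrow> (nat \<Rightarrow> nat) \<Rightarrow> 'k"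

abbreviation Sp :: "nat list \<Rightarrow> nat \<Rightarrow> ('k::field, (nat \<Rightarrow> nat) \<Rightarrow> 'k) sym_rep" where
  "Sp \<nu> n \<equiv> Specht n (padded \<nu> n)"

abbreviation M_Sp :: "nat list \<Rightarrow> nat \<Rightarrow> ('k::field, 'k free_Specht_elem) FI_module" where
  "M_Sp \<nu> n \<equiv> free_FI_module n (Sp \<nu> n)"

text \<open>By Pieri's rule the morphisms from \<open>M_Sp \<nu> (n + 1)\<close> to \<open>M_Sp \<nu> n\<close> form a line. The system
  defining the limit consists of a nonzero element of each of these lines. The choice is immaterial:
  replacing \<open>\<iota> n\<close> by a scalar multiple rescales the identifications with the limit by the same factor
  for all FI-modules.\<close>

definition Specht_system ::
    "nat list \<Rightarrow> (nat \<Rightarrow> nat \<Rightarrow> 'k::field free_Specht_elem \<Rightarrow> 'k free_Specht_elem) \<Rightarrow> bool" where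
  "Specht_system \<nu> \<iota> \<longleftrightarrow> (\<forall>n\<ge>pad_bound \<nu>.
     \<iota> n \<in> carrier (FI_Hom (M_Sp \<nu> (Suc n)) (M_Sp \<nu> n)) \<and>
     \<iota> n \<noteq> \<zero>\<^bsub>FI_Hom (M_Sp \<nu> (Suc n)) (M_Sp \<nu> n :: ('k, 'k free_Specht_elem) FI_module)\<^esub>)"

definition precompose ::
    "nat list \<Rightarrow> (nat \<Rightarrow> nat \<Rightarrow> 'k::field free_Specht_elem \<Rightarrow> 'k free_Specht_elem) \<Rightarrow>
     nat \<Rightarrow> (nat \<Rightarrow> 'k free_Specht_elem \<Rightarrow> 'v) \<Rightarrow> nat \<Rightarrow> 'k free_Specht_elem \<Rightarrow> 'v" where
  "precompose \<nu> \<iota> n \<phi> =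
     FI_comp (M_Sp \<nu> (Suc n) :: ('k, 'k free_Specht_elem) FI_module) \<phi> (\<iota> n)"

definition stable_mult ::
    "nat list \<Rightarrow> (nat \<Rightarrow> nat \<Rightarrow> 'k::field free_Specht_elem \<Rightarrow> 'k free_Specht_elem) \<Rightarrow>
     ('k, 'v) FI_module \<Rightarrow> ('k, (nat \<times> (nat \<Rightarrow> 'k free_Specht_elem \<Rightarrow> 'v)) set) module" where
  "stable_mult \<nu> \<iota> V =
     direct_limit (pad_bound \<nu>) (\<lambda>n. FI_Hom (M_Sp \<nu> n) V) (precompose \<nu> \<iota>)"

text \<open>The canonical map to the limit from the multiplicity space \<open>sym_Hom n (Sp \<nu> n) (rep_at V n)\<close>;
  for finitely generated \<open>V\<close> it is bijective for large \<open>n\<close>.\<close>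

definition to_stable ::
    "nat list \<Rightarrow> (nat \<Rightarrow> nat \<Rightarrow> 'k::field free_Specht_elem \<Rightarrow> 'k free_Specht_elem) \<Rightarrow>
     ('k, 'v) FI_module \<Rightarrow> nat \<Rightarrow> (((nat \<Rightarrow> nat) \<Rightarrow> 'k) \<Rightarrow> 'v) \<Rightarrow>
     (nat \<times> (nat \<Rightarrow> 'k free_Specht_elem \<Rightarrow> 'v)) set" where
  "to_stable \<nu> \<iota> V n \<psi> =
     limit_class (pad_bound \<nu>) (\<lambda>n. FI_Hom (M_Sp \<nu> n) V) (precompose \<nu> \<iota>) n
       (inv_into (carrier (FI_Hom (M_Sp \<nu> n) V))
          (free_restrict n (Sp \<nu> n :: ('k, (nat \<Rightarrow> nat) \<Rightarrow> 'k) sym_rep)) \<psi>)"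

definition stable_rel_map ::
    "nat list \<Rightarrow> (nat \<Rightarrow> nat \<Rightarrow> 'k::field free_Specht_elem \<Rightarrow> 'k free_Specht_elem) \<Rightarrow>
     'a FI_set \<Rightarrow> 'b FI_set \<Rightarrow> (nat \<Rightarrow> ('a \<times> 'b) set) \<Rightarrow> nat \<Rightarrow>
     (nat \<times> (nat \<Rightarrow> 'k free_Specht_elem \<Rightarrow> 'a \<Rightarrow> 'k)) set \<Rightarrow>
     (nat \<times> (nat \<Rightarrow> 'k free_Specht_elem \<Rightarrow> 'b \<Rightarrow> 'k)) set" where
  "stable_rel_map \<nu> \<iota> X Y R n A =
     to_stable \<nu> \<iota> (linearization Y) n
       (compose (carrier (space (Sp \<nu> n :: ('k, (nat \<Rightarrow> nat) \<Rightarrow> 'k) sym_rep))) (rel_map X Y R n)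
         (inv_into (sym_Hom n (Sp \<nu> n) (rep_at (linearization X) n))
            (to_stable \<nu> \<iota> (linearization X) n) A))"

end

(*
Let m be the size of nu. Row symmetrization of a polytabloid whose tableau has first row {m+1..n} gives a
vector u of Sp nu n that generates the module and spans the invariants of the row group. Hence a
morphism phi out of Sp nu n is determined by phi(u), a vector of k X_n fixed by Sym(m+1..n), and such
vectors have coordinates with respect to the averages of the Sym(m+1..n)-orbits on X_n. In these
coordinates the transition maps of the limit are, up to scalars not depending on X, given by the
inclusions [n] -> [n+1], which are bijective on orbits for large n if X is finitely generated. So the
stable multiplicity space embeds into the functions on finitely many orbits, compatibly with r_n.

The entry of r_n at the orbits of x and y is the number of elements of the orbit of y related to x. For x
in X_N it is a sum of sizes of Sym(N+1..n)-orbits, over a set of orbits that is eventually constant. The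
size of such an orbit is the quotient of two polynomials in n, both counting injections, and therefore a
polynomial, being an integer for all large n.
*)
theory Submission
  imports Defs "HOL-Library.Function_Algebras"
begin

section \<open>Counting functions that are eventually polynomial\<close>

text \<open>The obstacle is the identification with the limit: the system fixes each transition map
  only up to a nonzero factor, and these factors may vary with n in any way. They are collected in
  \<open>scaling\<close>, which is the same for X and for Y and therefore divides out of the matrix
  of \<open>stable_rel_map\<close>. An invariant vector is measured by its sums over orbits, not by
  its values. Sums are preserved by pushing forward along a map that is bijective on orbits, whereas
  values are rescaled by ratios of orbit sizes, which differ from orbit to orbit. The coordinates
  embed the limit in a finite-dimensional function space, possibly as a proper subspace. The
  functional that gives a basis coefficient is extended from the subspace to the whole space, so the
  entries in an arbitrary basis are linear combinations of orbit counts with coefficients not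
  depending on n. Characteristic zero is used to divide by group orders, by orbit sizes and by the
  norm of the row-symmetrized polytabloid.\<close>

text \<open>Allowing a denominator makes the notion stable under exact division.\<close>

definition quasi_polynomial :: "(nat \<Rightarrow> nat) \<Rightarrow> bool" where
  "quasi_polynomial a \<longleftrightarrow>
     (\<exists>(p :: int poly) c. c \<noteq> 0 \<and> (\<forall>\<^sub>F n in sequentially. c * int (a n) = poly p (int n)))"

lemma quasi_polynomial_eventually_cong:
  assumes "\<forall>\<^sub>F n in sequentially. a n = b n" and "quasi_polynomial b"
  shows "quasi_polynomial a"
proof -
  obtain p c where "c \<noteq> 0" and ev: "\<forall>\<^sub>F n in sequentially. c * int (b n) = poly p (int n)"
    using assms(2) unfolding quasi_polynomial_def by blast
  have "\<forall>\<^sub>F n in sequentially. c * int (a n) = poly p (int n)"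
    using ev assms(1) by eventually_elim simp
  then show ?thesis
    using \<open>c \<noteq> 0\<close> unfolding quasi_polynomial_def by blast
qed

lemma quasi_polynomial_0: "quasi_polynomial (\<lambda>n. 0)"
  unfolding quasi_polynomial_def by (intro exI[of _ 0] exI[of _ 1]) simp

lemma quasi_polynomial_add:
  assumes "quasi_polynomial a" and "quasi_polynomial b"
  shows "quasi_polynomial (\<lambda>n. a n + b n)"
proof -
  obtain p c where c: "c \<noteq> 0" and a: "\<forall>\<^sub>F n in sequentially. c * int (a n) = poly p (int n)"
    using assms(1) unfolding quasi_polynomial_def by blast
  obtain q d where d: "d \<noteq> 0" and b: "\<forall>\<^sub>F n in sequentially. d * int (b n) = poly q (int n)"
    using assms(2) unfolding quasi_polynomial_def by blast
  have "\<forall>\<^sub>F n in sequentially. (c * d) * int (a n + b n) =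
      poly (Polynomial.smult d p + Polynomial.smult c q) (int n)"
    using a b by eventually_elim (simp add: algebra_simps)
  then show ?thesis
    using c d unfolding quasi_polynomial_def
    by (intro exI[of _ "Polynomial.smult d p + Polynomial.smult c q"] exI[of _ "c * d"]) simp
qed

lemma quasi_polynomial_sum:
  assumes "\<And>x. x \<in> A \<Longrightarrow> quasi_polynomial (a x)"
  shows "quasi_polynomial (\<lambda>n. \<Sum>x\<in>A. a x n)"
  using assms
  by (induction A rule: infinite_finite_induct)
     (simp_all add: quasi_polynomial_0 quasi_polynomial_add)

lemma quasi_polynomial_falling: "quasi_polynomial (\<lambda>n. \<Prod>i = 0..<r. n - N - i)"
proof -
  have "\<forall>\<^sub>F n in sequentially. 1 * int (\<Prod>i = 0..<r. n - N - i) =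
      poly (\<Prod>i = 0..<r. [:- int (N + i), 1:]) (int n)"
    \<comment> \<open>From N + r on every truncated subtraction in the product is an honest
      one.\<close>
    using eventually_ge_at_top[of "N + r"]
    by eventually_elim (auto simp: poly_prod of_nat_diff intro!: prod.cong)
  then show ?thesis
    unfolding quasi_polynomial_def
    by (intro exI[of _ "\<Prod>i = 0..<r. [:- int (N + i), 1:]"] exI[of _ 1] conjI) simp_all
qed

section \<open>Growth of integer polynomials and exact division\<close>

text \<open>Horner form: once p(n) \<ge> 1, the value a + n p(n) is positive as soon as n exceeds
  the absolute value of a.\<close>

lemma poly_int_eventually_pos:
  fixes p :: "int poly"
  assumes "lead_coeff p > 0"
  shows "\<forall>\<^sub>F n in sequentially. poly p (int n) > 0"
  using assms
proof (induction p)
  case 0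
  then show ?case by simp
next
  case (pCons a p)
  show ?case
  proof (cases "p = 0")
    case True
    then show ?thesis using pCons.prems by simp
  next
    case False
    then have "lead_coeff p > 0"
      using pCons.prems by simp
    then have "\<forall>\<^sub>F n in sequentially. poly p (int n) > 0"
      using pCons.IH by blast
    then show ?thesis
      using eventually_gt_at_top[of "nat \<bar>a\<bar>"]
    proof eventually_elim
      case (elim n)
      have "int n * 1 \<le> int n * poly p (int n)"
        using elim(1) by (intro mult_left_mono) auto
      moreover have "int n > \<bar>a\<bar>"
        using elim(2) by linarith
      ultimately have "0 < a + int n * poly p (int n)"
        by linarith
      then show ?case
        by simp
    qed
  qed
qed

text \<open>If r has larger degree than p and positive leading coefficient, then r + p and r - p
  have the leading coefficient of r and are eventually positive, which bounds p from both sides. A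
  negative leading coefficient is handled by passing to the negative polynomial.\<close>

lemma poly_int_eventually_abs_less:
  fixes p q :: "int poly"
  assumes "degree p < degree q"
  shows "\<forall>\<^sub>F n in sequentially. \<bar>poly p (int n)\<bar> < \<bar>poly q (int n)\<bar>"
proof -
  have *: "\<forall>\<^sub>F n in sequentially. \<bar>poly p (int n)\<bar> < \<bar>poly r (int n)\<bar>"
    if "lead_coeff r > 0" "degree p < degree r" for r :: "int poly"
  proof -
    have "lead_coeff (r + p) > 0" "lead_coeff (r - p) > 0"
      using that degree_add_eq_left[of p r] degree_add_eq_left[of "- p" r] by (simp_all add: coeff_eq_0)
    then have "\<forall>\<^sub>F n in sequentially. poly (r + p) (int n) > 0"
      "\<forall>\<^sub>F n in sequentially. poly (r - p) (int n) > 0"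
      using poly_int_eventually_pos by blast+
    then show ?thesis
      by eventually_elim auto
  qed
  have "q \<noteq> 0" using assms by auto
  then consider "lead_coeff q > 0" | "lead_coeff (- q) > 0"
    by (metis leading_coeff_0_iff lead_coeff_minus linorder_neqE_linordered_idom neg_0_less_iff_less)
  then show ?thesis
  proof cases
    case 1
    then show ?thesis using * assms by blast
  next
    case 2
    then show ?thesis using *[of "- q"] assms by simp
  qed
qed

text \<open>A rational function taking integer values at all large integers is a polynomial: after pseudo
  division the remainder is a multiple of the divisor, and eventually smaller.\<close>

lemma quasi_polynomial_divide:
  assumes "quasi_polynomial a" and "quasi_polynomial f"
    and ev: "\<forall>\<^sub>F n in sequentially. a n = b n * f n \<and> f n > 0"
  shows "quasi_polynomial b"
proof -
  obtain p c where c: "c \<noteq> 0" and a: "\<forall>\<^sub>F n in sequentially. c * int (a n) = poly p (int n)"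
    using assms(1) unfolding quasi_polynomial_def by blast
  obtain q d where d: "d \<noteq> 0" and f: "\<forall>\<^sub>F n in sequentially. d * int (f n) = poly q (int n)"
    using assms(2) unfolding quasi_polynomial_def by blast
  have "\<forall>\<^sub>F n in sequentially. q \<noteq> 0"
    using f ev by eventually_elim (use d in auto)
  then have q: "q \<noteq> 0" by simp
  obtain s r where sr: "pseudo_divmod p q = (s, r)"
    by fastforce
  define l where "l = lead_coeff q ^ (Suc (degree p) - degree q)"
  have eq: "Polynomial.smult l p = q * s + r" and r: "r = 0 \<or> degree r < degree q"
    using pseudo_divmod[OF q sr] by (auto simp: l_def)
  have l: "l \<noteq> 0" using q by (simp add: l_def)
  have "\<forall>\<^sub>F n in sequentially. \<bar>poly (Polynomial.smult d r) (int n)\<bar> < \<bar>poly q (int n)\<bar>"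
  proof (cases "r = 0")
    case True
    have "\<forall>\<^sub>F n in sequentially. poly q (int n) \<noteq> 0"
      using f ev by eventually_elim (use d in auto)
    then show ?thesis using True by simp
  next
    case False
    then have "degree (Polynomial.smult d r) < degree q" using r d by simp
    then show ?thesis by (rule poly_int_eventually_abs_less)
  qed
  then have "\<forall>\<^sub>F n in sequentially. (l * c) * int (b n) = poly (Polynomial.smult d s) (int n)"
    using a f ev
  proof eventually_elim
    case (elim n)
    let ?f = "int (f n)" and ?x = "int n"
    \<comment> \<open>This integer is the quotient of the remainder by f(n): r(n) = e f(n), while
      q(n) = d f(n). Comparing d r with q, rather than r with q, cancels d and leaves an absolute
      value of e below 1.\<close>
    define e where "e = l * c * int (b n) - d * poly s ?x"
    have "l * poly p ?x = poly q ?x * poly s ?x + poly r ?x"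
      using arg_cong[OF eq, of "\<lambda>p. poly p ?x"] by simp
    moreover have "c * (int (b n) * ?f) = poly p ?x"
      using elim by simp
    ultimately have "poly r ?x = l * (c * (int (b n) * ?f)) - d * ?f * poly s ?x"
      using elim(3) by simp
    then have e: "poly r ?x = e * ?f"
      by (simp add: e_def algebra_simps)
    have "\<bar>d\<bar> * (\<bar>e\<bar> * ?f) < \<bar>d\<bar> * ?f"
      using elim(1) by (simp add: e elim(3)[symmetric] abs_mult)
    then have "\<bar>e\<bar> < 1"
      using elim(4) d by (simp add: mult_less_cancel_left)
    then show ?case
      by (simp add: e_def)
  qed
  then show ?thesis
    unfolding quasi_polynomial_def using l c by (meson mult_eq_0_iff)
qed

declare One_nat_def [simp del]

section \<open>Injections\<close>

abbreviation inc :: "nat \<Rightarrow> nat \<Rightarrow> nat" where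
  "inc n \<equiv> restrict id {1..n}"

lemma FI_homD:
  assumes "f \<in> FI_hom m n"
  shows "inj_on f {1..m}" and "f \<in> extensional {1..m}"
    and "\<And>k. k \<in> {1..m} \<Longrightarrow> f k \<in> {1..n}"
  using assms by (auto simp: FI_hom_def PiE_def Pi_def)

lemma finite_FI_hom [simp]: "finite (FI_hom m n)"
  by (rule finite_subset[of _ "{1..m} \<rightarrow>\<^sub>E {1..n}"]) (auto simp: FI_hom_def intro!: finite_PiE)

lemma FI_hom_eqI:
  assumes "f \<in> FI_hom m n" and "g \<in> FI_hom m n'" and "\<And>k. k \<in> {1..m} \<Longrightarrow> f k = g k"
  shows "f = g"
  using assms by (auto intro!: extensionalityI[of f "{1..m}" g] dest: FI_homD)

lemma compose_FI_hom [intro]: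
  assumes "f \<in> FI_hom l m" and "g \<in> FI_hom m n"
  shows "compose {1..l} g f \<in> FI_hom l n"
proof -
  have "inj_on (compose {1..l} g f) {1..l}"
    using FI_homD(1,3)[OF assms(1)] FI_homD(1)[OF assms(2)]
    by (intro inj_onI) (metis compose_eq inj_onD)
  then show ?thesis
    using FI_homD(3)[OF assms(1)] FI_homD(3)[OF assms(2)]
    by (auto simp: FI_hom_def compose_def intro!: restrict_PiE)
qed

lemma inc_FI_hom: "n \<le> p \<Longrightarrow> inc n \<in> FI_hom n p"
  by (auto simp: FI_hom_def inj_on_def)

lemma FI_hom_bij_betw:
  assumes "\<sigma> \<in> FI_hom n n"
  shows "bij_betw \<sigma> {1..n} {1..n}"
proof -
  have "\<sigma> ` {1..n} \<subseteq> {1..n}"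
    using FI_homD(3)[OF assms] by blast
  then show ?thesis
    using FI_homD(1)[OF assms] endo_inj_surj[of "{1..n}" \<sigma>] by (simp add: bij_betw_def)
qed

lemma FI_hom_selfI: "bij_betw \<sigma> {1..n} {1..n} \<Longrightarrow> \<sigma> \<in> extensional {1..n} \<Longrightarrow> \<sigma> \<in> FI_hom n n"
  by (auto simp: FI_hom_def bij_betw_def PiE_def)

lemma sym_inv_FI_hom:
  assumes "\<sigma> \<in> FI_hom n n"
  shows "sym_inv n \<sigma> \<in> FI_hom n n"
proof (rule FI_hom_selfI)
  have "bij_betw (inv_into {1..n} \<sigma>) {1..n} {1..n}"
    using FI_hom_bij_betw[OF assms] by (rule bij_betw_inv_into)
  then show "bij_betw (sym_inv n \<sigma>) {1..n} {1..n}"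
    by (simp add: sym_inv_def bij_betw_def inj_on_restrict_eq)
qed (simp add: sym_inv_def)

lemma sym_inv_left [simp]:
  assumes "\<sigma> \<in> FI_hom n n" and "k \<in> {1..n}"
  shows "sym_inv n \<sigma> (\<sigma> k) = k"
  using FI_homD[OF assms(1)] assms(2) by (simp add: sym_inv_def inv_into_f_f)

lemma sym_inv_right [simp]:
  assumes "\<sigma> \<in> FI_hom n n" and "k \<in> {1..n}"
  shows "\<sigma> (sym_inv n \<sigma> k) = k"
  using FI_hom_bij_betw[OF assms(1)] assms(2)
  by (simp add: sym_inv_def f_inv_into_f bij_betw_def)

lemma compose_sym_inv:
  assumes "\<sigma> \<in> FI_hom n n"
  shows "compose {1..n} (sym_inv n \<sigma>) \<sigma> = inc n" and "compose {1..n} \<sigma> (sym_inv n \<sigma>) = inc n"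
  using assms by (auto simp: compose_def)

lemma compose_inc_left:
  assumes "f \<in> FI_hom m n" and "n \<le> p"
  shows "compose {1..m} (inc p) f = f"
proof (rule extensionalityI[of _ "{1..m}"])
  show "f \<in> extensional {1..m}"
    using assms(1) by (rule FI_homD)
  show "compose {1..m} (inc p) f k = f k" if "k \<in> {1..m}" for k
    using FI_homD(3)[OF assms(1) that] assms(2) that by (simp add: compose_eq)
qed simp

lemma compose_inc_right:
  assumes "f \<in> extensional {1..m}"
  shows "compose {1..m} f (inc m) = f"
  using assms by (intro extensionalityI[of _ "{1..m}"]) (auto simp: compose_def)

lemma compose_compose_FI:
  assumes "f \<in> FI_hom l m" 
  shows "compose {1..l} (compose {1..m} h g) f = compose {1..l} h (compose {1..l} g f)"
  using FI_homD[OF assms] by (auto simp: compose_def)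

lemma bij_betw_compose_left:
  assumes "\<sigma> \<in> FI_hom n n"
  shows "bij_betw (compose {1..m} \<sigma>) (FI_hom m n) (FI_hom m n)"
proof (rule bij_betw_byWitness[of _ "compose {1..m} (sym_inv n \<sigma>)"])
  have "compose {1..m} (sym_inv n \<sigma>) (compose {1..m} \<sigma> f) = f"
    "compose {1..m} \<sigma> (compose {1..m} (sym_inv n \<sigma>) f) = f" if "f \<in> FI_hom m n" for f
    using that by (simp_all add: compose_compose_FI[symmetric] compose_sym_inv assms compose_inc_left)
  then show "\<forall>f\<in>FI_hom m n. compose {1..m} (sym_inv n \<sigma>) (compose {1..m} \<sigma> f) = f"
    "\<forall>f\<in>FI_hom m n. compose {1..m} \<sigma> (compose {1..m} (sym_inv n \<sigma>) f) = f"
    by blast+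
qed (use assms sym_inv_FI_hom in auto)

lemma bij_betw_compose_right:
  assumes "\<sigma> \<in> FI_hom n n"
  shows "bij_betw (\<lambda>f. compose {1..n} f \<sigma>) (FI_hom n m) (FI_hom n m)"
proof (rule bij_betw_byWitness[of _ "\<lambda>f. compose {1..n} f (sym_inv n \<sigma>)"])
  have "compose {1..n} (compose {1..n} f \<sigma>) (sym_inv n \<sigma>) = f"
    "compose {1..n} (compose {1..n} f (sym_inv n \<sigma>)) \<sigma> = f" if "f \<in> FI_hom n m" for f
    using that FI_homD[OF that] assms sym_inv_FI_hom[OF assms]
    by (simp_all add: compose_compose_FI compose_sym_inv compose_inc_right)
  then show "\<forall>f\<in>FI_hom n m. compose {1..n} (compose {1..n} f \<sigma>) (sym_inv n \<sigma>) = f"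
    "\<forall>f\<in>FI_hom n m. compose {1..n} (compose {1..n} f (sym_inv n \<sigma>)) \<sigma> = f"
    by blast+
qed (use assms sym_inv_FI_hom in auto)

section \<open>Permutations fixing an initial segment\<close>

text \<open>A copy of the symmetric group on N + 1, ..., n; for n \<le> N only the identity of [n]
  remains.\<close>

definition Fix :: "nat \<Rightarrow> nat \<Rightarrow> (nat \<Rightarrow> nat) set" where
  "Fix N n = {\<sigma> \<in> FI_hom n n. \<forall>k\<in>{1..n}. k \<le> N \<longrightarrow> \<sigma> k = k}"

lemma Fix_FI_hom: "\<sigma> \<in> Fix N n \<Longrightarrow> \<sigma> \<in> FI_hom n n"
  by (simp add: Fix_def)

lemma inc_Fix: "inc n \<in> Fix N n"
  by (simp add: Fix_def inc_FI_hom)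

lemma compose_Fix:
  assumes "\<sigma> \<in> Fix N n" and "\<tau> \<in> Fix N n"
  shows "compose {1..n} \<sigma> \<tau> \<in> Fix N n"
proof -
  have "compose {1..n} \<sigma> \<tau> k = k" if "k \<in> {1..n}" "k \<le> N" for k
    using assms that by (simp add: Fix_def compose_eq)
  then show ?thesis
    using assms compose_FI_hom[of \<sigma> n n \<tau> n] compose_FI_hom[of \<tau> n n \<sigma> n] by (simp add: Fix_def)
qed

lemma sym_inv_Fix:
  assumes "\<sigma> \<in> Fix N n"
  shows "sym_inv n \<sigma> \<in> Fix N n"
proof -
  have "sym_inv n \<sigma> k = k" if "k \<in> {1..n}" "k \<le> N" for k
    using assms that sym_inv_left[of \<sigma> n k] by (auto simp: Fix_def)
  then show ?thesis
    using assms sym_inv_FI_hom by (auto simp: Fix_def)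
qed

text \<open>The assignment f i \<mapsto> g i, together with the identity on the points up to N, is a
  well-defined bijection between two subsets of [n], since f and g agree wherever one of them takes
  a value up to N. The complements of the two subsets have equal size, so it extends to a
  permutation.\<close>

lemma Fix_transitive:
  assumes f: "f \<in> FI_hom K n" and g: "g \<in> FI_hom K n"
    and fg: "\<And>i. i \<in> {1..K} \<Longrightarrow> f i \<le> N \<or> g i \<le> N \<Longrightarrow> f i = g i"
  obtains \<sigma> where "\<sigma> \<in> Fix N n" and "compose {1..K} \<sigma> f = g"
proof -
  define L where "L = {k \<in> {1..n}. k \<le> N}"
  define A where "A = L \<union> f ` {1..K}"
  define B where "B = L \<union> g ` {1..K}"
  define \<phi> where "\<phi> k = (if k \<in> f ` {1..K} then g (inv_into {1..K} f k) else k)" for k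
  note f' = FI_homD[OF f] and g' = FI_homD[OF g]
  have \<phi>_f: "\<phi> (f i) = g i" if "i \<in> {1..K}" for i
    using that f' by (simp add: \<phi>_def)
  have \<phi>_L: "\<phi> k = k" if "k \<in> L" for k
    using that fg f' by (auto simp: \<phi>_def L_def) metis
  have "inj_on \<phi> A"
  proof (rule inj_onI)
    fix x y assume xy: "x \<in> A" "y \<in> A" "\<phi> x = \<phi> y"
    have *: "x = y" if "x \<in> L" "y = f i" "i \<in> {1..K}" "\<phi> x = \<phi> y" for x y i
      using that \<phi>_L \<phi>_f fg[of i] by (auto simp: L_def)
    have "x \<in> L \<or> (\<exists>i\<in>{1..K}. x = f i)" "y \<in> L \<or> (\<exists>i\<in>{1..K}. y = f i)"
      using xy(1,2) by (auto simp: A_def)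
    then show "x = y"
      using *[OF _ _ _ xy(3)] *[OF _ _ _ xy(3)[symmetric]] \<phi>_L \<phi>_f xy(3) inj_onD[OF g'(1)] by metis
  qed
  moreover have "\<phi> ` A = B"
  proof -
    have "\<phi> ` L = L" "(\<lambda>i. \<phi> (f i)) ` {1..K} = g ` {1..K}"
      using \<phi>_L \<phi>_f by (auto cong: image_cong_simp)
    then show ?thesis
      by (simp add: A_def B_def image_Un image_image)
  qed
  ultimately have bij: "bij_betw \<phi> A B"
    by (simp add: bij_betw_def)
  have sub: "A \<subseteq> {1..n}" "B \<subseteq> {1..n}"
    using f' g' by (auto simp: A_def B_def L_def)
  then have fin: "finite A" "finite B"
    by (auto intro: finite_subset)
  have "card ({1..n} - A) = card ({1..n} - B)"
    using sub fin bij_betw_same_card[OF bij] by (simp add: card_Diff_subset)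
  then obtain \<psi> where \<psi>: "bij_betw \<psi> ({1..n} - A) ({1..n} - B)"
    using finite_same_card_bij[of "{1..n} - A" "{1..n} - B"] by auto
  define \<sigma> where "\<sigma> = (\<lambda>k\<in>{1..n}. if k \<in> A then \<phi> k else \<psi> k)"
  have "bij_betw (\<lambda>k. if k \<in> A then \<phi> k else \<psi> k) (A \<union> ({1..n} - A)) (B \<union> ({1..n} - B))"
    using bij_betw_disjoint_Un[OF bij \<psi>] by blast
  moreover have "A \<union> ({1..n} - A) = {1..n}" "B \<union> ({1..n} - B) = {1..n}"
    using sub by auto
  ultimately have "bij_betw \<sigma> {1..n} {1..n}"
    unfolding \<sigma>_def by (simp only: bij_betw_restrict_eq)
  then have "\<sigma> \<in> FI_hom n n"
    by (rule FI_hom_selfI) (simp add: \<sigma>_def)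
  moreover have "\<sigma> k = k" if "k \<in> {1..n}" "k \<le> N" for k
    using that \<phi>_L by (auto simp: \<sigma>_def A_def L_def)
  moreover have "compose {1..K} \<sigma> f = g"
    using f' g' \<phi>_f by (intro extensionalityI[of _ "{1..K}" g]) (auto simp: compose_def \<sigma>_def A_def)
  ultimately show thesis
    by (intro that[of \<sigma>]) (auto simp: Fix_def)
qed

section \<open>Orbits on FI-sets\<close>

definition orb :: "'a FI_set \<Rightarrow> nat \<Rightarrow> nat \<Rightarrow> 'a \<Rightarrow> 'a set" where
  "orb X N n x = (\<lambda>\<sigma>. push X n n \<sigma> x) ` Fix N n"

abbreviation up :: "'a FI_set \<Rightarrow> nat \<Rightarrow> nat \<Rightarrow> 'a \<Rightarrow> 'a" where
  "up X n p \<equiv> push X n p (inc n)"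

context FI_set
begin

lemma up_closed: "n \<le> p \<Longrightarrow> x \<in> elems X n \<Longrightarrow> up X n p x \<in> elems X p"
  by (simp add: push_closed inc_FI_hom)

lemma up_up:
  assumes "n \<le> p" and "p \<le> q" and "x \<in> elems X n"
  shows "up X p q (up X n p x) = up X n q x"
  using push_compose[of "inc n" n p "inc p" q x] assms
  by (simp add: inc_FI_hom compose_inc_left[where n=n])

lemma orb_closed: "x \<in> elems X n \<Longrightarrow> orb X N n x \<subseteq> elems X n"
  by (auto simp: orb_def intro!: push_closed Fix_FI_hom)

lemma finite_orb [simp]: "finite (orb X N n x)"
  unfolding orb_def by (intro finite_imageI finite_subset[OF _ finite_FI_hom]) (auto dest: Fix_FI_hom)

lemma orb_self: "x \<in> elems X n \<Longrightarrow> x \<in> orb X N n x"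
  unfolding orb_def using inc_Fix push_id by force

lemma push_sym_inv:
  assumes "\<sigma> \<in> FI_hom n n" and "x \<in> elems X n"
  shows "push X n n (sym_inv n \<sigma>) (push X n n \<sigma> x) = x"
    and "push X n n \<sigma> (push X n n (sym_inv n \<sigma>) x) = x"
  using assms
  by (simp_all add: push_compose[symmetric] sym_inv_FI_hom compose_sym_inv push_id)

lemma push_Fix_orb:
  assumes "\<sigma> \<in> Fix N n" and "x \<in> elems X n" and "y \<in> orb X N n x"
  shows "push X n n \<sigma> y \<in> orb X N n x"
proof -
  obtain \<tau> where \<tau>: "\<tau> \<in> Fix N n" and y: "y = push X n n \<tau> x"
    using assms(3) by (auto simp: orb_def)
  then have "push X n n \<sigma> y = push X n n (compose {1..n} \<sigma> \<tau>) x"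
    using assms by (simp add: push_compose[of _ n n] Fix_FI_hom)
  then show ?thesis
    using compose_Fix[OF assms(1) \<tau>] by (auto simp: orb_def)
qed

lemma orb_sym:
  assumes "x \<in> elems X n" and "y \<in> orb X N n x"
  shows "x \<in> orb X N n y"
proof -
  obtain \<tau> where \<tau>: "\<tau> \<in> Fix N n" and y: "y = push X n n \<tau> x"
    using assms(2) by (auto simp: orb_def)
  then have "x = push X n n (sym_inv n \<tau>) y"
    using assms by (simp add: push_sym_inv Fix_FI_hom)
  then show ?thesis
    using sym_inv_Fix[OF \<tau>] by (auto simp: orb_def)
qed

lemma orb_trans:
  assumes "x \<in> elems X n" and "y \<in> orb X N n x" and "z \<in> orb X N n y"
  shows "z \<in> orb X N n x"
  using assms push_Fix_orb by (auto simp: orb_def[of X N n y])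

lemma orb_eq:
  assumes "x \<in> elems X n" and "y \<in> orb X N n x"
  shows "orb X N n y = orb X N n x"
proof -
  have "y \<in> elems X n" using assms orb_closed by blast
  then show ?thesis
    using assms orb_sym orb_trans by blast
qed

lemma orb_eq_iff:
  assumes "x \<in> elems X n" and "y \<in> elems X n"
  shows "orb X N n y = orb X N n x \<longleftrightarrow> y \<in> orb X N n x"
  using assms orb_eq orb_self by blast

text \<open>By \<open>Fix_transitive\<close> the two injections differ by an element of
  \<open>Fix N n\<close>. Membership in an orbit thus becomes a condition on the injections
  alone.\<close>

lemma push_in_orb:
  assumes "f \<in> FI_hom K n" and "g \<in> FI_hom K n" and "z \<in> elems X K"
    and "\<And>i. i \<in> {1..K} \<Longrightarrow> f i \<le> N \<or> g i \<le> N \<Longrightarrow> f i = g i"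
  shows "push X K n g z \<in> orb X N n (push X K n f z)"
proof -
  obtain \<sigma> where \<sigma>: "\<sigma> \<in> Fix N n" and "compose {1..K} \<sigma> f = g"
    using Fix_transitive[OF assms(1,2,4)] by blast
  then have "push X K n g z = push X n n \<sigma> (push X K n f z)"
    using assms by (simp add: push_compose[symmetric] Fix_FI_hom)
  then show ?thesis
    using \<sigma> by (auto simp: orb_def)
qed

text \<open>A permutation in \<open>Fix N n\<close> cannot send a point beyond N to a point up to N,
  because the latter is already the image of itself. Regarded as an injection into [p], it therefore
  meets the criterion of \<open>push_in_orb\<close> against the inclusion.\<close>

lemma up_orb:
  assumes "n \<le> p" and "x \<in> elems X n" and "y \<in> orb X N n x"
  shows "up X n p y \<in> orb X N p (up X n p x)"
proof -
  obtain \<sigma> where \<sigma>: "\<sigma> \<in> Fix N n" and y: "y = push X n n \<sigma> x"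
    using assms(3) by (auto simp: orb_def)
  have h: "compose {1..n} (inc p) \<sigma> = \<sigma>"
    using \<sigma> assms(1) by (intro compose_inc_left[where n=n]) (auto dest: Fix_FI_hom)
  have eq: "compose {1..n} (inc n) \<sigma> = \<sigma>"
    using \<sigma> by (intro compose_inc_left[where n=n]) (auto dest: Fix_FI_hom)
  have \<sigma>': "\<sigma> \<in> FI_hom n p"
    using compose_FI_hom[OF Fix_FI_hom[OF \<sigma>] inc_FI_hom[OF assms(1)]] eq by simp
  have "up X n p y = push X n p \<sigma> x"
    using push_compose[OF Fix_FI_hom[OF \<sigma>] inc_FI_hom[OF assms(1)] assms(2)] eq y by simp
  moreover have "push X n p \<sigma> x \<in> orb X N p (up X n p x)"
  proof (rule push_in_orb[OF inc_FI_hom[OF assms(1)] \<sigma>' assms(2)])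
    fix i assume i: "i \<in> {1..n}" "inc n i \<le> N \<or> \<sigma> i \<le> N"
    have "\<sigma> i \<in> {1..n}" using \<sigma> i FI_homD(3) Fix_FI_hom by blast
    show "inc n i = \<sigma> i"
    proof (cases "i \<le> N")
      case True
      then show ?thesis using \<sigma> i by (auto simp: Fix_def)
    next
      case False
      then have "\<sigma> i \<le> N" using i by simp
      then have "\<sigma> (\<sigma> i) = \<sigma> i" using \<sigma> \<open>\<sigma> i \<in> {1..n}\<close> by (auto simp: Fix_def)
      then show ?thesis
        using FI_homD(1)[OF Fix_FI_hom[OF \<sigma>]] i(1) \<open>\<sigma> i \<in> {1..n}\<close> by (auto dest: inj_onD)
    qed
  qed
  ultimately show ?thesis by simp
qed

end

section \<open>Stabilization of orbits under finite generation\<close>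

text \<open>The images of the generators form an FI-subset containing the generators, hence all of
  X; the bound is the largest degree of a generator.\<close>

lemma (in FI_set) generated_in_bounded_degree:
  assumes "finitely_generated X"
  obtains d where "\<And>p y. y \<in> elems X p \<Longrightarrow>
    \<exists>a\<le>d. \<exists>g\<in>FI_hom a p. \<exists>z\<in>elems X a. y = push X a p g z"
proof -
  obtain G where G: "finite G" "G \<subseteq> Sigma UNIV (elems X)"
    and gen: "\<And>Z. FI_subset Z X \<Longrightarrow> G \<subseteq> Sigma UNIV Z \<Longrightarrow> Z = elems X"
    using assms unfolding finitely_generated_def by blast
  define Z where "Z p = {push X a p g z | a g z. g \<in> FI_hom a p \<and> (a, z) \<in> G}" for p
  have "FI_subset Z X"
    unfolding FI_subset_def
  proof (intro conjI allI ballI subsetI)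
    fix n x assume "x \<in> Z n"
    then show "x \<in> elems X n"
      using G(2) by (auto simp: Z_def intro!: push_closed)
  next
    fix m n f x assume f: "f \<in> FI_hom m n" and "x \<in> Z m"
    then obtain a g z where g: "g \<in> FI_hom a m" "(a, z) \<in> G" and x: "x = push X a m g z"
      by (auto simp: Z_def)
    then have "push X m n f x = push X a n (compose {1..a} f g) z"
      using f G(2) push_compose[of g a m f n z] by auto
    then show "push X m n f x \<in> Z n"
      using compose_FI_hom[OF g(1) f] g(2) by (auto simp: Z_def)
  qed
  moreover have "G \<subseteq> Sigma UNIV Z"
  proof
    fix u assume u: "u \<in> G"
    then obtain a z where az: "u = (a, z)" "z \<in> elems X a"
      using G(2) by (cases u) auto
    have "push X a a (inc a) z \<in> Z a"
      unfolding Z_def using u az inc_FI_hom by blast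
    then show "u \<in> Sigma UNIV Z"
      using az by (simp add: push_id)
  qed
  ultimately have Z: "Z = elems X"
    by (rule gen)
  \<comment> \<open>The inserted 0 covers an empty set of generators.\<close>
  define d where "d = Max (insert 0 (fst ` G))"
  have d: "a \<le> d" if "(a, z) \<in> G" for a z
    unfolding d_def using G(1) that by (intro Max_ge) (auto intro: rev_image_eqI)
  have "\<exists>a\<le>d. \<exists>g\<in>FI_hom a p. \<exists>z\<in>elems X a. y = push X a p g z" if "y \<in> elems X p" for p y
  proof -
    have "y \<in> Z p" using that Z by simp
    then obtain a g z where "y = push X a p g z" "g \<in> FI_hom a p" "(a, z) \<in> G"
      by (auto simp: Z_def)
    then show ?thesis
      using d[of a z] G(2) by blast
  qed
  then show thesis
    using that by blast
qed

lemma decreasing_eventually_const: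
  fixes c :: "nat \<Rightarrow> nat"
  assumes "\<And>n p. n0 \<le> n \<Longrightarrow> n \<le> p \<Longrightarrow> c p \<le> c n"
  obtains n1 where "n0 \<le> n1" and "\<And>n. n1 \<le> n \<Longrightarrow> c n = c n1"
proof -
  obtain n1 where n1: "n0 \<le> n1" and min: "\<And>n. n0 \<le> n \<Longrightarrow> c n1 \<le> c n"
    using ex_has_least_nat[of "\<lambda>n. n0 \<le> n" n0 c, OF order_refl] by blast
  have "c n = c n1" if "n1 \<le> n" for n
    using assms[OF n1 that] min[of n] n1 that by linarith
  then show thesis
    using that n1 by blast
qed

text \<open>From degree n0 on, the inclusions induce bijections on the sets of orbits. This is
  spelled out on representatives, surjectivity in the first clause and injectivity in the
  second.\<close>

definition stable_from :: "'a FI_set \<Rightarrow> nat \<Rightarrow> nat \<Rightarrow> bool" where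
  "stable_from X N n0 \<longleftrightarrow> N \<le> n0 \<and>
     (\<forall>n p. n0 \<le> n \<and> n \<le> p \<longrightarrow>
       (\<forall>y\<in>elems X p. \<exists>x\<in>elems X n. y \<in> orb X N p (up X n p x)) \<and>
       (\<forall>x\<in>elems X n. \<forall>x'\<in>elems X n. up X n p x' \<in> orb X N p (up X n p x) \<longrightarrow> x' \<in> orb X N n x))"

text \<open>Surjectivity holds from N + d on, where d bounds the degrees of the generators. From
  there the finite number of orbits does not increase, so it becomes constant, and a surjection
  between finite sets of equal size is injective.\<close>

lemma (in FI_set) stable_from_exists:
  assumes "finitely_generated X"
  obtains n0 where "stable_from X N n0"
proof -
  obtain d where d: "\<And>p y. y \<in> elems X p \<Longrightarrow>
      \<exists>a\<le>d. \<exists>g\<in>FI_hom a p. \<exists>z\<in>elems X a. y = push X a p g z"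
    using generated_in_bounded_degree[OF assms] by blast
  have surj: "\<exists>x\<in>elems X n. y \<in> orb X N p (up X n p x)"
    if n: "N + d \<le> n" "n \<le> p" and y: "y \<in> elems X p" for n p y
  proof -
    obtain a g z where a: "a \<le> d" and g: "g \<in> FI_hom a p" and z: "z \<in> elems X a"
      and yz: "y = push X a p g z"
      using d[OF y] by blast
    \<comment> \<open>The values of g beyond N are moved to N + 1, ..., N + d. Using N + i at the
      argument i keeps h injective; since h keeps the values of g up to N, the orbit is unchanged,
      but h already lands in [n].\<close>
    define h where "h = (\<lambda>i\<in>{1..a}. if g i \<le> N then g i else N + i)"
    have "inj_on h {1..a}"
    proof (rule inj_onI)
      fix i j assume ij: "i \<in> {1..a}" "j \<in> {1..a}" "h i = h j"
      then have "g i = g j \<or> i = j"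
        by (auto simp: h_def split: if_splits)
      then show "i = j"
        using inj_onD[OF FI_homD(1)[OF g] _ ij(1,2)] by blast
    qed
    moreover have "h i \<in> {1..n}" if "i \<in> {1..a}" for i
      using FI_homD(3)[OF g that] n a that by (auto simp: h_def)
    ultimately have h: "h \<in> FI_hom a q" if "n \<le> q" for q
      using that by (fastforce simp: FI_hom_def h_def)
    have "push X a p h z = up X n p (push X a n h z)"
      using push_compose[OF h[OF order_refl] inc_FI_hom[OF n(2)] z]
      by (simp add: compose_inc_left[OF h[OF order_refl] order_refl])
    moreover have "y \<in> orb X N p (push X a p h z)"
      unfolding yz using n by (intro push_in_orb[OF h g z]) (auto simp: h_def)
    ultimately show ?thesis
      using push_closed[OF h[of n] z] by auto
  qed
  define orbits where "orbits n = orb X N n ` elems X n" for n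
  \<comment> \<open>The induced map on orbits, computed from an arbitrary representative.\<close>
  define \<phi> where "\<phi> n p A = orb X N p (up X n p (SOME x. x \<in> A))" for n p and A :: "'a set"
  have \<phi>: "\<phi> n p (orb X N n x) = orb X N p (up X n p x)" if "n \<le> p" "x \<in> elems X n" for n p x
  proof -
    have "(SOME y. y \<in> orb X N n x) \<in> orb X N n x"
      using orb_self[OF that(2)] by (rule someI)
    then show ?thesis
      unfolding \<phi>_def using that by (intro orb_eq up_orb up_closed)
  qed
  have onto: "\<phi> n p ` orbits n = orbits p" if "N + d \<le> n" "n \<le> p" for n p
  proof (intro equalityI subsetI)
    show "A \<in> orbits p" if "A \<in> \<phi> n p ` orbits n" for A
      using that \<open>n \<le> p\<close> by (auto simp: orbits_def \<phi> up_closed)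
  next
    fix A assume "A \<in> orbits p"
    then obtain y where y: "y \<in> elems X p" and A: "A = orb X N p y"
      by (auto simp: orbits_def)
    obtain x where x: "x \<in> elems X n" "y \<in> orb X N p (up X n p x)"
      using surj \<open>N + d \<le> n\<close> \<open>n \<le> p\<close> y by blast
    then have "A = \<phi> n p (orb X N n x)"
      using \<open>n \<le> p\<close> A by (simp add: \<phi> orb_eq[OF up_closed])
    then show "A \<in> \<phi> n p ` orbits n"
      using x by (auto simp: orbits_def)
  qed
  have fin: "finite (orbits n)" for n
    by (simp add: orbits_def finite_elems)
  have "card (orbits p) \<le> card (orbits n)" if "N + d \<le> n" "n \<le> p" for n p
    using onto[OF that] card_image_le[OF fin, of "\<phi> n p" n] by simp
  then obtain n1 where n1: "N + d \<le> n1" and const: "\<And>n. n1 \<le> n \<Longrightarrow> card (orbits n) = card (orbits n1)"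
    using decreasing_eventually_const[of "N + d" "\<lambda>n. card (orbits n)"] by blast
  have inj: "x' \<in> orb X N n x"
    if n: "n1 \<le> n" "n \<le> p" and x: "x \<in> elems X n" "x' \<in> elems X n"
      and up: "up X n p x' \<in> orb X N p (up X n p x)" for n p x x'
  proof -
    have "inj_on (\<phi> n p) (orbits n)"
      using onto[of n p] const[of n] const[of p] n n1 by (intro eq_card_imp_inj_on fin) simp
    moreover have "\<phi> n p (orb X N n x') = \<phi> n p (orb X N n x)"
      using n x orb_eq[OF up_closed[OF n(2) x(1)] up] by (simp add: \<phi>)
    ultimately have "orb X N n x' = orb X N n x"
      using x unfolding orbits_def by (blast dest: inj_onD)
    then show ?thesis
      using x by (simp add: orb_eq_iff)
  qed
  show thesis
  proof (rule that[of n1], unfold stable_from_def, intro conjI allI impI ballI)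
    show "N \<le> n1" using n1 by simp
    fix n p assume np: "n1 \<le> n \<and> n \<le> p"
    then have "N + d \<le> n" using n1 by simp
    then show "\<exists>x\<in>elems X n. y \<in> orb X N p (up X n p x)" if "y \<in> elems X p" for y
      using np that by (intro surj) auto
    show "x' \<in> orb X N n x" if "x \<in> elems X n" "x' \<in> elems X n"
      "up X n p x' \<in> orb X N p (up X n p x)" for x x'
      using inj[OF _ _ that] np by simp
  qed
qed

lemma stable_fromD:
  assumes "stable_from X N n0" and "n0 \<le> n" and "n \<le> p"
  shows "y \<in> elems X p \<Longrightarrow> \<exists>x\<in>elems X n. y \<in> orb X N p (up X n p x)"
    and "x \<in> elems X n \<Longrightarrow> x' \<in> elems X n \<Longrightarrow> up X n p x' \<in> orb X N p (up X n p x) \<Longrightarrow>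
      x' \<in> orb X N n x"
proof -
  have *: "(\<forall>y\<in>elems X p. \<exists>x\<in>elems X n. y \<in> orb X N p (up X n p x)) \<and>
      (\<forall>x\<in>elems X n. \<forall>x'\<in>elems X n. up X n p x' \<in> orb X N p (up X n p x) \<longrightarrow> x' \<in> orb X N n x)"
    using assms by (simp add: stable_from_def)
  show "y \<in> elems X p \<Longrightarrow> \<exists>x\<in>elems X n. y \<in> orb X N p (up X n p x)"
    using * by simp
  show "x \<in> elems X n \<Longrightarrow> x' \<in> elems X n \<Longrightarrow> up X n p x' \<in> orb X N p (up X n p x) \<Longrightarrow>
      x' \<in> orb X N n x"
    using * by simp
qed

lemma (in FI_set) transversal_exists:
  obtains T where "T \<subseteq> elems X n" and "\<And>x. x \<in> elems X n \<Longrightarrow> \<exists>!t. t \<in> T \<and> x \<in> orb X N n t"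
proof -
  define r where "r x = (SOME y. y \<in> orb X N n x)" for x
  have r: "r x \<in> orb X N n x" if "x \<in> elems X n" for x
    unfolding r_def using orb_self[OF that] by (rule someI)
  have r_cong: "r x = r y" if "x \<in> elems X n" "y \<in> orb X N n x" for x y
    using orb_eq[OF that] by (simp add: r_def)
  show thesis
  proof (rule that[of "r ` elems X n"])
    show "r ` elems X n \<subseteq> elems X n"
      using r orb_closed by blast
    fix x assume x: "x \<in> elems X n"
    show "\<exists>!t. t \<in> r ` elems X n \<and> x \<in> orb X N n t"
    proof (rule ex1I[of _ "r x"])
      show "r x \<in> r ` elems X n \<and> x \<in> orb X N n (r x)"
        using x r orb_sym by blast
      fix t assume t: "t \<in> r ` elems X n \<and> x \<in> orb X N n t"
      then obtain y where y: "y \<in> elems X n" "t = r y" by blast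
      then have "x \<in> orb X N n y"
        using t orb_trans r by blast
      then show "t = r x"
        using r_cong y by simp
    qed
  qed
qed

text \<open>A transversal chosen once in degree n0 is carried by the inclusions to a transversal in
  every degree n \<ge> n0. Sums over orbits thus get an index set that does not depend on n.\<close>

lemma (in FI_set) orbit_partition:
  assumes st: "stable_from X N n0" and n: "n0 \<le> n"
    and T: "T \<subseteq> elems X n0" and T1: "\<And>x. x \<in> elems X n0 \<Longrightarrow> \<exists>!t. t \<in> T \<and> x \<in> orb X N n0 t"
  shows "elems X n = (\<Union>t\<in>T. orb X N n (up X n0 n t))"
    and "t \<in> T \<Longrightarrow> t' \<in> T \<Longrightarrow> t \<noteq> t' \<Longrightarrow> orb X N n (up X n0 n t) \<inter> orb X N n (up X n0 n t') = {}"
proof -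
  have up: "up X n0 n t \<in> elems X n" if "t \<in> T" for t using T that n up_closed by blast
  show "elems X n = (\<Union>t\<in>T. orb X N n (up X n0 n t))"
  proof (intro equalityI subsetI)
    fix z assume "z \<in> elems X n"
    then obtain x where x: "x \<in> elems X n0" "z \<in> orb X N n (up X n0 n x)"
      using stable_fromD(1)[OF st order_refl n] by blast
    obtain t where t: "t \<in> T" "x \<in> orb X N n0 t" using T1[OF x(1)] by blast
    have "up X n0 n x \<in> orb X N n (up X n0 n t)"
      using up_orb[OF n _ t(2)] T t(1) by blast
    then show "z \<in> (\<Union>t\<in>T. orb X N n (up X n0 n t))"
      using orb_trans[OF up[OF t(1)]] x(2) t(1) by blast
  next
    fix z assume "z \<in> (\<Union>t\<in>T. orb X N n (up X n0 n t))"
    then show "z \<in> elems X n" using orb_closed[OF up] by blast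
  qed
  assume t: "t \<in> T" "t' \<in> T" "t \<noteq> t'"
  show "orb X N n (up X n0 n t) \<inter> orb X N n (up X n0 n t') = {}"
  proof (rule ccontr)
    assume "\<not> ?thesis"
    then obtain y where y: "y \<in> orb X N n (up X n0 n t)" "y \<in> orb X N n (up X n0 n t')" by blast
    have "up X n0 n t \<in> orb X N n (up X n0 n t')"
      using orb_trans[OF up[OF t(2)] y(2) orb_sym[OF up[OF t(1)] y(1)]] .
    then have "t \<in> orb X N n0 t'"
      using stable_fromD(2)[OF st order_refl n] T t by blast
    moreover have "t \<in> orb X N n0 t" using orb_self T t by blast
    ultimately show False using T1[of t] T t by blast
  qed
qed

section \<open>Counting in families stable under injections that fix an initial segment\<close>

text \<open>Stability is asked only for injections that fix 1, ..., N. The elements related to the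
  image of a fixed element of degree N form such a family, but in general not an FI-subset.\<close>

definition relative_subset :: "'a FI_set \<Rightarrow> nat \<Rightarrow> (nat \<Rightarrow> 'a set) \<Rightarrow> bool" where
  "relative_subset X N D \<longleftrightarrow> (\<forall>n\<ge>N. D n \<subseteq> elems X n) \<and>
     (\<forall>n\<ge>N. \<forall>p\<ge>n. \<forall>f\<in>FI_hom n p. \<forall>x\<in>D n. (\<forall>k\<in>{1..N}. f k = k) \<longrightarrow> push X n p f x \<in> D p)"

lemma finite_monotone_eventually:
  assumes "finite A" and "\<And>x n p. x \<in> A \<Longrightarrow> n \<ge> n0 \<Longrightarrow> n \<le> p \<Longrightarrow> Q n x \<Longrightarrow> Q p x"
  shows "\<forall>\<^sub>F n in sequentially. \<forall>x\<in>A. Q n x \<longleftrightarrow> (\<exists>m\<ge>n0. Q m x)"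
proof (rule eventually_ball_finite[OF assms(1)], rule ballI)
  fix x assume x: "x \<in> A"
  show "\<forall>\<^sub>F n in sequentially. Q n x \<longleftrightarrow> (\<exists>m\<ge>n0. Q m x)"
  proof (cases "\<exists>m\<ge>n0. Q m x")
    case True
    then obtain m where m: "m \<ge> n0" "Q m x" by blast
    show ?thesis
      using eventually_ge_at_top[of m] by eventually_elim (use assms(2)[OF x m(1)] m in blast)
  next
    case False
    show ?thesis
      using eventually_ge_at_top[of n0] by eventually_elim (use False in blast)
  qed
qed

text \<open>Whether the orbit of a transversal element lies in D can change with n only from no to
  yes, because the inclusions fix 1, ..., N. Polynomiality of orbit sizes is a hypothesis because
  the lemma is first applied to representable FI-sets, as an ingredient of the result on orbit sizes
  in general.\<close>

lemma (in FI_set) quasi_polynomial_relative_subset: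
  assumes "finitely_generated X" and D: "relative_subset X N D"
    and orb: "\<And>m x. N \<le> m \<Longrightarrow> x \<in> elems X m \<Longrightarrow> quasi_polynomial (\<lambda>n. card (orb X N n (up X m n x)))"
  shows "quasi_polynomial (\<lambda>n. card (D n))"
proof -
  obtain n0 where st: "stable_from X N n0"
    using stable_from_exists[OF assms(1)] by blast
  then have n0: "N \<le> n0" by (simp add: stable_from_def)
  obtain T where T: "T \<subseteq> elems X n0" and T1: "\<And>x. x \<in> elems X n0 \<Longrightarrow> \<exists>!t. t \<in> T \<and> x \<in> orb X N n0 t"
    using transversal_exists[of n0 N] by blast
  have finT: "finite T" using T finite_elems finite_subset by blast
  define T' where "T' = {t \<in> T. \<exists>n\<ge>n0. up X n0 n t \<in> D n}"
  have DX: "D n \<subseteq> elems X n" if "N \<le> n" for n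
    using D that by (auto simp: relative_subset_def)
  have D_Fix: "push X n n \<sigma> x \<in> D n" if "N \<le> n" "\<sigma> \<in> Fix N n" "x \<in> D n" for n \<sigma> x
  proof -
    have "\<forall>k\<in>{1..N}. \<sigma> k = k" using that by (auto simp: Fix_def)
    then show ?thesis
      using D that Fix_FI_hom[OF that(2)] unfolding relative_subset_def by blast
  qed
  have D_up: "up X n p x \<in> D p" if "N \<le> n" "n \<le> p" "x \<in> D n" for n p x
  proof -
    have "\<forall>k\<in>{1..N}. inc n k = k" using that by auto
    then show ?thesis
      using D that inc_FI_hom unfolding relative_subset_def by blast
  qed
  have "\<forall>\<^sub>F n in sequentially. \<forall>t\<in>T. up X n0 n t \<in> D n \<longleftrightarrow> (\<exists>m\<ge>n0. up X n0 m t \<in> D m)"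
  proof (rule finite_monotone_eventually[OF finT])
    fix t n p assume t: "t \<in> T" "n0 \<le> n" "n \<le> p" "up X n0 n t \<in> D n"
    then have "up X n p (up X n0 n t) \<in> D p" using D_up n0 by simp
    then show "up X n0 p t \<in> D p" using up_up t T by auto
  qed
  then have "\<forall>\<^sub>F n in sequentially. card (D n) = (\<Sum>t\<in>T'. card (orb X N n (up X n0 n t)))"
    using eventually_ge_at_top[of n0]
  proof eventually_elim
    case (elim n)
    have partition: "elems X n = (\<Union>t\<in>T. orb X N n (up X n0 n t))"
      by (rule orbit_partition(1)[OF st elim(2) T T1])
    have "D n = (\<Union>t\<in>T'. orb X N n (up X n0 n t))"
    proof (intro equalityI subsetI)
      fix y assume y: "y \<in> D n"
      then have "y \<in> elems X n" using DX[of n] n0 elim by auto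
      then obtain t where t: "t \<in> T" "y \<in> orb X N n (up X n0 n t)"
        unfolding partition by blast
      have "up X n0 n t \<in> orb X N n y"
        using orb_sym[OF up_closed[OF elim(2)] t(2)] t(1) T by blast
      then have "up X n0 n t \<in> D n"
        using y D_Fix n0 elim by (auto simp: orb_def)
      then show "y \<in> (\<Union>t\<in>T'. orb X N n (up X n0 n t))"
        using t elim by (auto simp: T'_def)
    next
      fix y assume "y \<in> (\<Union>t\<in>T'. orb X N n (up X n0 n t))"
      then obtain t where t: "t \<in> T'" "y \<in> orb X N n (up X n0 n t)" by blast
      then have "up X n0 n t \<in> D n" using elim by (auto simp: T'_def)
      then show "y \<in> D n"
        using t D_Fix n0 elim by (auto simp: orb_def)
    qed
    moreover have "orb X N n (up X n0 n t) \<inter> orb X N n (up X n0 n t') = {}"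
      if "t \<in> T'" "t' \<in> T'" "t \<noteq> t'" for t t'
      by (rule orbit_partition(2)[OF st elim(2) T T1]) (use that in \<open>simp_all add: T'_def\<close>)
    moreover have "finite T'" using finT by (simp add: T'_def)
    ultimately show ?case
      using card_UN_disjoint[of T' "\<lambda>t. orb X N n (up X n0 n t)"] by simp
  qed
  moreover have "quasi_polynomial (\<lambda>n. \<Sum>t\<in>T'. card (orb X N n (up X n0 n t)))"
    by (intro quasi_polynomial_sum orb[OF n0]) (use T in \<open>auto simp: T'_def\<close>)
  ultimately show ?thesis
    by (rule quasi_polynomial_eventually_cong)
qed

section \<open>Orbit sizes\<close>

definition representable :: "nat \<Rightarrow> (nat \<Rightarrow> nat) FI_set" where
  "representable K = \<lparr>elems = FI_hom K, push = (\<lambda>m n f g. compose {1..K} f g)\<rparr>"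

lemma elems_representable [simp]: "elems (representable K) = FI_hom K"
  and push_representable [simp]: "push (representable K) m n f g = compose {1..K} f g"
  by (simp_all add: representable_def)

lemma FI_set_representable: "FI_set (representable K)"
  by unfold_locales (auto simp: compose_compose_FI intro: compose_inc_left)

lemma finitely_generated_representable: "finitely_generated (representable K)"
proof -
  have "Z = FI_hom K" if Z: "FI_subset Z (representable K)" "{(K, inc K)} \<subseteq> Sigma UNIV Z" for Z
  proof
    fix n
    have "f \<in> Z n" if f: "f \<in> FI_hom K n" for f
    proof -
      have "compose {1..K} f (inc K) \<in> Z n"
        using Z f by (auto simp: FI_subset_def)
      then show ?thesis
        using compose_inc_right[OF FI_homD(2)[OF f]] by simp
    qed
    then show "Z n = FI_hom K n"
      using Z by (auto simp: FI_subset_def)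
  qed
  then show ?thesis
    unfolding finitely_generated_def
    by (intro exI[of _ "{(K, inc K)}"]) (auto simp: inc_FI_hom)
qed

text \<open>The group can change only the values of g beyond N, and by \<open>Fix_transitive\<close>
  these can become any r distinct elements of N + 1, ..., n, where r is their number. The orbit size
  is a falling factorial in n - N.\<close>

lemma quasi_polynomial_orb_representable:
  assumes "N \<le> m" and g: "g \<in> FI_hom K m"
  shows "quasi_polynomial (\<lambda>n. card (orb (representable K) N n (up (representable K) m n g)))"
proof -
  define S where "S = {i \<in> {1..K}. N < g i}"
  define r where "r = card S"
  have "\<forall>\<^sub>F n in sequentially. card (orb (representable K) N n (up (representable K) m n g)) =
      (\<Prod>i = 0..<r. n - N - i)"
    using eventually_ge_at_top[of m]
  proof eventually_elim
    case (elim n)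
    interpret M: FI_set "representable K" by (rule FI_set_representable)
    have g_n: "g \<in> FI_hom K n"
      using compose_FI_hom[OF g inc_FI_hom[OF elim]] compose_inc_left[OF g order_refl]
      by simp
    have up_g: "up (representable K) m n g = g"
      using compose_inc_left[OF g order_refl] by simp
    have orb: "orb (representable K) N n g =
        {h \<in> FI_hom K n. \<forall>i\<in>{1..K}. if i \<in> S then N < h i else h i = g i}"
    proof (intro equalityI subsetI)
      fix h assume "h \<in> orb (representable K) N n g"
      then obtain \<sigma> where \<sigma>: "\<sigma> \<in> Fix N n" and h: "h = compose {1..K} \<sigma> g"
        by (auto simp: orb_def)
      have "N < h i" if "i \<in> S" for i
      proof (rule ccontr)
        assume *: "\<not> N < h i"
        have i: "i \<in> {1..K}" "N < g i" using that by (auto simp: S_def)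
        then have gi: "g i \<in> {1..n}" using FI_homD(3)[OF g_n] by blast
        then have "\<sigma> (g i) \<in> {1..n}" using FI_homD(3)[OF Fix_FI_hom[OF \<sigma>]] by blast
        moreover have "\<sigma> (g i) \<le> N" using * i h by (simp add: compose_eq)
        ultimately have "\<sigma> (\<sigma> (g i)) = \<sigma> (g i)" using \<sigma> by (auto simp: Fix_def)
        then have "\<sigma> (g i) = g i"
          using FI_homD(1)[OF Fix_FI_hom[OF \<sigma>]] gi \<open>\<sigma> (g i) \<in> {1..n}\<close> by (auto dest: inj_onD)
        then show False using \<open>\<sigma> (g i) \<le> N\<close> i by simp
      qed
      moreover have "h i = g i" if "i \<in> {1..K}" "i \<notin> S" for i
        using that \<sigma> FI_homD(3)[OF g_n] h by (auto simp: S_def Fix_def compose_eq)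
      moreover have "h \<in> FI_hom K n"
        using compose_FI_hom[OF g_n Fix_FI_hom[OF \<sigma>]] h by simp
      ultimately show "h \<in> {h \<in> FI_hom K n. \<forall>i\<in>{1..K}. if i \<in> S then N < h i else h i = g i}"
        by auto
    next
      fix h assume h: "h \<in> {h \<in> FI_hom K n. \<forall>i\<in>{1..K}. if i \<in> S then N < h i else h i = g i}"
      have "g i = h i" if "i \<in> {1..K}" "g i \<le> N \<or> h i \<le> N" for i
      proof -
        have "if i \<in> S then N < h i else h i = g i"
          using h that(1) by blast
        then show ?thesis
          using that by (cases "i \<in> S") (auto simp: S_def)
      qed
      then obtain \<sigma> where "\<sigma> \<in> Fix N n" "compose {1..K} \<sigma> g = h"
        using Fix_transitive[OF g_n, of h N] h by blast
      then show "h \<in> orb (representable K) N n g"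
        by (auto simp: orb_def)
    qed
    have "bij_betw (\<lambda>h. restrict h S)
        {h \<in> FI_hom K n. \<forall>i\<in>{1..K}. if i \<in> S then N < h i else h i = g i}
        {h \<in> S \<rightarrow>\<^sub>E {N<..n}. inj_on h S}" (is "bij_betw _ ?A ?B")
    proof (rule bij_betw_byWitness[of _ "\<lambda>h. \<lambda>i\<in>{1..K}. if i \<in> S then h i else g i"])
      have SK: "S \<subseteq> {1..K}" by (auto simp: S_def)
      show "\<forall>h\<in>?A. (\<lambda>i\<in>{1..K}. if i \<in> S then restrict h S i else g i) = h"
        by (auto simp: fun_eq_iff FI_hom_def PiE_def extensional_def)
      show "\<forall>h\<in>?B. restrict (\<lambda>i\<in>{1..K}. if i \<in> S then h i else g i) S = h"
        by (auto simp: fun_eq_iff PiE_def extensional_def S_def)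
      show "(\<lambda>h. restrict h S) ` ?A \<subseteq> ?B"
        using SK by (force simp: FI_hom_def inj_on_restrict_eq intro: inj_on_subset)
      show "(\<lambda>h. \<lambda>i\<in>{1..K}. if i \<in> S then h i else g i) ` ?B \<subseteq> ?A"
      proof (rule image_subsetI)
        fix h assume h: "h \<in> ?B"
        let ?h = "\<lambda>i. if i \<in> S then h i else g i"
        have h_S: "h i \<in> {N<..n}" if "i \<in> S" for i
          using h that by auto
        have g_S: "g i \<le> N" if "i \<in> {1..K}" "i \<notin> S" for i
          using that by (auto simp: S_def)
        have "inj_on ?h {1..K}"
        proof (rule inj_onI)
          fix i j assume ij: "i \<in> {1..K}" "j \<in> {1..K}" "?h i = ?h j"
          show "i = j"
          proof (cases "i \<in> S"; cases "j \<in> S")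
            assume "i \<in> S" "j \<in> S"
            then show ?thesis using ij h by (auto dest: inj_onD)
          next
            assume "i \<notin> S" "j \<notin> S"
            then show ?thesis using ij FI_homD(1)[OF g] by (auto dest: inj_onD)
          next
            assume "i \<in> S" "j \<notin> S"
            then show ?thesis using ij h_S[of i] g_S[of j] by auto
          next
            assume "i \<notin> S" "j \<in> S"
            then show ?thesis using ij h_S[of j] g_S[of i] by auto
          qed
        qed
        moreover have "?h i \<in> {1..n}" if "i \<in> {1..K}" for i
          using that FI_homD(3)[OF g_n that] h_S[of i] by (cases "i \<in> S") auto
        ultimately have "(\<lambda>i\<in>{1..K}. ?h i) \<in> FI_hom K n"
          by (simp add: FI_hom_def inj_on_restrict_eq)
        then show "(\<lambda>i\<in>{1..K}. ?h i) \<in> ?A"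
          using h_S by auto
      qed
    qed
    moreover have "finite S" by (simp add: S_def)
    ultimately show ?case
      using card_inj_on_subset_funcset[of S "{N<..n}" S] bij_betw_same_card
      by (fastforce simp: up_g[simplified] orb r_def)
  qed
  then show ?thesis
    using quasi_polynomial_falling by (rule quasi_polynomial_eventually_cong)
qed

text \<open>The size of an orbit is the number of injections fixing \<open>1, \<dots>, N\<close> divided by the number of those
  that map \<open>z\<close> to a given point.\<close>

lemma (in FI_set) quasi_polynomial_orb:
  assumes "N \<le> K" and z: "z \<in> elems X K"
  shows "quasi_polynomial (\<lambda>n. card (orb X N n (up X K n z)))"
proof -
  interpret M: FI_set "representable K" by (rule FI_set_representable)
  \<comment> \<open>The orbit of the inclusion of [K], that is, the injections of [K] fixing 1, ...,
    N. Evaluation at z maps it onto the orbit in question, and F below is the fibre over the base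
    point.\<close>
  define \<Gamma> where "\<Gamma> n = orb (representable K) N n (up (representable K) K n (inc K))" for n
  define F where "F n = {g \<in> \<Gamma> n. push X K n g z = up X K n z}" for n
  have "compose {1..K} (inc K) (inc K) = inc K"
    by (auto simp: compose_def)
  then have \<Gamma>: "\<Gamma> n = {compose {1..K} \<sigma> (inc K) | \<sigma>. \<sigma> \<in> Fix N n}" for n
    by (auto simp: \<Gamma>_def orb_def)
  have \<Gamma>_FI: "\<Gamma> n \<subseteq> FI_hom K n" if "K \<le> n" for n
    using that by (auto simp: \<Gamma> intro!: compose_FI_hom[OF inc_FI_hom] dest: Fix_FI_hom)
  have \<Gamma>_iff: "\<Gamma> n = {g \<in> FI_hom K n. \<forall>k\<in>{1..N}. g k = k}" if "K \<le> n" for n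
  proof (intro equalityI subsetI)
    fix g assume g: "g \<in> \<Gamma> n"
    then obtain \<sigma> where "\<sigma> \<in> Fix N n" "g = compose {1..K} \<sigma> (inc K)"
      by (auto simp: \<Gamma>)
    then show "g \<in> {g \<in> FI_hom K n. \<forall>k\<in>{1..N}. g k = k}"
      using g \<Gamma>_FI[OF that] assms(1) that by (auto simp: Fix_def compose_eq)
  next
    fix g assume g: "g \<in> {g \<in> FI_hom K n. \<forall>k\<in>{1..N}. g k = k}"
    have "inc K i = g i" if i: "i \<in> {1..K}" "inc K i \<le> N \<or> g i \<le> N" for i
    proof (cases "i \<le> N")
      case True
      then show ?thesis using i g by auto
    next
      case False
      then have "g i \<in> {1..N}" using i g FI_homD(3)[of g K n i] by auto
      then have "g (g i) = g i" "g i \<in> {1..K}" using g assms(1) by auto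
      then show ?thesis using g i FI_homD(1)[of g K n] by (auto dest: inj_onD)
    qed
    then obtain \<sigma> where "\<sigma> \<in> Fix N n" "compose {1..K} \<sigma> (inc K) = g"
      using Fix_transitive[OF inc_FI_hom[OF \<open>K \<le> n\<close>], of g N] g by blast
    then show "g \<in> \<Gamma> n" by (auto simp: \<Gamma>)
  qed
  have "quasi_polynomial (\<lambda>n. card (\<Gamma> n))"
    unfolding \<Gamma>_def by (rule quasi_polynomial_orb_representable[OF assms(1)]) (simp add: inc_FI_hom)
  \<comment> \<open>Composing with an injection that fixes all of [K] preserves the image of z, so F
    is a relative subset at level K rather than N. Its size is then governed by orbits in the
    representable FI-set.\<close>
  moreover have "quasi_polynomial (\<lambda>n. card (F n))"
  proof (rule M.quasi_polynomial_relative_subset[OF finitely_generated_representable, of K])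
    show "relative_subset (representable K) K F"
      unfolding relative_subset_def
    proof (intro conjI allI impI ballI)
      fix n assume "K \<le> n"
      then show "F n \<subseteq> elems (representable K) n"
        using \<Gamma>_FI by (auto simp: F_def)
    next
      fix n p f g assume n: "K \<le> n" "n \<le> p" and f: "f \<in> FI_hom n p" and g: "g \<in> F n"
        and fK: "\<forall>k\<in>{1..K}. f k = k"
      have gF: "g \<in> FI_hom K n" "\<forall>k\<in>{1..N}. g k = k" "push X K n g z = up X K n z"
        using g n by (auto simp: F_def \<Gamma>_iff)
      have "compose {1..K} f g \<in> \<Gamma> p"
        using gF compose_FI_hom[OF gF(1) f] fK assms(1) n by (auto simp: \<Gamma>_iff compose_eq)
      moreover have "compose {1..K} f (inc K) = inc K"
        using fK by (auto simp: compose_def)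
      then have "push X K p (compose {1..K} f g) z = up X K p z"
        using gF(3) push_compose[OF gF(1) f z] push_compose[OF inc_FI_hom[OF n(1)] f z] by simp
      ultimately show "push (representable K) n p f g \<in> F p"
        by (simp add: F_def)
    qed
  qed (use quasi_polynomial_orb_representable in simp)
  moreover have "\<forall>\<^sub>F n in sequentially. card (\<Gamma> n) = card (orb X N n (up X K n z)) * card (F n) \<and> card (F n) > 0"
    using eventually_ge_at_top[of K]
  proof eventually_elim
    case (elim n)
    have fin: "finite (\<Gamma> n)" using \<Gamma>_FI[OF elim] finite_FI_hom by (rule finite_subset)
    have act: "push X K n (compose {1..K} \<sigma> g) z = push X n n \<sigma> (push X K n g z)"
      if "\<sigma> \<in> Fix N n" "g \<in> FI_hom K n" for \<sigma> g
      using that z by (simp add: push_compose Fix_FI_hom)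
    have into: "push X K n g z \<in> orb X N n (up X K n z)" if "g \<in> \<Gamma> n" for g
      using that act inc_FI_hom[OF elim] by (auto simp: \<Gamma> orb_def)
    \<comment> \<open>All fibres of the evaluation are translates of F by permutations in
      \<open>Fix N n\<close>.\<close>
    have "card {g \<in> \<Gamma> n. push X K n g z = y} = card (F n)" if y: "y \<in> orb X N n (up X K n z)" for y
    proof -
      obtain \<sigma> where \<sigma>: "\<sigma> \<in> Fix N n" and y': "y = push X n n \<sigma> (up X K n z)"
        using y by (auto simp: orb_def)
      note \<sigma>' = Fix_FI_hom[OF \<sigma>]
      have up: "up X K n z \<in> elems X n" using z elim by (rule up_closed[rotated])
      have \<Gamma>_act: "compose {1..K} \<tau> g \<in> \<Gamma> n" if "\<tau> \<in> Fix N n" "g \<in> \<Gamma> n" for \<tau> g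
        using that unfolding \<Gamma>_iff[OF elim]
        using compose_FI_hom[OF _ Fix_FI_hom] assms(1) elim by (auto simp: compose_eq Fix_def)
      have "bij_betw (compose {1..K} \<sigma>) (F n) {g \<in> \<Gamma> n. push X K n g z = y}"
      proof (rule bij_betw_byWitness[of _ "compose {1..K} (sym_inv n \<sigma>)"])
        show "\<forall>g\<in>F n. compose {1..K} (sym_inv n \<sigma>) (compose {1..K} \<sigma> g) = g"
          "\<forall>g\<in>{g \<in> \<Gamma> n. push X K n g z = y}. compose {1..K} \<sigma> (compose {1..K} (sym_inv n \<sigma>) g) = g"
          using \<Gamma>_FI[OF elim] \<sigma>'
          by (auto simp: F_def compose_compose_FI[symmetric, of _ K n] compose_sym_inv compose_inc_left[of _ K n] subset_iff)
        show "compose {1..K} \<sigma> ` F n \<subseteq> {g \<in> \<Gamma> n. push X K n g z = y}"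
          using \<Gamma>_act[OF \<sigma>] act[OF \<sigma>] \<Gamma>_FI[OF elim] y' by (auto simp: F_def subset_iff)
        show "compose {1..K} (sym_inv n \<sigma>) ` {g \<in> \<Gamma> n. push X K n g z = y} \<subseteq> F n"
          using \<Gamma>_act[OF sym_inv_Fix[OF \<sigma>]] act[OF sym_inv_Fix[OF \<sigma>]] \<Gamma>_FI[OF elim] y'
            push_sym_inv(1)[OF \<sigma>' up] by (auto simp: F_def subset_iff)
      qed
      then show ?thesis using bij_betw_same_card by fastforce
    qed
    then have "(\<Sum>y\<in>orb X N n (up X K n z). card {g \<in> \<Gamma> n. push X K n g z = y}) =
        card (orb X N n (up X K n z)) * card (F n)"
      by simp
    moreover have "card (\<Gamma> n) = (\<Sum>y\<in>orb X N n (up X K n z). card {g \<in> \<Gamma> n. push X K n g z = y})"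
    proof -
      have "(\<lambda>g. push X K n g z) ` \<Gamma> n \<subseteq> orb X N n (up X K n z)"
        using into by blast
      then show ?thesis
        using sum_fun_comp[OF fin finite_orb, where f = "\<lambda>_. 1::nat"] by fastforce
    qed
    moreover have "inc K \<in> F n"
      using elim inc_FI_hom assms(1) by (auto simp: F_def \<Gamma>_iff)
    then have "card (F n) > 0"
      using fin by (auto simp: card_gt_0_iff F_def)
    ultimately show ?case by simp
  qed
  ultimately show ?thesis
    by (rule quasi_polynomial_divide)
qed

declare sign_on_cong [cong del]

section \<open>Tableaux and polytabloids\<close>

lemma finite_diagram [simp]: "finite (diagram \<mu>)"
proof -
  have "diagram \<mu> = (\<Union>i<length \<mu>. Pair i ` {..<\<mu> ! i})"
    by (auto simp: diagram_def)
  then show ?thesis by simp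
qed

definition column :: "nat list \<Rightarrow> (nat \<times> nat \<Rightarrow> nat) \<Rightarrow> nat \<Rightarrow> nat" where
  "column \<mu> T k = snd (inv_into (diagram \<mu>) T k)"

text \<open>Row groups, column groups and the symmetric group on a subset of the entries all arise
  as stabilizers of a labelling.\<close>

definition stabilizer :: "nat \<Rightarrow> (nat \<Rightarrow> 'c) \<Rightarrow> (nat \<Rightarrow> nat) set" where
  "stabilizer n lab = {\<rho> \<in> FI_hom n n. \<forall>k\<in>{1..n}. lab (\<rho> k) = lab k}"

lemma stabilizer_FI_hom: "\<rho> \<in> stabilizer n lab \<Longrightarrow> \<rho> \<in> FI_hom n n"
  by (simp add: stabilizer_def)

lemma finite_stabilizer [simp]: "finite (stabilizer n lab)"
  by (rule finite_subset[OF _ finite_FI_hom]) (auto dest: stabilizer_FI_hom)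

lemma inc_stabilizer: "inc n \<in> stabilizer n lab"
  by (auto simp: stabilizer_def inc_FI_hom)

lemma compose_stabilizer:
  assumes "\<rho> \<in> stabilizer n lab" and "\<tau> \<in> stabilizer n lab"
  shows "compose {1..n} \<rho> \<tau> \<in> stabilizer n lab"
proof -
  have "lab (compose {1..n} \<rho> \<tau> k) = lab k" if "k \<in> {1..n}" for k
    using assms that FI_homD(3)[of \<tau> n n k] by (simp add: stabilizer_def compose_eq)
  then show ?thesis
    using compose_FI_hom[of \<tau> n n \<rho> n] assms by (simp add: stabilizer_def)
qed

lemma sym_inv_stabilizer:
  assumes "\<rho> \<in> stabilizer n lab"
  shows "sym_inv n \<rho> \<in> stabilizer n lab"
proof -
  have "lab (sym_inv n \<rho> k) = lab k" if k: "k \<in> {1..n}" for k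
  proof -
    have "sym_inv n \<rho> k \<in> {1..n}"
      using FI_homD(3)[OF sym_inv_FI_hom[OF stabilizer_FI_hom[OF assms]] k] .
    then have "lab (\<rho> (sym_inv n \<rho> k)) = lab (sym_inv n \<rho> k)"
      using assms by (simp add: stabilizer_def)
    then show ?thesis
      using sym_inv_right[OF stabilizer_FI_hom[OF assms] k] by simp
  qed
  then show ?thesis
    using sym_inv_FI_hom[OF stabilizer_FI_hom[OF assms]] by (simp add: stabilizer_def)
qed

lemma bij_betw_stabilizer_right:
  assumes \<tau>: "\<tau> \<in> stabilizer n lab"
  shows "bij_betw (\<lambda>\<rho>. compose {1..n} \<rho> \<tau>) (stabilizer n lab) (stabilizer n lab)"
proof -
  note \<tau>' = stabilizer_FI_hom[OF \<tau>]
  have inj: "inj_on (\<lambda>\<rho>. compose {1..n} \<rho> \<tau>) (stabilizer n lab)"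
    using bij_betw_compose_right[OF \<tau>', of n]
    by (rule inj_on_subset[OF bij_betw_imp_inj_on]) (auto dest: stabilizer_FI_hom)
  have "(\<lambda>\<rho>. compose {1..n} \<rho> \<tau>) ` stabilizer n lab \<subseteq> stabilizer n lab"
    using compose_stabilizer \<tau> by blast
  then show ?thesis
    using inj endo_inj_surj[OF finite_stabilizer] by (simp add: bij_betw_def)
qed

definition tswap :: "nat \<Rightarrow> nat \<Rightarrow> nat \<Rightarrow> nat \<Rightarrow> nat" where
  "tswap n p q = restrict (Transposition.transpose p q) {1..n}"

lemma tswap_stabilizer:
  assumes "p \<in> {1..n}" and "q \<in> {1..n}" and "lab p = lab q"
  shows "tswap n p q \<in> stabilizer n lab"
proof -
  have "bij_betw (Transposition.transpose p q) {1..n} {1..n}"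
    using assms by (intro permutes_imp_bij permutes_swap_id)
  then have "tswap n p q \<in> FI_hom n n"
    unfolding tswap_def by (intro FI_hom_selfI) (simp_all only: bij_betw_restrict_eq restrict_extensional)
  then show ?thesis
    using assms by (auto simp: stabilizer_def tswap_def Transposition.transpose_def)
qed

abbreviation sgn_perm :: "nat \<Rightarrow> (nat \<Rightarrow> nat) \<Rightarrow> int" where
  "sgn_perm n \<sigma> \<equiv> sign_on {1..n} \<sigma>"

lemma sgn_perm_compose:
  assumes "\<sigma> \<in> FI_hom n n" and "\<tau> \<in> FI_hom n n"
  shows "sgn_perm n (compose {1..n} \<sigma> \<tau>) = sgn_perm n \<sigma> * sgn_perm n \<tau>"
proof -
  have "sgn_perm n (compose {1..n} \<sigma> \<tau>) = sgn_perm n (\<sigma> \<circ> \<tau>)"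
    by (rule sign_on_cong) (simp_all add: compose_eq)
  also have "\<dots> = sgn_perm n \<sigma> * sgn_perm n \<tau>"
    using assms by (intro sign_on_compose FI_hom_bij_betw) simp_all
  finally show ?thesis .
qed

lemma sgn_perm_inc: "sgn_perm n (inc n) = 1"
proof -
  have "sgn_perm n (inc n) = sgn_perm n id"
    by (rule sign_on_cong) simp_all
  then show ?thesis by simp
qed

lemma sgn_perm_tswap:
  assumes "p \<in> {1..n}" and "q \<in> {1..n}" and "p \<noteq> q"
  shows "sgn_perm n (tswap n p q) = - 1"
proof -
  have "sgn_perm n (tswap n p q) = sgn_perm n (Transposition.transpose p q)"
    by (rule sign_on_cong) (simp_all add: tswap_def)
  then show ?thesis
    using assms by (simp add: sign_on_transpose)
qed

lemma sgn_perm_sym_inv: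
  assumes "\<sigma> \<in> FI_hom n n"
  shows "sgn_perm n \<sigma> * sgn_perm n (sym_inv n \<sigma>) = 1"
  using assms sgn_perm_compose[OF assms sym_inv_FI_hom[OF assms]]
  by (simp add: compose_sym_inv sgn_perm_inc)

locale tableau =
  fixes n :: nat and \<mu> :: "nat list" and T :: "nat \<times> nat \<Rightarrow> nat"
  assumes tableau: "T \<in> tableaux n \<mu>"
begin

lemma bij: "bij_betw T (diagram \<mu>) {1..n}"
  using tableau by (simp add: tableaux_def)

lemma ext: "T \<in> extensional (diagram \<mu>)"
  using tableau by (simp add: tableaux_def)

lemma entry: "b \<in> diagram \<mu> \<Longrightarrow> T b \<in> {1..n}"
  using bij by (auto simp: bij_betw_def)

lemma inv_T [simp]: "b \<in> diagram \<mu> \<Longrightarrow> inv_into (diagram \<mu>) T (T b) = b"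
  using bij by (simp add: bij_betw_def inv_into_f_f)

lemma entryE:
  assumes "k \<in> {1..n}"
  obtains b where "b \<in> diagram \<mu>" and "k = T b"
  using assms bij unfolding bij_betw_def by blast

lemma tabloid_T [simp]: "b \<in> diagram \<mu> \<Longrightarrow> tabloid n \<mu> T (T b) = fst b"
  using entry by (simp add: tabloid_def)

lemma column_T [simp]: "b \<in> diagram \<mu> \<Longrightarrow> column \<mu> T (T b) = snd b"
  by (simp add: column_def)

lemma row_column_inj:
  assumes "k \<in> {1..n}" and "l \<in> {1..n}"
    and "tabloid n \<mu> T k = tabloid n \<mu> T l" and "column \<mu> T k = column \<mu> T l"
  shows "k = l"
  using assms by (elim entryE) (auto simp: prod_eq_iff)

lemma column_stabilizer_eq: "column_stabilizer n \<mu> T = stabilizer n (column \<mu> T)"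
proof -
  have "(\<forall>b\<in>diagram \<mu>. snd (inv_into (diagram \<mu>) T (\<sigma> (T b))) = snd b) \<longleftrightarrow>
      (\<forall>k\<in>{1..n}. column \<mu> T (\<sigma> k) = column \<mu> T k)" for \<sigma>
  proof (intro iffI ballI)
    fix k assume *: "\<forall>b\<in>diagram \<mu>. snd (inv_into (diagram \<mu>) T (\<sigma> (T b))) = snd b" and "k \<in> {1..n}"
    then obtain b where "b \<in> diagram \<mu>" "k = T b" by (blast elim: entryE)
    then show "column \<mu> T (\<sigma> k) = column \<mu> T k"
      using * by (simp add: column_def)
  next
    fix b assume *: "\<forall>k\<in>{1..n}. column \<mu> T (\<sigma> k) = column \<mu> T k" and b: "b \<in> diagram \<mu>"
    then have "column \<mu> T (\<sigma> (T b)) = column \<mu> T (T b)"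
      using entry by blast
    then show "snd (inv_into (diagram \<mu>) T (\<sigma> (T b))) = snd b"
      using b by (simp add: column_def)
  qed
  then show ?thesis
    by (simp add: column_stabilizer_def stabilizer_def)
qed

lemma tabloid_in: "tabloid n \<mu> T \<in> tabloids n \<mu>"
  using tableau by (simp add: tabloids_def)

lemma compose_tableau:
  assumes "\<sigma> \<in> FI_hom n n"
  shows "compose (diagram \<mu>) \<sigma> T \<in> tableaux n \<mu>"
proof -
  have "bij_betw (\<sigma> \<circ> T) (diagram \<mu>) {1..n}"
    using bij FI_hom_bij_betw[OF assms] by (rule bij_betw_trans)
  then have "bij_betw (compose (diagram \<mu>) \<sigma> T) (diagram \<mu>) {1..n}"
    by (simp add: compose_def o_def)
  then show ?thesis by (simp add: tableaux_def)
qed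

end

lemma tableauI: "T \<in> tableaux n \<mu> \<Longrightarrow> tableau n \<mu> T"
  by (rule tableau.intro)

lemma tabloid_extensional: "t \<in> tabloids n \<mu> \<Longrightarrow> t \<in> extensional {1..n}"
  by (auto simp: tabloids_def tabloid_def)

lemma column_compose:
  assumes T: "T \<in> tableaux n \<mu>" and \<sigma>: "\<sigma> \<in> FI_hom n n" and k: "k \<in> {1..n}"
  shows "column \<mu> (compose (diagram \<mu>) \<sigma> T) (\<sigma> k) = column \<mu> T k"
    and "tabloid n \<mu> (compose (diagram \<mu>) \<sigma> T) (\<sigma> k) = tabloid n \<mu> T k"
proof -
  interpret T: tableau n \<mu> T using T by (rule tableauI)
  interpret S: tableau n \<mu> "compose (diagram \<mu>) \<sigma> T" using T.compose_tableau[OF \<sigma>] by (rule tableauI)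
  obtain b where b: "b \<in> diagram \<mu>" "k = T b" using k by (rule T.entryE)
  show "column \<mu> (compose (diagram \<mu>) \<sigma> T) (\<sigma> k) = column \<mu> T k"
    using S.column_T[OF b(1)] b by (simp add: compose_eq)
  show "tabloid n \<mu> (compose (diagram \<mu>) \<sigma> T) (\<sigma> k) = tabloid n \<mu> T k"
    using S.tabloid_T[OF b(1)] b by (simp add: compose_eq)
qed

lemma tabloid_compose:
  assumes T: "T \<in> tableaux n \<mu>" and \<sigma>: "\<sigma> \<in> FI_hom n n"
  shows "compose {1..n} (tabloid n \<mu> (compose (diagram \<mu>) \<sigma> T)) \<sigma> = tabloid n \<mu> T"
  using column_compose(2)[OF T \<sigma>]
  by (intro extensionalityI[of _ "{1..n}"]) (auto simp: compose_eq tabloid_def)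

lemma compose_tabloids:
  assumes t: "t \<in> tabloids n \<mu>" and \<sigma>: "\<sigma> \<in> FI_hom n n"
  shows "compose {1..n} t \<sigma> \<in> tabloids n \<mu>"
proof -
  obtain T where T: "T \<in> tableaux n \<mu>" and t': "t = tabloid n \<mu> T"
    using t by (auto simp: tabloids_def)
  interpret T: tableau n \<mu> T using T by (rule tableauI)
  note \<tau> = sym_inv_FI_hom[OF \<sigma>]
  have "compose {1..n} t \<sigma> =
      compose {1..n} (compose {1..n} (tabloid n \<mu> (compose (diagram \<mu>) (sym_inv n \<sigma>) T)) (sym_inv n \<sigma>)) \<sigma>"
    by (simp add: t' tabloid_compose[OF T \<tau>])
  also have "\<dots> = tabloid n \<mu> (compose (diagram \<mu>) (sym_inv n \<sigma>) T)"
    by (simp add: compose_compose_FI[OF \<sigma>] compose_sym_inv[OF \<sigma>] compose_inc_right tabloid_def)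
  also have "\<dots> \<in> tabloids n \<mu>"
    using T.compose_tableau[OF \<tau>] by (simp add: tabloids_def)
  finally show ?thesis .
qed

lemma finite_tabloids [simp]: "finite (tabloids n \<mu>)"
proof -
  have "t \<in> {1..n} \<rightarrow>\<^sub>E {..length \<mu>}" if t': "t \<in> tabloids n \<mu>" for t
  proof -
    obtain T where T: "T \<in> tableaux n \<mu>" and t: "t = tabloid n \<mu> T"
      using t' by (auto simp: tabloids_def)
    interpret T: tableau n \<mu> T using T by (rule tableauI)
    have "t k \<le> length \<mu>" if k: "k \<in> {1..n}" for k
    proof -
      obtain b where b: "b \<in> diagram \<mu>" "k = T b" using k by (rule T.entryE)
      then have "t k = fst b" by (simp add: t)
      then show ?thesis using b(1) by (auto simp: diagram_def)
    qed
    moreover have "t \<in> extensional {1..n}" by (simp add: t tabloid_def)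
    ultimately show ?thesis by (simp add: PiE_iff)
  qed
  then show ?thesis
    by (rule finite_subset[OF subsetI finite_PiE]) simp_all
qed

lemma bij_betw_tabloids:
  assumes "\<sigma> \<in> FI_hom n n"
  shows "bij_betw (\<lambda>t. compose {1..n} t \<sigma>) (tabloids n \<mu>) (tabloids n \<mu>)"
proof (rule bij_betw_byWitness[of _ "\<lambda>t. compose {1..n} t (sym_inv n \<sigma>)"])
  show "\<forall>t\<in>tabloids n \<mu>. compose {1..n} (compose {1..n} t \<sigma>) (sym_inv n \<sigma>) = t"
    "\<forall>t\<in>tabloids n \<mu>. compose {1..n} (compose {1..n} t (sym_inv n \<sigma>)) \<sigma> = t"
    using assms tabloid_extensional
    by (auto simp: compose_compose_FI sym_inv_FI_hom compose_sym_inv compose_inc_right)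
qed (use assms sym_inv_FI_hom compose_tabloids in auto)

subsection \<open>Signed counts over the column group\<close>

text \<open>The coefficient of t in the signed column sum of T applied to the tabloid s: the
  permutation \<sigma> sends s to t exactly if t composed with \<sigma> is s.\<close>

definition signed_count :: "nat \<Rightarrow> nat list \<Rightarrow> (nat \<times> nat \<Rightarrow> nat) \<Rightarrow> (nat \<Rightarrow> nat) \<Rightarrow> (nat \<Rightarrow> nat) \<Rightarrow> int" where
  "signed_count n \<mu> T t s =
     (\<Sum>\<sigma>\<in>{\<sigma> \<in> stabilizer n (column \<mu> T). compose {1..n} t \<sigma> = s}. sgn_perm n \<sigma>)"

text \<open>With integer coefficients the combinatorial identities are independent of the field, and
  nonvanishing can be deduced from positivity.\<close>

definition polytabloid_int :: "nat \<Rightarrow> nat list \<Rightarrow> (nat \<times> nat \<Rightarrow> nat) \<Rightarrow> (nat \<Rightarrow> nat) \<Rightarrow> int" where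
  "polytabloid_int n \<mu> T t = signed_count n \<mu> T t (tabloid n \<mu> T)"

lemma polytabloid_eq:
  assumes T: "T \<in> tableaux n \<mu>"
  shows "polytabloid n \<mu> T = (\<lambda>t\<in>tabloids n \<mu>. of_int (polytabloid_int n \<mu> T t))"
proof -
  interpret T: tableau n \<mu> T using T by (rule tableauI)
  have "(tabloid n \<mu> (compose (diagram \<mu>) \<sigma> T) = t) = (compose {1..n} t \<sigma> = tabloid n \<mu> T)"
    if t: "t \<in> tabloids n \<mu>" and \<sigma>: "\<sigma> \<in> FI_hom n n" for t \<sigma>
  proof
    assume "tabloid n \<mu> (compose (diagram \<mu>) \<sigma> T) = t"
    then show "compose {1..n} t \<sigma> = tabloid n \<mu> T"
      using tabloid_compose[OF T \<sigma>] by simp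
  next
    assume "compose {1..n} t \<sigma> = tabloid n \<mu> T"
    then have "compose {1..n} t \<sigma> = compose {1..n} (tabloid n \<mu> (compose (diagram \<mu>) \<sigma> T)) \<sigma>"
      using tabloid_compose[OF T \<sigma>] by simp
    moreover have "tabloid n \<mu> (compose (diagram \<mu>) \<sigma> T) \<in> tabloids n \<mu>"
      using T.compose_tableau[OF \<sigma>] by (simp add: tabloids_def)
    ultimately show "tabloid n \<mu> (compose (diagram \<mu>) \<sigma> T) = t"
      using bij_betw_imp_inj_on[OF bij_betw_tabloids[OF \<sigma>, of \<mu>]] t by (auto dest: inj_onD)
  qed
  then have "{\<sigma> \<in> column_stabilizer n \<mu> T. tabloid n \<mu> (compose (diagram \<mu>) \<sigma> T) = t} =
      {\<sigma> \<in> stabilizer n (column \<mu> T). compose {1..n} t \<sigma> = tabloid n \<mu> T}"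
    if "t \<in> tabloids n \<mu>" for t
    using that by (auto simp: T.column_stabilizer_eq dest: stabilizer_FI_hom)
  then show ?thesis
    by (simp add: polytabloid_def polytabloid_int_def signed_count_def cong: restrict_cong)
qed

text \<open>Reindexing of the column group, by left translation with \<pi> in the first statement
  and by right translation with its inverse in the second; \<pi> and its inverse have the same
  sign.\<close>

lemma signed_count_compose:
  assumes T: "T \<in> tableaux n \<mu>" and \<pi>: "\<pi> \<in> stabilizer n (column \<mu> T)"
    and t: "t \<in> extensional {1..n}"
  shows "signed_count n \<mu> T (compose {1..n} t \<pi>) s = sgn_perm n \<pi> * signed_count n \<mu> T t s"
    and "s \<in> extensional {1..n} \<Longrightarrow>
      signed_count n \<mu> T t (compose {1..n} s \<pi>) = sgn_perm n \<pi> * signed_count n \<mu> T t s"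
proof -
  let ?C = "stabilizer n (column \<mu> T)"
  note \<pi>' = stabilizer_FI_hom[OF \<pi>] and \<pi>i = sym_inv_stabilizer[OF \<pi>]
  note \<pi>i' = stabilizer_FI_hom[OF \<pi>i]
  have sg: "sgn_perm n (compose {1..n} \<sigma> \<tau>) = sgn_perm n \<sigma> * sgn_perm n \<tau>"
    if "\<sigma> \<in> ?C" "\<tau> \<in> ?C" for \<sigma> \<tau>
    using that by (intro sgn_perm_compose) (auto dest: stabilizer_FI_hom)
  have canc: "compose {1..n} (sym_inv n \<pi>) (compose {1..n} \<pi> \<sigma>) = \<sigma>"
    "compose {1..n} \<pi> (compose {1..n} (sym_inv n \<pi>) \<sigma>) = \<sigma>"
    "compose {1..n} (compose {1..n} \<sigma> \<pi>) (sym_inv n \<pi>) = \<sigma>"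
    "compose {1..n} (compose {1..n} \<sigma> (sym_inv n \<pi>)) \<pi> = \<sigma>" if "\<sigma> \<in> ?C" for \<sigma>
  proof -
    note \<sigma> = stabilizer_FI_hom[OF that]
    show "compose {1..n} (sym_inv n \<pi>) (compose {1..n} \<pi> \<sigma>) = \<sigma>"
      "compose {1..n} \<pi> (compose {1..n} (sym_inv n \<pi>) \<sigma>) = \<sigma>"
      by (simp_all only: compose_compose_FI[OF \<sigma>, symmetric] compose_sym_inv[OF \<pi>']
          compose_inc_left[OF \<sigma> order_refl])
    show "compose {1..n} (compose {1..n} \<sigma> \<pi>) (sym_inv n \<pi>) = \<sigma>"
      "compose {1..n} (compose {1..n} \<sigma> (sym_inv n \<pi>)) \<pi> = \<sigma>"
      by (simp_all only: compose_compose_FI[OF \<pi>'] compose_compose_FI[OF \<pi>i'] compose_sym_inv[OF \<pi>']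
          compose_inc_right[OF FI_homD(2)[OF \<sigma>]])
  qed
  have canc_s: "compose {1..n} (compose {1..n} s \<pi>) (sym_inv n \<pi>) = s" if "s \<in> extensional {1..n}" for s :: "nat \<Rightarrow> nat"
    by (simp only: compose_compose_FI[OF \<pi>i'] compose_sym_inv[OF \<pi>'] compose_inc_right[OF that])
  have canc_t: "compose {1..n} (compose {1..n} t \<pi>) (compose {1..n} (sym_inv n \<pi>) \<sigma>) = compose {1..n} t \<sigma>"
    if "\<sigma> \<in> ?C" for \<sigma>
    by (simp only: compose_compose_FI[OF compose_FI_hom[OF stabilizer_FI_hom[OF that] \<pi>i']] canc(2)[OF that])
  have one: "sgn_perm n \<pi> * sgn_perm n (sym_inv n \<pi>) = 1"
    using \<pi>' by (rule sgn_perm_sym_inv)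
  have unit: "sgn_perm n (sym_inv n \<pi>) = sgn_perm n \<pi>"
    using one zmult_eq_1_iff by metis
  show "signed_count n \<mu> T (compose {1..n} t \<pi>) s = sgn_perm n \<pi> * signed_count n \<mu> T t s"
    unfolding signed_count_def sum_distrib_left
  proof (rule sum.reindex_bij_witness[of _ "compose {1..n} (sym_inv n \<pi>)" "compose {1..n} \<pi>"])
    fix \<sigma> assume \<sigma>: "\<sigma> \<in> {\<sigma> \<in> ?C. compose {1..n} (compose {1..n} t \<pi>) \<sigma> = s}"
    then show "compose {1..n} \<pi> \<sigma> \<in> {\<sigma> \<in> ?C. compose {1..n} t \<sigma> = s}"
      using \<pi> by (auto simp: compose_stabilizer compose_compose_FI[OF stabilizer_FI_hom])
    show "sgn_perm n \<pi> * sgn_perm n (compose {1..n} \<pi> \<sigma>) = sgn_perm n \<sigma>"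
      using \<sigma> one unit by (simp add: sg[OF \<pi>] mult.assoc[symmetric])
  next
    fix \<sigma> assume \<sigma>: "\<sigma> \<in> {\<sigma> \<in> ?C. compose {1..n} t \<sigma> = s}"
    then show "compose {1..n} (sym_inv n \<pi>) \<sigma> \<in> {\<sigma> \<in> ?C. compose {1..n} (compose {1..n} t \<pi>) \<sigma> = s}"
      using \<pi>i compose_stabilizer canc_t by auto
  qed (simp_all add: canc)
  show "signed_count n \<mu> T t (compose {1..n} s \<pi>) = sgn_perm n \<pi> * signed_count n \<mu> T t s"
    if s: "s \<in> extensional {1..n}"
    unfolding signed_count_def sum_distrib_left
  proof (rule sum.reindex_bij_witness[of _ "\<lambda>\<sigma>. compose {1..n} \<sigma> \<pi>" "\<lambda>\<sigma>. compose {1..n} \<sigma> (sym_inv n \<pi>)"])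
    fix \<sigma> assume \<sigma>: "\<sigma> \<in> {\<sigma> \<in> ?C. compose {1..n} t \<sigma> = compose {1..n} s \<pi>}"
    then have "compose {1..n} (compose {1..n} t \<sigma>) (sym_inv n \<pi>) = s"
      using canc_s[OF s] by simp
    then show "compose {1..n} \<sigma> (sym_inv n \<pi>) \<in> {\<sigma> \<in> ?C. compose {1..n} t \<sigma> = s}"
      using \<sigma> \<pi>i by (auto simp: compose_stabilizer compose_compose_FI[OF \<pi>i'])
    show "sgn_perm n \<pi> * sgn_perm n (compose {1..n} \<sigma> (sym_inv n \<pi>)) = sgn_perm n \<sigma>"
      using \<sigma> one by (simp add: sg[OF _ \<pi>i] mult.left_commute)
  next
    fix \<sigma> assume \<sigma>: "\<sigma> \<in> {\<sigma> \<in> ?C. compose {1..n} t \<sigma> = s}"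
    then show "compose {1..n} \<sigma> \<pi> \<in> {\<sigma> \<in> ?C. compose {1..n} t \<sigma> = compose {1..n} s \<pi>}"
      using \<pi> by (auto simp: compose_stabilizer compose_compose_FI[OF \<pi>'])
  qed (simp_all add: canc)
qed

text \<open>Only the identity preserves both the rows and the columns of T.\<close>

lemma polytabloid_int_self:
  assumes T: "T \<in> tableaux n \<mu>"
  shows "polytabloid_int n \<mu> T (tabloid n \<mu> T) = 1"
proof -
  interpret T: tableau n \<mu> T using T by (rule tableauI)
  have "\<sigma> = inc n"
    if \<sigma>: "\<sigma> \<in> stabilizer n (column \<mu> T)" and eq: "compose {1..n} (tabloid n \<mu> T) \<sigma> = tabloid n \<mu> T" for \<sigma>
  proof (rule FI_hom_eqI[OF stabilizer_FI_hom[OF \<sigma>] inc_FI_hom[OF order_refl]])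
    fix k assume k: "k \<in> {1..n}"
    then have "tabloid n \<mu> T (\<sigma> k) = tabloid n \<mu> T k"
      using fun_cong[OF eq, of k] by (simp add: compose_eq)
    moreover have "column \<mu> T (\<sigma> k) = column \<mu> T k"
      using \<sigma> k by (simp add: stabilizer_def)
    ultimately show "\<sigma> k = inc n k"
      using T.row_column_inj[of "\<sigma> k" k] k FI_homD(3)[OF stabilizer_FI_hom[OF \<sigma>] k] by simp
  qed
  then have "{\<sigma> \<in> stabilizer n (column \<mu> T). compose {1..n} (tabloid n \<mu> T) \<sigma> = tabloid n \<mu> T} = {inc n}"
    using inc_stabilizer by (auto simp: compose_inc_right tabloid_def)
  then show ?thesis
    by (simp add: polytabloid_int_def signed_count_def sgn_perm_inc)
qed

section \<open>Column permutations and the sign lemma\<close>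

text \<open>With h the size of A, the elements of A outside 0, ..., h - 1 and the numbers below h
  missing from A are equally many; the former are at least h, the latter smaller.\<close>

lemma sum_lessThan_le:
  fixes A :: "nat set"
  assumes "finite A"
  shows "\<Sum>{..<card A} \<le> \<Sum>A" and "\<Sum>A = \<Sum>{..<card A} \<Longrightarrow> A = {..<card A}"
proof -
  let ?h = "card A"
  define U where "U = A - {..<?h}"
  define L where "L = {..<?h} - A"
  have fin: "finite U" "finite L" using assms by (auto simp: U_def L_def)
  have "card U + card (A \<inter> {..<?h}) = card A"
    using assms card_Int_Diff[of A "{..<?h}"] by (simp add: U_def)
  moreover have "card L + card (A \<inter> {..<?h}) = ?h"
    using card_Int_Diff[of "{..<?h}" A] by (simp add: L_def Int_commute)
  ultimately have card: "card U = card L" by simp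
  have A: "\<Sum>A = \<Sum>U + \<Sum>(A \<inter> {..<?h})"
    using assms sum.Int_Diff[of A "\<lambda>x. x" "{..<?h}"] by (simp add: U_def)
  have h: "\<Sum>{..<?h} = \<Sum>L + \<Sum>(A \<inter> {..<?h})"
    using sum.Int_Diff[of "{..<?h}" "\<lambda>x. x" A] by (simp add: L_def Int_commute)
  have U: "\<Sum>U \<ge> card U * ?h"
    using sum_bounded_below[of U ?h "\<lambda>x. x"] by (auto simp: U_def)
  have L: "\<Sum>L < card L * ?h" if "L \<noteq> {}"
    using that sum_strict_mono[OF fin(2) that, of "\<lambda>x. x" "\<lambda>_. ?h"] by (auto simp: L_def)
  show "\<Sum>{..<?h} \<le> \<Sum>A"
    using A h U L card by (cases "L = {}") auto
  show "A = {..<?h}" if "\<Sum>A = \<Sum>{..<?h}"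
  proof -
    have "L = {}"
    proof (rule ccontr)
      assume "L \<noteq> {}"
      moreover have "\<Sum>U \<ge> card L * ?h" using U card by simp
      ultimately show False using L A h that by linarith
    qed
    then have "U = {}" using card fin by simp
    then show ?thesis using \<open>L = {}\<close> by (auto simp: U_def L_def)
  qed
qed

lemma diagram_column:
  assumes "sorted_wrt (\<ge>) \<mu>"
  shows "{i. (i, j) \<in> diagram \<mu>} = {..<card {i. (i, j) \<in> diagram \<mu>}}"
proof -
  let ?A = "{i. (i, j) \<in> diagram \<mu>}"
  have fin: "finite ?A"
    by (rule finite_subset[of _ "{..<length \<mu>}"]) (auto simp: diagram_def)
  have down: "i' \<in> ?A" if "i \<in> ?A" "i' \<le> i" for i i'
    using sorted_wrt_nth_less[OF assms, of i' i] that by (cases "i' = i") (auto simp: diagram_def)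
  show ?thesis
  proof (cases "?A = {}")
    case False
    have "?A = {..Max ?A}"
    proof (intro equalityI subsetI)
      show "i \<in> {..Max ?A}" if "i \<in> ?A" for i
        using Max_ge[OF fin that] by (simp only: atMost_iff)
      show "i \<in> ?A" if "i \<in> {..Max ?A}" for i
        using down[OF Max_in[OF fin False]] that by (simp only: atMost_iff)
    qed
    then show ?thesis
      by (metis card_atMost lessThan_Suc_atMost)
  qed simp
qed

text \<open>Summing the rows of \<open>s\<close> over each column of \<open>T\<close>, the inequality of \<open>sum_lessThan_le\<close> is an equality
  for every column, because both sides have the same total. Hence the entries of a column of length \<open>h\<close>
  lie in the rows \<open>0, \<dots>, h - 1\<close> of \<open>s\<close>.\<close>

lemma column_permutation_or_repetition:
  assumes T: "T \<in> tableaux n \<mu>" and s: "s \<in> tabloids n \<mu>" and \<mu>: "sorted_wrt (\<ge>) \<mu>"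
  obtains (perm) \<pi> where "\<pi> \<in> stabilizer n (column \<mu> T)" and "compose {1..n} s \<pi> = tabloid n \<mu> T"
  | (rep) p q where "p \<in> {1..n}" and "q \<in> {1..n}" and "p \<noteq> q"
      and "column \<mu> T p = column \<mu> T q" and "s p = s q"
proof (cases "\<exists>p\<in>{1..n}. \<exists>q\<in>{1..n}. p \<noteq> q \<and> column \<mu> T p = column \<mu> T q \<and> s p = s q")
  case True
  then show thesis using rep by blast
next
  case False
  interpret T: tableau n \<mu> T using T by (rule tableauI)
  obtain S where S: "S \<in> tableaux n \<mu>" and s': "s = tabloid n \<mu> S"
    using s by (auto simp: tabloids_def)
  interpret S: tableau n \<mu> S using S by (rule tableauI)
  have norep: "p = q"
    if "p \<in> {1..n}" "q \<in> {1..n}" "column \<mu> T p = column \<mu> T q" "s p = s q" for p q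
    using False that by blast
  let ?D = "diagram \<mu>"
  define rows where "rows j = {i. (i, j) \<in> ?D}" for j
  define J where "J = snd ` ?D"
  define g where "g j i = s (T (i, j))" for j i
  have fin_rows: "finite (rows j)" for j
    by (rule finite_subset[of _ "fst ` ?D"]) (force simp: rows_def)+
  have inj: "inj_on (g j) (rows j)" for j
  proof (rule inj_onI)
    fix i i' assume i: "i \<in> rows j" "i' \<in> rows j" "g j i = g j i'"
    then have "(i, j) \<in> ?D" "(i', j) \<in> ?D" "s (T (i, j)) = s (T (i', j))"
      by (simp_all add: rows_def g_def)
    then have "T (i, j) = T (i', j)"
      using norep[OF T.entry T.entry, of "(i, j)" "(i', j)"] by simp
    then show "i = i'"
      using i bij_betw_imp_inj_on[OF T.bij] by (auto simp: rows_def dest: inj_onD)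
  qed
  have by_columns: "(\<Sum>b\<in>?D. f b) = (\<Sum>j\<in>J. \<Sum>i\<in>rows j. f (i, j))" for f :: "nat \<times> nat \<Rightarrow> nat"
  proof -
    have "(\<Sum>j\<in>J. \<Sum>i\<in>rows j. f (i, j)) = (\<Sum>(j, i)\<in>Sigma J rows. f (i, j))"
      using fin_rows by (intro sum.Sigma) (auto simp: J_def)
    also have "\<dots> = (\<Sum>b\<in>?D. f b)"
      by (rule sum.reindex_bij_witness[of _ prod.swap prod.swap]) (force simp: rows_def J_def)+
    finally show ?thesis by simp
  qed
  have "(\<Sum>b\<in>?D. s (T b)) = (\<Sum>k\<in>{1..n}. s k)"
    using T.bij by (rule sum.reindex_bij_betw)
  also have "\<dots> = (\<Sum>b\<in>?D. s (S b))"
    using S.bij by (rule sum.reindex_bij_betw[symmetric])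
  also have "\<dots> = (\<Sum>b\<in>?D. fst b)"
    by (simp add: s')
  finally have "(\<Sum>j\<in>J. \<Sum>(rows j)) = (\<Sum>j\<in>J. \<Sum>(g j ` rows j))"
    using inj by (simp add: by_columns g_def[symmetric] sum.reindex o_def)
  moreover have rows: "rows j = {..<card (g j ` rows j)}" for j
    using diagram_column[OF \<mu>, of j] inj[of j] by (simp add: rows_def[symmetric] card_image)
  moreover have "\<Sum>(rows j) \<le> \<Sum>(g j ` rows j)" for j
    using sum_lessThan_le(1)[of "g j ` rows j"] fin_rows rows[of j] by simp
  ultimately have "\<Sum>(rows j) = \<Sum>(g j ` rows j)" if "j \<in> J" for j
    using that by (intro sum_mono_inv[of "\<lambda>j. \<Sum>(rows j)" J "\<lambda>j. \<Sum>(g j ` rows j)"]) (auto simp: J_def)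
  then have g_rows: "g j ` rows j = rows j" if "j \<in> J" for j
    using that sum_lessThan_le(2)[of "g j ` rows j"] fin_rows rows[of j] by simp
  \<comment> \<open>G moves a box within its column to the row in which s has the entry of that box.
    It permutes the diagram, and conjugating its inverse by T gives the required column
    permutation.\<close>
  define G where "G b = (s (T b), snd b)" for b
  have "G ` ?D \<subseteq> ?D"
  proof
    fix b assume "b \<in> G ` ?D"
    then obtain i j where ij: "(i, j) \<in> ?D" "b = G (i, j)" by auto
    then have "g j i \<in> rows j"
      using g_rows[of j] by (force simp: J_def rows_def)
    then show "b \<in> ?D" using ij by (simp add: G_def g_def rows_def)
  qed
  moreover have "inj_on G ?D"
  proof (rule inj_onI)
    fix b c assume bc: "b \<in> ?D" "c \<in> ?D" "G b = G c"
    then have "T b = T c"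
      using bc norep[OF T.entry T.entry, of b c] by (simp add: G_def)
    then show "b = c"
      using bc bij_betw_imp_inj_on[OF T.bij] by (auto dest: inj_onD)
  qed
  ultimately have G: "bij_betw G ?D ?D"
    using endo_inj_surj[OF finite_diagram] by (simp add: bij_betw_def)
  define \<pi> where "\<pi> = restrict (T \<circ> (inv_into ?D G \<circ> inv_into ?D T)) {1..n}"
  have "bij_betw (T \<circ> (inv_into ?D G \<circ> inv_into ?D T)) {1..n} {1..n}"
    using bij_betw_inv_into[OF T.bij] bij_betw_inv_into[OF G] T.bij by (blast intro: bij_betw_trans)
  then have \<pi>: "\<pi> \<in> FI_hom n n"
    unfolding \<pi>_def by (intro FI_hom_selfI) (simp_all only: bij_betw_restrict_eq restrict_extensional)
  have *: "\<exists>c\<in>?D. \<pi> (T b) = T c \<and> G c = b" if "b \<in> ?D" for b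
    using that T.entry G
    by (intro bexI[of _ "inv_into ?D G b"]) (auto simp: \<pi>_def bij_betw_def f_inv_into_f inv_into_into)
  have "column \<mu> T (\<pi> k) = column \<mu> T k \<and> s (\<pi> k) = tabloid n \<mu> T k" if k: "k \<in> {1..n}" for k
  proof -
    obtain b where b: "b \<in> ?D" "k = T b" using k by (rule T.entryE)
    obtain c where c: "c \<in> ?D" "\<pi> (T b) = T c" "G c = b" using * b by blast
    then show ?thesis using b by (auto simp: G_def)
  qed
  then show thesis
    using \<pi> by (intro perm[of \<pi>] extensionalityI[of _ "{1..n}"]) (auto simp: stabilizer_def compose_eq tabloid_def)
qed

text \<open>The signed column sum has rank one on tabloids, its image being spanned by the
  polytabloid. If s has two entries of one column in the same row, swapping them fixes s and
  reverses the sign, so both sides vanish. Any other s is the tabloid of T up to a column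
  permutation, which contributes its sign.\<close>

lemma signed_count_factor:
  assumes T: "T \<in> tableaux n \<mu>" and \<mu>: "sorted_wrt (\<ge>) \<mu>"
    and t: "t \<in> tabloids n \<mu>" and s: "s \<in> tabloids n \<mu>"
  shows "signed_count n \<mu> T t s = polytabloid_int n \<mu> T s * polytabloid_int n \<mu> T t"
proof -
  note ext = tabloid_extensional[OF t] tabloid_extensional[OF s]
  show ?thesis
  proof (rule column_permutation_or_repetition[OF T s \<mu>])
    fix \<pi> assume \<pi>: "\<pi> \<in> stabilizer n (column \<mu> T)" "compose {1..n} s \<pi> = tabloid n \<mu> T"
    have "polytabloid_int n \<mu> T t = sgn_perm n \<pi> * signed_count n \<mu> T t s"
      using signed_count_compose(2)[OF T \<pi>(1) ext] \<pi>(2) by (simp add: polytabloid_int_def)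
    moreover have "1 = sgn_perm n \<pi> * polytabloid_int n \<mu> T s"
      using signed_count_compose(1)[OF T \<pi>(1) ext(2), of "tabloid n \<mu> T"] \<pi>(2) polytabloid_int_self[OF T]
      by (simp add: polytabloid_int_def)
    ultimately show ?thesis
      by (metis mult.assoc mult.commute mult_1)
  next
    fix p q assume pq: "p \<in> {1..n}" "q \<in> {1..n}" "p \<noteq> q" "column \<mu> T p = column \<mu> T q" "s p = s q"
    have \<tau>: "tswap n p q \<in> stabilizer n (column \<mu> T)"
      using pq by (intro tswap_stabilizer)
    have "compose {1..n} s (tswap n p q) = s"
      using pq ext(2) by (intro extensionalityI[of _ "{1..n}"])
        (auto simp: compose_eq tswap_def Transposition.transpose_def)
    then show ?thesis
      using signed_count_compose(2)[OF T \<tau> ext] signed_count_compose(1)[OF T \<tau> ext(2), of "tabloid n \<mu> T"]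
        sgn_perm_tswap[OF pq(1-3)] by (simp add: polytabloid_int_def)
  qed
qed

lemma polytabloid_int_compose_column:
  assumes T: "T \<in> tableaux n \<mu>" and \<pi>: "\<pi> \<in> stabilizer n (column \<mu> T)" and t: "t \<in> tabloids n \<mu>"
  shows "polytabloid_int n \<mu> T (compose {1..n} t \<pi>) = sgn_perm n \<pi> * polytabloid_int n \<mu> T t"
  using signed_count_compose(1)[OF T \<pi> tabloid_extensional[OF t]] by (simp add: polytabloid_int_def)

text \<open>Conjugation by \<sigma> carries the column group of T to that of \<sigma> T, preserving
  signs and matching the conditions on tabloids. In terms of vectors, the polytabloid of \<sigma> T
  is \<sigma> applied to that of T.\<close>

lemma polytabloid_int_compose:
  assumes T: "T \<in> tableaux n \<mu>" and \<sigma>: "\<sigma> \<in> FI_hom n n" and t: "t \<in> tabloids n \<mu>"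
  shows "polytabloid_int n \<mu> (compose (diagram \<mu>) \<sigma> T) t = polytabloid_int n \<mu> T (compose {1..n} t \<sigma>)"
proof -
  let ?S = "compose (diagram \<mu>) \<sigma> T"
  let ?C = "\<lambda>T. stabilizer n (column \<mu> T)"
  note \<sigma>i = sym_inv_FI_hom[OF \<sigma>]
  have canc: "compose {1..n} (compose {1..n} h \<sigma>) (sym_inv n \<sigma>) = h"
    "compose {1..n} (compose {1..n} h (sym_inv n \<sigma>)) \<sigma> = h" if "h \<in> extensional {1..n}" for h :: "nat \<Rightarrow> nat"
    by (simp_all only: compose_compose_FI[OF \<sigma>] compose_compose_FI[OF \<sigma>i] compose_sym_inv[OF \<sigma>]
        compose_inc_right[OF that])
  have canc': "compose {1..n} (sym_inv n \<sigma>) (compose {1..n} \<sigma> h) = h"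
    "compose {1..n} \<sigma> (compose {1..n} (sym_inv n \<sigma>) h) = h" if "h \<in> FI_hom n n" for h
    by (simp_all only: compose_compose_FI[OF that, symmetric] compose_sym_inv[OF \<sigma>]
        compose_inc_left[OF that order_refl])
  define conj1 where "conj1 \<tau> = compose {1..n} \<sigma> (compose {1..n} \<tau> (sym_inv n \<sigma>))" for \<tau>
  define conj2 where "conj2 \<tau> = compose {1..n} (sym_inv n \<sigma>) (compose {1..n} \<tau> \<sigma>)" for \<tau>
  have FI: "conj1 \<tau> \<in> FI_hom n n" "conj2 \<tau> \<in> FI_hom n n" if "\<tau> \<in> FI_hom n n" for \<tau>
    unfolding conj1_def conj2_def using that \<sigma> \<sigma>i by (auto intro!: compose_FI_hom)
  have conj12: "conj1 (conj2 \<tau>) = \<tau>" "conj2 (conj1 \<tau>) = \<tau>" if \<tau>: "\<tau> \<in> FI_hom n n" for \<tau>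
  proof -
    note [simp] = compose_compose_FI[OF \<sigma>] compose_compose_FI[OF \<sigma>i] compose_sym_inv[OF \<sigma>]
      compose_inc_right[OF FI_homD(2)[OF \<tau>]]
    show "conj1 (conj2 \<tau>) = \<tau>" "conj2 (conj1 \<tau>) = \<tau>"
      using \<tau> by (simp_all add: conj1_def conj2_def canc' compose_FI_hom[OF \<sigma>] compose_FI_hom[OF \<sigma>i])
  qed
  have app1: "conj1 \<tau> (\<sigma> k) = \<sigma> (\<tau> k)" if "\<tau> \<in> FI_hom n n" "k \<in> {1..n}" for \<tau> k
    using that FI_homD(3)[OF \<sigma>] \<sigma> by (simp add: conj1_def compose_eq)
  have app2: "\<sigma> (conj2 \<tau> k) = \<tau> (\<sigma> k)" if "\<tau> \<in> FI_hom n n" "k \<in> {1..n}" for \<tau> k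
    using that FI_homD(3)[OF \<sigma>] FI_homD(3)[OF that(1)] \<sigma> by (simp add: conj2_def compose_eq)
  have C1: "conj1 \<tau> \<in> ?C ?S" if \<tau>: "\<tau> \<in> ?C T" for \<tau>
  proof -
    note \<tau>' = stabilizer_FI_hom[OF \<tau>]
    have "column \<mu> ?S (conj1 \<tau> l) = column \<mu> ?S l" if l: "l \<in> {1..n}" for l
    proof -
      obtain k where k: "k \<in> {1..n}" "l = \<sigma> k"
        using l FI_hom_bij_betw[OF \<sigma>] unfolding bij_betw_def by blast
      then show ?thesis
        using \<tau> column_compose(1)[OF T \<sigma>] FI_homD(3)[OF \<tau>' k(1)]
        by (simp add: app1[OF \<tau>'] stabilizer_def)
    qed
    then show ?thesis using FI(1)[OF \<tau>'] by (simp add: stabilizer_def)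
  qed
  have C2: "conj2 \<tau> \<in> ?C T" if \<tau>: "\<tau> \<in> ?C ?S" for \<tau>
  proof -
    note \<tau>' = stabilizer_FI_hom[OF \<tau>]
    have "column \<mu> T (conj2 \<tau> k) = column \<mu> T k" if k: "k \<in> {1..n}" for k
    proof -
      have "column \<mu> T (conj2 \<tau> k) = column \<mu> ?S (\<tau> (\<sigma> k))"
        using column_compose(1)[OF T \<sigma> FI_homD(3)[OF FI(2)[OF \<tau>'] k]] app2[OF \<tau>' k] by simp
      also have "\<dots> = column \<mu> ?S (\<sigma> k)"
        using \<tau> FI_homD(3)[OF \<sigma> k] by (simp add: stabilizer_def)
      finally show ?thesis
        using column_compose(1)[OF T \<sigma> k] by simp
    qed
    then show ?thesis using FI(2)[OF \<tau>'] by (simp add: stabilizer_def)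
  qed
  have tabS: "tabloid n \<mu> ?S \<in> extensional {1..n}" by (simp add: tabloid_def)
  have cond: "compose {1..n} t (conj1 \<tau>) = tabloid n \<mu> ?S \<longleftrightarrow>
      compose {1..n} (compose {1..n} t \<sigma>) \<tau> = tabloid n \<mu> T" if \<tau>: "\<tau> \<in> FI_hom n n" for \<tau>
  proof -
    have "compose {1..n} t (conj1 \<tau>) = compose {1..n} (compose {1..n} (compose {1..n} t \<sigma>) \<tau>) (sym_inv n \<sigma>)"
      by (simp only: conj1_def compose_compose_FI[OF \<sigma>i] compose_compose_FI[OF compose_FI_hom[OF \<sigma>i \<tau>]])
    moreover have "tabloid n \<mu> ?S = compose {1..n} (tabloid n \<mu> T) (sym_inv n \<sigma>)"
      using canc(1)[OF tabS] tabloid_compose[OF T \<sigma>] by simp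
    moreover have "compose {1..n} (compose {1..n} t \<sigma>) \<tau> \<in> extensional {1..n}"
      "tabloid n \<mu> T \<in> extensional {1..n}"
      by (simp_all add: compose_def tabloid_def)
    ultimately show ?thesis
      using canc(2) by metis
  qed
  have sg: "sgn_perm n (conj1 \<tau>) = sgn_perm n \<tau>" if \<tau>: "\<tau> \<in> FI_hom n n" for \<tau>
    using sgn_perm_sym_inv[OF \<sigma>]
    by (simp add: conj1_def sgn_perm_compose \<sigma> \<sigma>i \<tau> compose_FI_hom[OF \<sigma>i \<tau>])
  show ?thesis
    unfolding polytabloid_int_def signed_count_def
  proof (rule sum.reindex_bij_witness[of _ conj1 conj2])
    fix \<tau> assume \<tau>: "\<tau> \<in> {\<sigma> \<in> ?C ?S. compose {1..n} t \<sigma> = tabloid n \<mu> ?S}"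
    then have \<tau>': "\<tau> \<in> FI_hom n n" by (auto dest: stabilizer_FI_hom)
    show "conj1 (conj2 \<tau>) = \<tau>" using conj12 \<tau>' by blast
    show "conj2 \<tau> \<in> {\<tau> \<in> ?C T. compose {1..n} (compose {1..n} t \<sigma>) \<tau> = tabloid n \<mu> T}"
      using \<tau> C2 cond[OF FI(2)[OF \<tau>']] conj12(1)[OF \<tau>'] by auto
    show "sgn_perm n (conj2 \<tau>) = sgn_perm n \<tau>"
      using sg[OF FI(2)[OF \<tau>']] conj12(1)[OF \<tau>'] by simp
  next
    fix \<tau> assume \<tau>: "\<tau> \<in> {\<tau> \<in> ?C T. compose {1..n} (compose {1..n} t \<sigma>) \<tau> = tabloid n \<mu> T}"
    then have \<tau>': "\<tau> \<in> FI_hom n n" by (auto dest: stabilizer_FI_hom)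
    show "conj2 (conj1 \<tau>) = \<tau>" using conj12 \<tau>' by blast
    show "conj1 \<tau> \<in> {\<sigma> \<in> ?C ?S. compose {1..n} t \<sigma> = tabloid n \<mu> ?S}"
      using \<tau> C1 cond[OF \<tau>'] by auto
  qed
qed

section \<open>Row-symmetrized polytabloids\<close>

lemma bij_betw_stabilizer_left:
  assumes \<tau>: "\<tau> \<in> stabilizer n lab"
  shows "bij_betw (compose {1..n} \<tau>) (stabilizer n lab) (stabilizer n lab)"
proof -
  have inj: "inj_on (compose {1..n} \<tau>) (stabilizer n lab)"
    using bij_betw_compose_left[OF stabilizer_FI_hom[OF \<tau>], of n]
    by (rule inj_on_subset[OF bij_betw_imp_inj_on]) (auto dest: stabilizer_FI_hom)
  have "compose {1..n} \<tau> ` stabilizer n lab \<subseteq> stabilizer n lab"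
    using compose_stabilizer \<tau> by blast
  then show ?thesis
    using inj endo_inj_surj[OF finite_stabilizer] by (simp add: bij_betw_def)
qed

text \<open>The coefficient of t in the sum of all row permutations of T applied to its polytabloid,
  i.e. in the tabloid of T after antisymmetrization over columns followed by symmetrization over
  rows.\<close>

definition row_sum :: "nat \<Rightarrow> nat list \<Rightarrow> (nat \<times> nat \<Rightarrow> nat) \<Rightarrow> (nat \<Rightarrow> nat) \<Rightarrow> int" where
  "row_sum n \<mu> T t =
     (\<Sum>\<rho>\<in>stabilizer n (tabloid n \<mu> T). polytabloid_int n \<mu> T (compose {1..n} t \<rho>))"

lemma row_sum_invariant:
  assumes \<rho>: "\<rho> \<in> stabilizer n (tabloid n \<mu> T)"
  shows "row_sum n \<mu> T (compose {1..n} t \<rho>) = row_sum n \<mu> T t"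
proof -
  have "row_sum n \<mu> T (compose {1..n} t \<rho>) =
      (\<Sum>\<tau>\<in>stabilizer n (tabloid n \<mu> T). polytabloid_int n \<mu> T (compose {1..n} t (compose {1..n} \<rho> \<tau>)))"
    unfolding row_sum_def by (intro sum.cong refl) (simp add: compose_compose_FI stabilizer_FI_hom)
  also have "\<dots> = row_sum n \<mu> T t"
    unfolding row_sum_def by (rule sum.reindex_bij_betw[OF bij_betw_stabilizer_left[OF \<rho>]])
  finally show ?thesis .
qed

text \<open>The transposition of p and q lies in both groups. Right translation by it permutes the
  terms of the sum, and at the same time changes the sign of each.\<close>

lemma symmetrized_polytabloid_eq_0:
  assumes T: "T \<in> tableaux n \<mu>" and t: "t \<in> tabloids n \<mu>"
    and pq: "p \<in> {1..n}" "q \<in> {1..n}" "p \<noteq> q" "column \<mu> T p = column \<mu> T q" "lab p = lab q"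
  shows "(\<Sum>\<rho>\<in>stabilizer n lab. polytabloid_int n \<mu> T (compose {1..n} t \<rho>)) = 0"
proof -
  let ?\<tau> = "tswap n p q"
  have \<tau>: "?\<tau> \<in> stabilizer n lab" "?\<tau> \<in> stabilizer n (column \<mu> T)"
    using pq by (auto intro!: tswap_stabilizer)
  have "(\<Sum>\<rho>\<in>stabilizer n lab. polytabloid_int n \<mu> T (compose {1..n} t \<rho>)) =
      (\<Sum>\<rho>\<in>stabilizer n lab. polytabloid_int n \<mu> T (compose {1..n} t (compose {1..n} \<rho> ?\<tau>)))"
    by (rule sum.reindex_bij_betw[OF bij_betw_stabilizer_right[OF \<tau>(1)], symmetric])
  also have "\<dots> = (\<Sum>\<rho>\<in>stabilizer n lab. - polytabloid_int n \<mu> T (compose {1..n} t \<rho>))"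
  proof (intro sum.cong refl)
    fix \<rho> assume "\<rho> \<in> stabilizer n lab"
    then have "compose {1..n} t \<rho> \<in> tabloids n \<mu>"
      using compose_tabloids[OF t] stabilizer_FI_hom by blast
    then show "polytabloid_int n \<mu> T (compose {1..n} t (compose {1..n} \<rho> ?\<tau>)) =
        - polytabloid_int n \<mu> T (compose {1..n} t \<rho>)"
      using polytabloid_int_compose_column[OF T \<tau>(2)] sgn_perm_tswap[OF pq(1-3)]
      by (simp add: compose_compose_FI[OF stabilizer_FI_hom[OF \<tau>(1)], symmetric])
  qed
  finally show ?thesis by (simp add: sum_negf)
qed

lemma tableaux_transitive:
  assumes S: "S \<in> tableaux n \<mu>" and T: "T \<in> tableaux n \<mu>"
  obtains \<sigma> where "\<sigma> \<in> FI_hom n n" and "S = compose (diagram \<mu>) \<sigma> T"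
proof -
  interpret S: tableau n \<mu> S using S by (rule tableauI)
  interpret T: tableau n \<mu> T using T by (rule tableauI)
  define \<sigma> where "\<sigma> = restrict (S \<circ> inv_into (diagram \<mu>) T) {1..n}"
  have "bij_betw (S \<circ> inv_into (diagram \<mu>) T) {1..n} {1..n}"
    using bij_betw_inv_into[OF T.bij] S.bij by (rule bij_betw_trans)
  then have "\<sigma> \<in> FI_hom n n"
    unfolding \<sigma>_def by (intro FI_hom_selfI) (simp_all only: bij_betw_restrict_eq restrict_extensional)
  moreover have "S = compose (diagram \<mu>) \<sigma> T"
  proof (rule extensionalityI[OF S.ext])
    show "S b = compose (diagram \<mu>) \<sigma> T b" if "b \<in> diagram \<mu>" for b
      using that T.entry[OF that] by (simp add: \<sigma>_def compose_eq)
  qed simp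
  ultimately show thesis by (rule that)
qed

text \<open>This makes the invariants of the row group at most one-dimensional. Either two entries
  of a column of S share a row of T and the symmetrization vanishes, or S becomes a row permutation
  of T after a column permutation of S.\<close>

lemma symmetrized_polytabloid:
  assumes S: "S \<in> tableaux n \<mu>" and T: "T \<in> tableaux n \<mu>" and \<mu>: "sorted_wrt (\<ge>) \<mu>"
  obtains c where "\<And>t. t \<in> tabloids n \<mu> \<Longrightarrow>
    (\<Sum>\<rho>\<in>stabilizer n (tabloid n \<mu> T). polytabloid_int n \<mu> S (compose {1..n} t \<rho>)) = c * row_sum n \<mu> T t"
proof -
  interpret S: tableau n \<mu> S using S by (rule tableauI)
  interpret T: tableau n \<mu> T using T by (rule tableauI)
  let ?s = "tabloid n \<mu> T"
  show thesis
  proof (rule column_permutation_or_repetition[OF S T.tabloid_in \<mu>])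
    fix p q assume "p \<in> {1..n}" "q \<in> {1..n}" "p \<noteq> q" "column \<mu> S p = column \<mu> S q" "?s p = ?s q"
    then show thesis
      using symmetrized_polytabloid_eq_0[OF S] by (intro that[of 0]) simp
  next
    fix \<pi> assume \<pi>: "\<pi> \<in> stabilizer n (column \<mu> S)" "compose {1..n} ?s \<pi> = tabloid n \<mu> S"
    note \<pi>' = stabilizer_FI_hom[OF \<pi>(1)]
    \<comment> \<open>S' has the tabloid of T, so it differs from T by an element \<sigma> of the
      row group, while its polytabloid is that of S up to the sign of \<pi>.\<close>
    define S' where "S' = compose (diagram \<mu>) \<pi> S"
    have S': "S' \<in> tableaux n \<mu>" unfolding S'_def using \<pi>' by (rule S.compose_tableau)
    interpret S': tableau n \<mu> S' using S' by (rule tableauI)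
    have "tabloid n \<mu> S' \<in> tabloids n \<mu>" by (rule S'.tabloid_in)
    moreover have "compose {1..n} (tabloid n \<mu> S') \<pi> = compose {1..n} ?s \<pi>"
      unfolding S'_def by (simp add: tabloid_compose[OF S \<pi>'] \<pi>(2))
    ultimately have tab_S': "tabloid n \<mu> S' = ?s"
      using bij_betw_imp_inj_on[OF bij_betw_tabloids[OF \<pi>', of \<mu>]] T.tabloid_in by (auto dest: inj_onD)
    obtain \<sigma> where \<sigma>: "\<sigma> \<in> FI_hom n n" and S'_\<sigma>: "S' = compose (diagram \<mu>) \<sigma> T"
      using tableaux_transitive[OF S' T] .
    have \<sigma>_stab: "\<sigma> \<in> stabilizer n ?s"
      using column_compose(2)[OF T \<sigma>] \<sigma> by (simp add: stabilizer_def S'_\<sigma>[symmetric] tab_S')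
    have eq: "polytabloid_int n \<mu> S t = sgn_perm n \<pi> * polytabloid_int n \<mu> T (compose {1..n} t \<sigma>)"
      if t: "t \<in> tabloids n \<mu>" for t
    proof -
      have "polytabloid_int n \<mu> T (compose {1..n} t \<sigma>) = polytabloid_int n \<mu> S' t"
        by (simp add: S'_\<sigma> polytabloid_int_compose[OF T \<sigma> t])
      also have "\<dots> = sgn_perm n \<pi> * polytabloid_int n \<mu> S t"
        by (simp add: S'_def polytabloid_int_compose[OF S \<pi>' t] polytabloid_int_compose_column[OF S \<pi>(1) t])
      moreover have "sgn_perm n \<pi> * sgn_perm n \<pi> = 1"
        using sgn_perm_sym_inv[OF \<pi>'] zmult_eq_1_iff by auto
      ultimately show ?thesis by (simp add: mult.assoc[symmetric])
    qed
    show thesis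
    proof (rule that[of "sgn_perm n \<pi>"])
      fix t assume t: "t \<in> tabloids n \<mu>"
      have "(\<Sum>\<rho>\<in>stabilizer n ?s. polytabloid_int n \<mu> S (compose {1..n} t \<rho>)) =
          sgn_perm n \<pi> * (\<Sum>\<rho>\<in>stabilizer n ?s. polytabloid_int n \<mu> T (compose {1..n} t (compose {1..n} \<rho> \<sigma>)))"
        unfolding sum_distrib_left
        by (intro sum.cong refl) (simp add: eq compose_tabloids[OF t] stabilizer_FI_hom compose_compose_FI[OF \<sigma>])
      also have "(\<Sum>\<rho>\<in>stabilizer n ?s. polytabloid_int n \<mu> T (compose {1..n} t (compose {1..n} \<rho> \<sigma>))) =
          row_sum n \<mu> T t"
        unfolding row_sum_def by (rule sum.reindex_bij_betw[OF bij_betw_stabilizer_right[OF \<sigma>_stab]])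
      finally show "(\<Sum>\<rho>\<in>stabilizer n ?s. polytabloid_int n \<mu> S (compose {1..n} t \<rho>)) =
          sgn_perm n \<pi> * row_sum n \<mu> T t" .
    qed
  qed
qed

text \<open>\<open>row_norm\<close> is nonzero because, up to the order of the row group, it is the sum of the squares of the
  values of \<open>row_sum\<close>.\<close>

definition row_norm :: "nat \<Rightarrow> nat list \<Rightarrow> (nat \<times> nat \<Rightarrow> nat) \<Rightarrow> int" where
  "row_norm n \<mu> T = (\<Sum>s\<in>tabloids n \<mu>. row_sum n \<mu> T s * polytabloid_int n \<mu> T s)"

lemma row_norm_nonzero:
  assumes T: "T \<in> tableaux n \<mu>"
  shows "row_norm n \<mu> T \<noteq> 0"
proof -
  interpret T: tableau n \<mu> T using T by (rule tableauI)
  let ?R = "stabilizer n (tabloid n \<mu> T)" and ?t = "tabloid n \<mu> T"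
  have R: "card ?R > 0"
    using inc_stabilizer by (auto simp: card_gt_0_iff)
  have "(\<Sum>s\<in>tabloids n \<mu>. row_sum n \<mu> T s * row_sum n \<mu> T s) =
      (\<Sum>\<rho>\<in>?R. \<Sum>s\<in>tabloids n \<mu>. row_sum n \<mu> T s * polytabloid_int n \<mu> T (compose {1..n} s \<rho>))"
    unfolding row_sum_def[of n \<mu> T s for s, abs_def] sum_distrib_left
    by (subst sum.swap) (simp add: sum_distrib_left row_sum_def)
  also have "\<dots> = (\<Sum>\<rho>\<in>?R. row_norm n \<mu> T)"
  proof (intro sum.cong refl)
    fix \<rho> assume \<rho>: "\<rho> \<in> ?R"
    have "(\<Sum>s\<in>tabloids n \<mu>. row_sum n \<mu> T s * polytabloid_int n \<mu> T (compose {1..n} s \<rho>)) =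
        (\<Sum>s\<in>tabloids n \<mu>. row_sum n \<mu> T (compose {1..n} s \<rho>) * polytabloid_int n \<mu> T (compose {1..n} s \<rho>))"
      by (simp add: row_sum_invariant[OF \<rho>])
    also have "\<dots> = row_norm n \<mu> T"
      unfolding row_norm_def
      by (rule sum.reindex_bij_betw[OF bij_betw_tabloids[OF stabilizer_FI_hom[OF \<rho>]]])
    finally show "(\<Sum>s\<in>tabloids n \<mu>. row_sum n \<mu> T s * polytabloid_int n \<mu> T (compose {1..n} s \<rho>)) =
      row_norm n \<mu> T" .
  qed
  finally have eq: "(\<Sum>s\<in>tabloids n \<mu>. row_sum n \<mu> T s * row_sum n \<mu> T s) = int (card ?R) * row_norm n \<mu> T"
    by simp
  have "compose {1..n} ?t \<rho> = ?t" if "\<rho> \<in> ?R" for \<rho>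
    using that by (intro extensionalityI[of _ "{1..n}"]) (auto simp: compose_eq stabilizer_def tabloid_def)
  then have "row_sum n \<mu> T ?t = int (card ?R)"
    by (simp add: row_sum_def polytabloid_int_self[OF T])
  then have "row_sum n \<mu> T ?t * row_sum n \<mu> T ?t > 0"
    using R by simp
  then have "(\<Sum>s\<in>tabloids n \<mu>. row_sum n \<mu> T s * row_sum n \<mu> T s) > 0"
    by (intro sum_pos2[of _ ?t]) (use T.tabloid_in in auto)
  then show ?thesis using eq by auto
qed

text \<open>Grouping the column permutations by the tabloid they produce gives the entries
  \<open>signed_count\<close>, and the rank one factorization takes the polytabloid out of the sum.
  With \<open>row_norm_nonzero\<close> the polytabloid is thereby recovered from its row
  symmetrization.\<close>

lemma antisymmetrized_row_sum:
  assumes T: "T \<in> tableaux n \<mu>" and \<mu>: "sorted_wrt (\<ge>) \<mu>" and t: "t \<in> tabloids n \<mu>"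
  shows "(\<Sum>\<sigma>\<in>stabilizer n (column \<mu> T). sgn_perm n \<sigma> * row_sum n \<mu> T (compose {1..n} t \<sigma>)) =
    row_norm n \<mu> T * polytabloid_int n \<mu> T t"
proof -
  let ?C = "stabilizer n (column \<mu> T)"
  have "(\<Sum>\<sigma>\<in>?C. sgn_perm n \<sigma> * row_sum n \<mu> T (compose {1..n} t \<sigma>)) =
      (\<Sum>s\<in>tabloids n \<mu>. \<Sum>\<sigma>\<in>{\<sigma> \<in> ?C. compose {1..n} t \<sigma> = s}. sgn_perm n \<sigma> * row_sum n \<mu> T (compose {1..n} t \<sigma>))"
    by (intro sum.group[symmetric]) (auto intro!: compose_tabloids[OF t] dest: stabilizer_FI_hom)
  also have "\<dots> = (\<Sum>s\<in>tabloids n \<mu>. row_sum n \<mu> T s * signed_count n \<mu> T t s)"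
    by (simp add: signed_count_def sum_distrib_left mult.commute)
  also have "\<dots> = (\<Sum>s\<in>tabloids n \<mu>. row_sum n \<mu> T s * polytabloid_int n \<mu> T s * polytabloid_int n \<mu> T t)"
    by (intro sum.cong refl) (simp add: signed_count_factor[OF T \<mu> t])
  finally show ?thesis by (simp add: row_norm_def sum_distrib_right)
qed

section \<open>Specht modules\<close>

lemma carrier_func_space [simp]: "carrier (class_ring.func_space S :: ('k::field, 'a \<Rightarrow> 'k) module) = extensional S"
  and zero_func_space [simp]: "\<zero>\<^bsub>class_ring.func_space S :: ('k::field, 'a \<Rightarrow> 'k) module\<^esub> = (\<lambda>x\<in>S. 0)"
  and add_func_space [simp]: "v \<oplus>\<^bsub>class_ring.func_space S :: ('k::field, 'a \<Rightarrow> 'k) module\<^esub> w = (\<lambda>x\<in>S. v x + w x)"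
  and smult_func_space [simp]: "c \<odot>\<^bsub>class_ring.func_space S :: ('k::field, 'a \<Rightarrow> 'k) module\<^esub> v = (\<lambda>x\<in>S. c * v x)"
  by (simp_all add: class_ring.func_space_def PiE_def)

lemma module_func_space: "Module.module class_ring (class_ring.func_space S :: ('k::field, 'a \<Rightarrow> 'k) module)"
  by (rule class_cring.func_space_is_module)

abbreviation Specht_carrier :: "nat \<Rightarrow> nat list \<Rightarrow> ((nat \<Rightarrow> nat) \<Rightarrow> 'k::field) set" where
  "Specht_carrier n \<mu> \<equiv> carrier (space (Specht n \<mu> :: ('k, (nat \<Rightarrow> nat) \<Rightarrow> 'k) sym_rep))"

abbreviation Specht_act :: "nat \<Rightarrow> nat list \<Rightarrow> (nat \<Rightarrow> nat) \<Rightarrow> ((nat \<Rightarrow> nat) \<Rightarrow> 'k::field) \<Rightarrow> (nat \<Rightarrow> nat) \<Rightarrow> 'k" where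
  "Specht_act n \<mu> \<sigma> v \<equiv> (\<lambda>t\<in>tabloids n \<mu>. v (compose {1..n} t \<sigma>))"

lemma act_Specht [simp]: "act (Specht n \<mu>) \<sigma> v = Specht_act n \<mu> \<sigma> v"
  by (simp add: Specht_def)

lemma zero_Specht [simp]: "\<zero>\<^bsub>space (Specht n \<mu>)\<^esub> = (\<lambda>t\<in>tabloids n \<mu>. 0)"
  and add_Specht [simp]: "v \<oplus>\<^bsub>space (Specht n \<mu>)\<^esub> w = (\<lambda>t\<in>tabloids n \<mu>. v t + w t)"
  and smult_Specht [simp]: "c \<odot>\<^bsub>space (Specht n \<mu>)\<^esub> v = (\<lambda>t\<in>tabloids n \<mu>. c * v t)"
  by (simp_all add: Specht_def)

lemma polytabloid_extensional: "polytabloid n \<mu> ` tableaux n \<mu> \<subseteq> extensional (tabloids n \<mu>)"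
  by (auto simp: polytabloid_def)

lemma Specht_carrier_eq:
  "Specht_carrier n \<mu> = LinearCombinations.module.span class_ring
     (class_ring.func_space (tabloids n \<mu>)) (polytabloid n \<mu> ` tableaux n \<mu>)"
  by (simp add: Specht_def)

lemma submodule_Specht:
  "submodule class_ring (Specht_carrier n \<mu> :: ((nat \<Rightarrow> nat) \<Rightarrow> 'k::field) set)
     (class_ring.func_space (tabloids n \<mu>))"
proof -
  interpret F: Module.module "class_ring :: 'k ring" "class_ring.func_space (tabloids n \<mu>)"
    by (rule module_func_space)
  show ?thesis
    unfolding Specht_carrier_eq using polytabloid_extensional
    by (intro F.span_is_submodule) simp
qed

lemma Specht_extensional: "w \<in> Specht_carrier n \<mu> \<Longrightarrow> w \<in> extensional (tabloids n \<mu>)"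
  using submodule.subset[OF submodule_Specht, of n \<mu>] by auto

lemma Specht_closed:
  fixes v w :: "(nat \<Rightarrow> nat) \<Rightarrow> 'k::field"
  shows "(\<lambda>t\<in>tabloids n \<mu>. 0 :: 'k) \<in> Specht_carrier n \<mu>"
    and "v \<in> Specht_carrier n \<mu> \<Longrightarrow> w \<in> Specht_carrier n \<mu> \<Longrightarrow> (\<lambda>t\<in>tabloids n \<mu>. v t + w t) \<in> Specht_carrier n \<mu>"
    and "v \<in> Specht_carrier n \<mu> \<Longrightarrow> (\<lambda>t\<in>tabloids n \<mu>. c * v t) \<in> Specht_carrier n \<mu>"
  using submodule.zero_closed[OF submodule_Specht, of n \<mu>] submodule.m_closed[OF submodule_Specht, of v n \<mu> w]
    submodule.smult_closed[OF submodule_Specht, of c v n \<mu>]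
  by simp_all

lemma polytabloid_in_Specht: "T \<in> tableaux n \<mu> \<Longrightarrow> polytabloid n \<mu> T \<in> (Specht_carrier n \<mu> :: ((nat \<Rightarrow> nat) \<Rightarrow> 'k::field) set)"
proof -
  interpret F: Module.module "class_ring :: 'k ring" "class_ring.func_space (tabloids n \<mu>)"
    by (rule module_func_space)
  show "T \<in> tableaux n \<mu> \<Longrightarrow> polytabloid n \<mu> T \<in> (Specht_carrier n \<mu> :: ((nat \<Rightarrow> nat) \<Rightarrow> 'k) set)"
    unfolding Specht_carrier_eq using F.in_own_span[of "polytabloid n \<mu> ` tableaux n \<mu>"] polytabloid_extensional
    by auto
qed

lemma Specht_sum:
  fixes v :: "'i \<Rightarrow> (nat \<Rightarrow> nat) \<Rightarrow> 'k::field"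
  assumes "\<And>i. i \<in> A \<Longrightarrow> v i \<in> Specht_carrier n \<mu>" and "\<And>i. i \<in> A \<Longrightarrow> Q (v i)"
    and "Q (\<lambda>t\<in>tabloids n \<mu>. 0)"
    and "\<And>v w. v \<in> Specht_carrier n \<mu> \<Longrightarrow> w \<in> Specht_carrier n \<mu> \<Longrightarrow> Q v \<Longrightarrow> Q w \<Longrightarrow> Q (\<lambda>t\<in>tabloids n \<mu>. v t + w t)"
    and "\<And>c v. v \<in> Specht_carrier n \<mu> \<Longrightarrow> Q v \<Longrightarrow> Q (\<lambda>t\<in>tabloids n \<mu>. c * v t)"
  shows "Q (\<lambda>t\<in>tabloids n \<mu>. \<Sum>i\<in>A. c i * v i t)"
    and "(\<lambda>t\<in>tabloids n \<mu>. \<Sum>i\<in>A. c i * v i t) \<in> Specht_carrier n \<mu>"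
proof -
  have "Q (\<lambda>t\<in>tabloids n \<mu>. \<Sum>i\<in>A. c i * v i t) \<and> (\<lambda>t\<in>tabloids n \<mu>. \<Sum>i\<in>A. c i * v i t) \<in> Specht_carrier n \<mu>"
    using assms(1,2)
  proof (induction A rule: infinite_finite_induct)
    case (insert i A)
    have "(\<lambda>t\<in>tabloids n \<mu>. \<Sum>i\<in>insert i A. c i * v i t) =
        (\<lambda>t\<in>tabloids n \<mu>. (\<lambda>t\<in>tabloids n \<mu>. c i * v i t) t + (\<lambda>t\<in>tabloids n \<mu>. \<Sum>i\<in>A. c i * v i t) t)"
      using insert.hyps by (auto simp: fun_eq_iff)
    moreover have "Q (\<lambda>t\<in>tabloids n \<mu>. c i * v i t)" "(\<lambda>t\<in>tabloids n \<mu>. c i * v i t) \<in> Specht_carrier n \<mu>"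
      using insert.prems by (auto intro!: assms(5) Specht_closed(3))
    moreover have "Q (\<lambda>t\<in>tabloids n \<mu>. \<Sum>i\<in>A. c i * v i t)"
      "(\<lambda>t\<in>tabloids n \<mu>. \<Sum>i\<in>A. c i * v i t) \<in> Specht_carrier n \<mu>"
      using insert.IH insert.prems by blast+
    ultimately show ?case
      by (simp only: assms(4) Specht_closed(2) conj_absorb simp_thms)
  qed (simp_all add: assms(3) Specht_closed(1))
  then show "Q (\<lambda>t\<in>tabloids n \<mu>. \<Sum>i\<in>A. c i * v i t)"
    and "(\<lambda>t\<in>tabloids n \<mu>. \<Sum>i\<in>A. c i * v i t) \<in> Specht_carrier n \<mu>" by blast+
qed

text \<open>The vectors of the Specht module with property Q form a submodule that contains the
  polytabloids.\<close>

lemma Specht_induct [consumes 1, case_names polytabloid zero add smult]: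
  fixes w :: "(nat \<Rightarrow> nat) \<Rightarrow> 'k::field"
  assumes w: "w \<in> Specht_carrier n \<mu>"
    and poly: "\<And>T. T \<in> tableaux n \<mu> \<Longrightarrow> Q (polytabloid n \<mu> T)"
    and zero: "Q (\<lambda>t\<in>tabloids n \<mu>. 0)"
    and add: "\<And>v w. v \<in> Specht_carrier n \<mu> \<Longrightarrow> w \<in> Specht_carrier n \<mu> \<Longrightarrow> Q v \<Longrightarrow> Q w \<Longrightarrow>
      Q (\<lambda>t\<in>tabloids n \<mu>. v t + w t)"
    and smult: "\<And>c v. v \<in> Specht_carrier n \<mu> \<Longrightarrow> Q v \<Longrightarrow> Q (\<lambda>t\<in>tabloids n \<mu>. c * v t)"
  shows "Q w"
proof -
  interpret F: Module.module "class_ring :: 'k ring" "class_ring.func_space (tabloids n \<mu>)"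
    by (rule module_func_space)
  let ?N = "{w \<in> Specht_carrier n \<mu>. Q w}"
  have "submodule class_ring ?N (class_ring.func_space (tabloids n \<mu>))"
    using F.module_axioms Specht_extensional
    by (intro submodule.intro) (auto intro!: zero add smult Specht_closed)
  then have "F.span (polytabloid n \<mu> ` tableaux n \<mu>) \<subseteq> ?N"
    using poly polytabloid_in_Specht by (intro F.span_is_subset) auto
  then show ?thesis
    using w unfolding Specht_carrier_eq by blast
qed

lemma Specht_act_compose:
  assumes "\<sigma> \<in> FI_hom n n" and "\<tau> \<in> FI_hom n n"
  shows "Specht_act n \<mu> \<sigma> (Specht_act n \<mu> \<tau> v) = Specht_act n \<mu> (compose {1..n} \<sigma> \<tau>) v"
  using assms by (auto simp: fun_eq_iff compose_tabloids compose_compose_FI)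

lemma Specht_act_inc:
  assumes "v \<in> Specht_carrier n \<mu>"
  shows "Specht_act n \<mu> (inc n) v = v"
proof (rule extensionalityI[OF _ Specht_extensional[OF assms]])
  show "Specht_act n \<mu> (inc n) v t = v t" if "t \<in> tabloids n \<mu>" for t
    using that compose_inc_right[OF tabloid_extensional[OF that]] by simp
qed simp

lemma Specht_act_polytabloid:
  assumes T: "T \<in> tableaux n \<mu>" and \<sigma>: "\<sigma> \<in> FI_hom n n"
  shows "Specht_act n \<mu> \<sigma> (polytabloid n \<mu> T) = polytabloid n \<mu> (compose (diagram \<mu>) \<sigma> T)"
proof -
  interpret T: tableau n \<mu> T using T by (rule tableauI)
  show ?thesis
    using \<sigma> by (auto simp: fun_eq_iff polytabloid_eq[OF T] polytabloid_eq[OF T.compose_tableau[OF \<sigma>]]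
        polytabloid_int_compose[OF T \<sigma>] compose_tabloids)
qed

lemma Specht_act_closed:
  fixes w :: "(nat \<Rightarrow> nat) \<Rightarrow> 'k::field"
  assumes w: "w \<in> Specht_carrier n \<mu>" and \<sigma>: "\<sigma> \<in> FI_hom n n"
  shows "Specht_act n \<mu> \<sigma> w \<in> Specht_carrier n \<mu>"
  using w
proof (induction rule: Specht_induct)
  case (polytabloid T)
  then show ?case
    by (simp add: Specht_act_polytabloid[OF _ \<sigma>] polytabloid_in_Specht tableau.compose_tableau[OF tableauI, OF _ \<sigma>])
next
  case zero
  have "Specht_act n \<mu> \<sigma> (\<lambda>t\<in>tabloids n \<mu>. 0 :: 'k) = (\<lambda>t\<in>tabloids n \<mu>. 0)"
    using \<sigma> by (auto simp: fun_eq_iff compose_tabloids)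
  then show ?case by (simp only: Specht_closed(1))
next
  case (add v w)
  have "Specht_act n \<mu> \<sigma> (\<lambda>t\<in>tabloids n \<mu>. v t + w t) =
      (\<lambda>t\<in>tabloids n \<mu>. Specht_act n \<mu> \<sigma> v t + Specht_act n \<mu> \<sigma> w t)"
    using \<sigma> by (auto simp: fun_eq_iff compose_tabloids)
  then show ?case using Specht_closed(2)[OF add.IH] by (simp only:)
next
  case (smult c v)
  have "Specht_act n \<mu> \<sigma> (\<lambda>t\<in>tabloids n \<mu>. c * v t) = (\<lambda>t\<in>tabloids n \<mu>. c * Specht_act n \<mu> \<sigma> v t)"
    using \<sigma> by (auto simp: fun_eq_iff compose_tabloids)
  then show ?case using Specht_closed(3)[OF smult.IH] by (simp only:)
qed

section \<open>The row-symmetrized vector as generator and as invariant\<close>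

definition row_vector :: "nat \<Rightarrow> nat list \<Rightarrow> (nat \<times> nat \<Rightarrow> nat) \<Rightarrow> (nat \<Rightarrow> nat) \<Rightarrow> 'k::field" where
  "row_vector n \<mu> T = (\<lambda>t\<in>tabloids n \<mu>. of_int (row_sum n \<mu> T t))"

lemma row_vector_in_Specht:
  assumes T: "T \<in> tableaux n \<mu>"
  shows "(row_vector n \<mu> T :: _ \<Rightarrow> 'k::field) \<in> Specht_carrier n \<mu>"
proof -
  let ?R = "stabilizer n (tabloid n \<mu> T)"
  have "row_vector n \<mu> T = (\<lambda>t\<in>tabloids n \<mu>. \<Sum>\<rho>\<in>?R. 1 * Specht_act n \<mu> \<rho> (polytabloid n \<mu> T :: _ \<Rightarrow> 'k) t)"
    by (auto simp: fun_eq_iff row_vector_def row_sum_def polytabloid_eq[OF T] compose_tabloids stabilizer_FI_hom)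
  moreover have "\<dots> \<in> Specht_carrier n \<mu>"
  proof (rule Specht_sum(2)[where Q = "\<lambda>_. True"])
    show "Specht_act n \<mu> \<rho> (polytabloid n \<mu> T :: _ \<Rightarrow> 'k) \<in> Specht_carrier n \<mu>" if "\<rho> \<in> ?R" for \<rho>
      using that by (intro Specht_act_closed polytabloid_in_Specht T stabilizer_FI_hom)
  qed simp_all
  ultimately show ?thesis by simp
qed

lemma row_vector_invariant:
  assumes "\<rho> \<in> stabilizer n (tabloid n \<mu> T)"
  shows "Specht_act n \<mu> \<rho> (row_vector n \<mu> T) = row_vector n \<mu> T"
  using assms by (auto simp: fun_eq_iff row_vector_def row_sum_invariant compose_tabloids stabilizer_FI_hom)

text \<open>By \<open>antisymmetrized_row_sum\<close>, the polytabloid of \<sigma> T is the sum,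
  over \<tau> in the column group of T, of sgn(\<tau>) / \<open>row_norm\<close> times \<sigma>
  \<tau> applied to the row vector. Characteristic zero makes the nonzero integer
  \<open>row_norm\<close> invertible.\<close>

lemma Specht_cyclic_induct [consumes 3, case_names act add smult]:
  fixes w :: "(nat \<Rightarrow> nat) \<Rightarrow> 'k::field_char_0"
  assumes w: "w \<in> Specht_carrier n \<mu>" and T: "T \<in> tableaux n \<mu>" and \<mu>: "sorted_wrt (\<ge>) \<mu>"
    and act: "\<And>\<sigma>. \<sigma> \<in> FI_hom n n \<Longrightarrow> Q (Specht_act n \<mu> \<sigma> (row_vector n \<mu> T))"
    and add: "\<And>v w. v \<in> Specht_carrier n \<mu> \<Longrightarrow> w \<in> Specht_carrier n \<mu> \<Longrightarrow> Q v \<Longrightarrow> Q w \<Longrightarrow>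
      Q (\<lambda>t\<in>tabloids n \<mu>. v t + w t)"
    and smult: "\<And>c v. v \<in> Specht_carrier n \<mu> \<Longrightarrow> Q v \<Longrightarrow> Q (\<lambda>t\<in>tabloids n \<mu>. c * v t)"
  shows "Q w"
proof -
  let ?u = "row_vector n \<mu> T :: _ \<Rightarrow> 'k" and ?C = "stabilizer n (column \<mu> T)"
  have act_in: "Specht_act n \<mu> \<sigma> ?u \<in> Specht_carrier n \<mu>" if "\<sigma> \<in> FI_hom n n" for \<sigma>
    using Specht_act_closed[OF row_vector_in_Specht[OF T] that] .
  have zero: "Q (\<lambda>t\<in>tabloids n \<mu>. 0)"
    using smult[OF act_in[OF inc_FI_hom] act[OF inc_FI_hom], where c = 0] by simp
  from w show ?thesis
  proof (induction rule: Specht_induct)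
    case (polytabloid S)
    obtain \<sigma> where \<sigma>: "\<sigma> \<in> FI_hom n n" and S: "S = compose (diagram \<mu>) \<sigma> T"
      using tableaux_transitive[OF polytabloid T] .
    define c where "c \<tau> = of_int (sgn_perm n \<tau>) / (of_int (row_norm n \<mu> T) :: 'k)" for \<tau>
    have \<sigma>\<tau>: "compose {1..n} \<sigma> \<tau> \<in> FI_hom n n" if "\<tau> \<in> ?C" for \<tau>
      using compose_FI_hom[OF stabilizer_FI_hom[OF that] \<sigma>] .
    have eq: "polytabloid n \<mu> S =
        (\<lambda>t\<in>tabloids n \<mu>. \<Sum>\<tau>\<in>?C. c \<tau> * Specht_act n \<mu> (compose {1..n} \<sigma> \<tau>) ?u t)"
    proof -
      have "polytabloid_int n \<mu> S t = polytabloid_int n \<mu> T (compose {1..n} t \<sigma>)"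
        if "t \<in> tabloids n \<mu>" for t
        using that by (simp add: S polytabloid_int_compose[OF T \<sigma>])
      moreover have "(\<Sum>\<tau>\<in>?C. c \<tau> * Specht_act n \<mu> (compose {1..n} \<sigma> \<tau>) ?u t) =
          of_int (polytabloid_int n \<mu> T (compose {1..n} t \<sigma>))" if t: "t \<in> tabloids n \<mu>" for t
      proof -
        have t\<sigma>: "compose {1..n} t \<sigma> \<in> tabloids n \<mu>" using t \<sigma> by (rule compose_tabloids)
        have "(\<Sum>\<tau>\<in>?C. c \<tau> * Specht_act n \<mu> (compose {1..n} \<sigma> \<tau>) ?u t) =
            (\<Sum>\<tau>\<in>?C. of_int (sgn_perm n \<tau> * row_sum n \<mu> T (compose {1..n} (compose {1..n} t \<sigma>) \<tau>))
              / of_int (row_norm n \<mu> T))"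
          using t t\<sigma> by (intro sum.cong refl)
            (simp add: c_def row_vector_def compose_tabloids \<sigma>\<tau> compose_compose_FI stabilizer_FI_hom)
        also have "\<dots> = of_int (row_norm n \<mu> T * polytabloid_int n \<mu> T (compose {1..n} t \<sigma>)) / of_int (row_norm n \<mu> T)"
          by (simp only: sum_divide_distrib[symmetric] of_int_sum[symmetric] antisymmetrized_row_sum[OF T \<mu> t\<sigma>])
        finally show ?thesis
          using row_norm_nonzero[OF T] by simp
      qed
      ultimately show ?thesis
        by (auto simp: fun_eq_iff polytabloid_eq[OF polytabloid])
    qed
    show ?case
      unfolding eq
      by (rule Specht_sum(1)) (assumption | rule zero add smult act act_in \<sigma>\<tau>)+
  qed (assumption | rule zero add smult)+
qed

text \<open>Summation over the row group multiplies an invariant vector by the order of the group,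
  and takes every polytabloid, hence every vector, to a multiple of the row vector.\<close>

lemma Specht_row_invariant:
  fixes w :: "(nat \<Rightarrow> nat) \<Rightarrow> 'k::field_char_0"
  assumes w: "w \<in> Specht_carrier n \<mu>" and T: "T \<in> tableaux n \<mu>" and \<mu>: "sorted_wrt (\<ge>) \<mu>"
    and inv: "\<And>\<rho>. \<rho> \<in> stabilizer n (tabloid n \<mu> T) \<Longrightarrow> Specht_act n \<mu> \<rho> w = w"
  obtains c where "w = (\<lambda>t\<in>tabloids n \<mu>. c * row_vector n \<mu> T t)"
proof -
  let ?R = "stabilizer n (tabloid n \<mu> T)"
  have R: "(of_nat (card ?R) :: 'k) \<noteq> 0"
    using inc_stabilizer finite_stabilizer by (auto simp: card_eq_0_iff)
  have "\<exists>c. \<forall>t\<in>tabloids n \<mu>. (\<Sum>\<rho>\<in>?R. w (compose {1..n} t \<rho>)) = c * row_vector n \<mu> T t"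
    using w
  proof (induction rule: Specht_induct)
    case (polytabloid S)
    obtain c where "\<And>t. t \<in> tabloids n \<mu> \<Longrightarrow>
        (\<Sum>\<rho>\<in>?R. polytabloid_int n \<mu> S (compose {1..n} t \<rho>)) = c * row_sum n \<mu> T t"
      using symmetrized_polytabloid[OF polytabloid T \<mu>] by blast
    then have "(\<Sum>\<rho>\<in>?R. polytabloid n \<mu> S (compose {1..n} t \<rho>)) = of_int c * (row_vector n \<mu> T t :: 'k)"
      if "t \<in> tabloids n \<mu>" for t
      using that by (simp add: polytabloid_eq[OF polytabloid] row_vector_def compose_tabloids stabilizer_FI_hom
          of_int_sum[symmetric] of_int_mult[symmetric] del: of_int_sum of_int_mult)
    then show ?case by blast
  next
    case zero
    show ?case
      by (intro exI[of _ 0]) (auto simp: compose_tabloids stabilizer_FI_hom)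
  next
    case (add v w)
    then obtain c d where "\<forall>t\<in>tabloids n \<mu>. (\<Sum>\<rho>\<in>?R. v (compose {1..n} t \<rho>)) = c * row_vector n \<mu> T t"
      "\<forall>t\<in>tabloids n \<mu>. (\<Sum>\<rho>\<in>?R. w (compose {1..n} t \<rho>)) = d * row_vector n \<mu> T t" by blast
    then show ?case
      by (intro exI[of _ "c + d"]) (auto simp: compose_tabloids stabilizer_FI_hom sum.distrib distrib_right)
  next
    case (smult a v)
    then obtain c where "\<forall>t\<in>tabloids n \<mu>. (\<Sum>\<rho>\<in>?R. v (compose {1..n} t \<rho>)) = c * row_vector n \<mu> T t" by blast
    then show ?case
      by (intro exI[of _ "a * c"]) (auto simp: compose_tabloids stabilizer_FI_hom sum_distrib_left[symmetric])
  qed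
  then obtain c where c: "\<And>t. t \<in> tabloids n \<mu> \<Longrightarrow> (\<Sum>\<rho>\<in>?R. w (compose {1..n} t \<rho>)) = c * row_vector n \<mu> T t"
    by blast
  have "w (compose {1..n} t \<rho>) = w t" if "\<rho> \<in> ?R" "t \<in> tabloids n \<mu>" for \<rho> t
    using fun_cong[OF inv[OF that(1)], of t] that by simp
  then have "of_nat (card ?R) * w t = c * row_vector n \<mu> T t" if "t \<in> tabloids n \<mu>" for t
    using c[OF that] that by simp
  then have "w t = c / of_nat (card ?R) * row_vector n \<mu> T t" if "t \<in> tabloids n \<mu>" for t
    using that R by (simp add: field_simps)
  then have "w = (\<lambda>t\<in>tabloids n \<mu>. c / of_nat (card ?R) * row_vector n \<mu> T t)"
    by (intro extensionalityI[OF Specht_extensional[OF w]]) auto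
  then show thesis by (rule that)
qed

text \<open>A set with more elements than \<open>\<mu>\<close> has columns contains two entries of the same column of any
  tableau.\<close>

lemma Specht_large_invariant:
  fixes w :: "(nat \<Rightarrow> nat) \<Rightarrow> 'k::field_char_0"
  assumes w: "w \<in> Specht_carrier n \<mu>" and \<mu>: "sorted_wrt (\<ge>) \<mu>" "\<mu> \<noteq> []"
    and A: "A \<subseteq> {1..n}" "card A > \<mu> ! 0"
    and inv: "\<And>\<rho>. \<rho> \<in> FI_hom n n \<Longrightarrow> \<forall>k\<in>{1..n} - A. \<rho> k = k \<Longrightarrow> Specht_act n \<mu> \<rho> w = w"
  shows "w = (\<lambda>t\<in>tabloids n \<mu>. 0)"
proof -
  \<comment> \<open>The elements of A share the label 0, which is not an entry, and every other
    entry is its own label. The stabilizer is thus the symmetric group on A.\<close>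
  define lab where "lab k = (if k \<in> A then 0 else k)" for k
  let ?R = "stabilizer n lab"
  have R: "(of_nat (card ?R) :: 'k) \<noteq> 0"
    using inc_stabilizer finite_stabilizer by (auto simp: card_eq_0_iff)
  have "\<forall>t\<in>tabloids n \<mu>. (\<Sum>\<rho>\<in>?R. w (compose {1..n} t \<rho>)) = 0"
    using w
  proof (induction rule: Specht_induct)
    case (polytabloid S)
    interpret S: tableau n \<mu> S using polytabloid by (rule tableauI)
    have "column \<mu> S k < \<mu> ! 0" if k: "k \<in> {1..n}" for k
    proof -
      obtain b where b: "b \<in> diagram \<mu>" "k = S b" using k by (rule S.entryE)
      then have "snd b < \<mu> ! fst b" "fst b < length \<mu>" by (auto simp: diagram_def)
      moreover have "\<mu> ! fst b \<le> \<mu> ! 0"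
        using sorted_wrt_nth_less[OF \<mu>(1), of 0 "fst b"] calculation(2) by (cases "fst b") auto
      ultimately show ?thesis using b by simp
    qed
    then have "column \<mu> S ` A \<subseteq> {..<\<mu> ! 0}"
      using A(1) by auto
    then have "card (column \<mu> S ` A) \<le> \<mu> ! 0"
      using card_mono[of "{..<\<mu> ! 0}"] by fastforce
    then have "\<not> inj_on (column \<mu> S) A"
      using A(2) card_image by fastforce
    then obtain p q where pq: "p \<in> A" "q \<in> A" "column \<mu> S p = column \<mu> S q" "p \<noteq> q"
      by (auto simp: inj_on_def)
    then have "(\<Sum>\<rho>\<in>?R. polytabloid_int n \<mu> S (compose {1..n} t \<rho>)) = 0" if "t \<in> tabloids n \<mu>" for t
      using A(1) by (intro symmetrized_polytabloid_eq_0[OF polytabloid that, of p q]) (auto simp: lab_def)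
    then show ?case
      by (auto simp: polytabloid_eq[OF polytabloid] compose_tabloids stabilizer_FI_hom
          of_int_sum[symmetric] simp del: of_int_sum)
  qed (simp_all add: compose_tabloids stabilizer_FI_hom sum.distrib sum_distrib_left[symmetric])
  moreover have "w (compose {1..n} t \<rho>) = w t" if \<rho>: "\<rho> \<in> ?R" and t: "t \<in> tabloids n \<mu>" for \<rho> t
  proof -
    have "\<rho> k = k" if k: "k \<in> {1..n} - A" for k
    proof -
      have "lab (\<rho> k) = k" "k \<noteq> 0" using \<rho> k by (auto simp: stabilizer_def lab_def)
      then show ?thesis by (auto simp: lab_def split: if_splits)
    qed
    then show ?thesis
      using fun_cong[OF inv[OF stabilizer_FI_hom[OF \<rho>]], of t] t by simp
  qed
  ultimately have "w t = 0" if "t \<in> tabloids n \<mu>" for t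
    using R that by simp
  then show ?thesis
    by (intro extensionalityI[OF Specht_extensional[OF w]]) auto
qed

section \<open>Free modules on Specht modules\<close>

declare act_Specht [simp del] zero_Specht [simp del] add_Specht [simp del] smult_Specht [simp del]

lemma act_Specht_closed:
  "w \<in> Specht_carrier n \<mu> \<Longrightarrow> \<sigma> \<in> FI_hom n n \<Longrightarrow> act (Specht n \<mu>) \<sigma> w \<in> Specht_carrier n \<mu>"
  unfolding act_Specht by (rule Specht_act_closed)

lemma act_Specht_compose:
  "\<sigma> \<in> FI_hom n n \<Longrightarrow> \<tau> \<in> FI_hom n n \<Longrightarrow>
    act (Specht n \<mu>) \<sigma> (act (Specht n \<mu>) \<tau> v) = act (Specht n \<mu>) (compose {1..n} \<sigma> \<tau>) v"
  unfolding act_Specht by (rule Specht_act_compose)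

lemma act_Specht_inc: "w \<in> Specht_carrier n \<mu> \<Longrightarrow> act (Specht n \<mu>) (inc n) w = w"
  unfolding act_Specht by (rule Specht_act_inc)

lemma act_Specht_add:
  "\<sigma> \<in> FI_hom n n \<Longrightarrow> act (Specht n \<mu>) \<sigma> (v \<oplus>\<^bsub>space (Specht n \<mu>)\<^esub> w) =
    act (Specht n \<mu>) \<sigma> v \<oplus>\<^bsub>space (Specht n \<mu>)\<^esub> act (Specht n \<mu>) \<sigma> w"
  by (auto simp: fun_eq_iff act_Specht add_Specht compose_tabloids)

lemma act_Specht_smult:
  "\<sigma> \<in> FI_hom n n \<Longrightarrow> act (Specht n \<mu>) \<sigma> (c \<odot>\<^bsub>space (Specht n \<mu>)\<^esub> v) =
    c \<odot>\<^bsub>space (Specht n \<mu>)\<^esub> act (Specht n \<mu>) \<sigma> v"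
  by (auto simp: fun_eq_iff act_Specht smult_Specht compose_tabloids)

lemma act_Specht_zero:
  "\<sigma> \<in> FI_hom n n \<Longrightarrow> act (Specht n \<mu>) \<sigma> \<zero>\<^bsub>space (Specht n \<mu>)\<^esub> = \<zero>\<^bsub>space (Specht n \<mu>)\<^esub>"
  by (auto simp: fun_eq_iff act_Specht zero_Specht compose_tabloids)

lemma Specht_add_closed:
    "v \<in> Specht_carrier n \<mu> \<Longrightarrow> w \<in> Specht_carrier n \<mu> \<Longrightarrow> v \<oplus>\<^bsub>space (Specht n \<mu>)\<^esub> w \<in> Specht_carrier n \<mu>"
  and Specht_smult_closed:
    "v \<in> Specht_carrier n \<mu> \<Longrightarrow> c \<odot>\<^bsub>space (Specht n \<mu>)\<^esub> v \<in> Specht_carrier n \<mu>"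
  and Specht_zero_closed: "\<zero>\<^bsub>space (Specht n \<mu>)\<^esub> \<in> Specht_carrier n \<mu>"
  unfolding zero_Specht add_Specht smult_Specht by (rule Specht_closed; assumption)+

lemma Specht_zero_smult: "0 \<odot>\<^bsub>space (Specht n \<mu>)\<^esub> v = \<zero>\<^bsub>space (Specht n \<mu> :: ('k::field, _) sym_rep)\<^esub>"
  by (simp add: zero_Specht smult_Specht)

lemma carrier_free:
    "carrier (obj (free_FI_module n W) k) = {F \<in> FI_hom n k \<rightarrow>\<^sub>E carrier (space W).
       \<forall>f\<in>FI_hom n k. \<forall>\<sigma>\<in>FI_hom n n. act W \<sigma> (F (compose {1..n} f \<sigma>)) = F f}"
  and zero_free: "\<zero>\<^bsub>obj (free_FI_module n W) k\<^esub> = (\<lambda>f\<in>FI_hom n k. \<zero>\<^bsub>space W\<^esub>)"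
  and add_free: "F \<oplus>\<^bsub>obj (free_FI_module n W) k\<^esub> G = (\<lambda>f\<in>FI_hom n k. F f \<oplus>\<^bsub>space W\<^esub> G f)"
  and smult_free: "c \<odot>\<^bsub>obj (free_FI_module n W) k\<^esub> F = (\<lambda>f\<in>FI_hom n k. c \<odot>\<^bsub>space W\<^esub> F f)"
  by (simp_all add: free_FI_module_def)

lemma arr_free: "arr (free_FI_module n W) m p g F = (\<lambda>h\<in>FI_hom n p.
    if h \<in> compose {1..n} g ` FI_hom n m
    then F (inv_into (FI_hom n m) (compose {1..n} g) h) else \<zero>\<^bsub>space W\<^esub>)"
  by (simp add: free_FI_module_def)

lemma inj_on_compose_left:
  assumes "g \<in> FI_hom m p"
  shows "inj_on (compose {1..n} g) (FI_hom n m)"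
proof (rule inj_onI)
  fix f f' assume f: "f \<in> FI_hom n m" "f' \<in> FI_hom n m" "compose {1..n} g f = compose {1..n} g f'"
  show "f = f'"
  proof (rule FI_hom_eqI[OF f(1,2)])
    fix k assume k: "k \<in> {1..n}"
    then have "g (f k) = g (f' k)"
      using fun_cong[OF f(3), of k] by (simp add: compose_eq)
    then show "f k = f' k"
      using FI_homD(1)[OF assms] FI_homD(3)[OF f(1) k] FI_homD(3)[OF f(2) k] by (auto dest: inj_onD)
  qed
qed

lemma arr_free_compose:
  assumes "g \<in> FI_hom m p" and "f \<in> FI_hom n m"
  shows "arr (free_FI_module n W) m p g F (compose {1..n} g f) = F f"
  using assms inj_on_compose_left[OF assms(1)] by (auto simp: arr_free inv_into_f_f)

lemma arr_free_outside:
  assumes "h \<in> FI_hom n p" and "h \<notin> compose {1..n} g ` FI_hom n m"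
  shows "arr (free_FI_module n W) m p g F h = \<zero>\<^bsub>space W\<^esub>"
  using assms by (simp add: arr_free)

lemma arr_free_extensional: "arr (free_FI_module n W) m p g F \<in> extensional (FI_hom n p)"
  by (simp add: arr_free)

lemma carrier_freeD:
  assumes "F \<in> carrier (obj (free_FI_module n W) k)"
  shows "F \<in> extensional (FI_hom n k)" and "\<And>f. f \<in> FI_hom n k \<Longrightarrow> F f \<in> carrier (space W)"
    and "\<And>f \<sigma>. f \<in> FI_hom n k \<Longrightarrow> \<sigma> \<in> FI_hom n n \<Longrightarrow> act W \<sigma> (F (compose {1..n} f \<sigma>)) = F f"
  using assms by (auto simp: carrier_free PiE_def)

lemma free_eqI:
  assumes "F \<in> extensional (FI_hom n k)" and "G \<in> extensional (FI_hom n k)"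
    and "\<And>f. f \<in> FI_hom n k \<Longrightarrow> F f = G f"
  shows "F = G"
  using assms by (rule extensionalityI)

context
  fixes n :: nat and \<mu> :: "nat list" and W :: "('k::field, (nat \<Rightarrow> nat) \<Rightarrow> 'k) sym_rep"
  defines W: "W \<equiv> Specht n \<mu>"
begin

lemma free_closed:
  shows "\<zero>\<^bsub>obj (free_FI_module n W) k\<^esub> \<in> carrier (obj (free_FI_module n W) k)"
    and "F \<in> carrier (obj (free_FI_module n W) k) \<Longrightarrow> G \<in> carrier (obj (free_FI_module n W) k) \<Longrightarrow>
      F \<oplus>\<^bsub>obj (free_FI_module n W) k\<^esub> G \<in> carrier (obj (free_FI_module n W) k)"
    and "F \<in> carrier (obj (free_FI_module n W) k) \<Longrightarrow>
      c \<odot>\<^bsub>obj (free_FI_module n W) k\<^esub> F \<in> carrier (obj (free_FI_module n W) k)"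
  unfolding W
  by (auto simp: carrier_free zero_free add_free smult_free act_Specht_zero act_Specht_add act_Specht_smult
      intro!: restrict_PiE Specht_zero_closed Specht_add_closed Specht_smult_closed)

text \<open>The injections that factor through g are stable under right translation by permutations
  of [n], so extension by zero preserves equivariance.\<close>

lemma arr_free_closed:
  assumes g: "g \<in> FI_hom m p" and F: "F \<in> carrier (obj (free_FI_module n W) m)"
  shows "arr (free_FI_module n W) m p g F \<in> carrier (obj (free_FI_module n W) p)"
proof -
  note F' = carrier_freeD[OF F]
  let ?G = "arr (free_FI_module n W) m p g F"
  have in_image: "h \<in> compose {1..n} g ` FI_hom n m" if "h \<in> FI_hom n p" "\<sigma> \<in> FI_hom n n"
    and h\<sigma>: "compose {1..n} h \<sigma> \<in> compose {1..n} g ` FI_hom n m" for h \<sigma>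
  proof -
    obtain f where f: "f \<in> FI_hom n m" "compose {1..n} h \<sigma> = compose {1..n} g f" using h\<sigma> by blast
    note \<sigma>i = sym_inv_FI_hom[OF that(2)]
    have "h = compose {1..n} (compose {1..n} h \<sigma>) (sym_inv n \<sigma>)"
      by (simp only: compose_compose_FI[OF \<sigma>i] compose_sym_inv[OF that(2)] compose_inc_right[OF FI_homD(2)[OF that(1)]])
    also have "\<dots> = compose {1..n} g (compose {1..n} f (sym_inv n \<sigma>))"
      by (simp only: f(2) compose_compose_FI[OF \<sigma>i])
    finally show ?thesis
      using compose_FI_hom[OF \<sigma>i f(1)] by blast
  qed
  have "?G h \<in> carrier (space W) \<and> act W \<sigma> (?G (compose {1..n} h \<sigma>)) = ?G h"
    if h: "h \<in> FI_hom n p" and \<sigma>: "\<sigma> \<in> FI_hom n n" for h \<sigma>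
  proof (cases "h \<in> compose {1..n} g ` FI_hom n m")
    case True
    then obtain f where f: "f \<in> FI_hom n m" "h = compose {1..n} g f" by blast
    have "?G h = F f" using arr_free_compose[OF g f(1)] f(2) by simp
    moreover have "?G (compose {1..n} h \<sigma>) = F (compose {1..n} f \<sigma>)"
      using arr_free_compose[OF g compose_FI_hom[OF \<sigma> f(1)]] by (simp add: f(2) compose_compose_FI[OF \<sigma>])
    ultimately show ?thesis using F'(2,3) f \<sigma> by simp
  next
    case False
    then have "?G h = \<zero>\<^bsub>space W\<^esub>" using arr_free_outside[OF h] by simp
    moreover have "?G (compose {1..n} h \<sigma>) = \<zero>\<^bsub>space W\<^esub>"
      using False in_image[OF h \<sigma>] arr_free_outside[OF compose_FI_hom[OF \<sigma> h]] by blast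
    ultimately show ?thesis using \<sigma> by (simp add: W act_Specht_zero Specht_zero_closed)
  qed
  then show ?thesis
    using arr_free_extensional inc_FI_hom[of n n] by (auto simp: carrier_free PiE_iff)
qed

lemma free_unit_apply: "\<sigma> \<in> FI_hom n n \<Longrightarrow> free_unit n W w \<sigma> = act W (sym_inv n \<sigma>) w"
  by (simp add: free_unit_def)

lemma sym_inv_compose:
  assumes "\<sigma> \<in> FI_hom n n" and "\<tau> \<in> FI_hom n n"
  shows "sym_inv n (compose {1..n} \<sigma> \<tau>) = compose {1..n} (sym_inv n \<tau>) (sym_inv n \<sigma>)"
proof (rule FI_hom_eqI)
  show "sym_inv n (compose {1..n} \<sigma> \<tau>) \<in> FI_hom n n"
    "compose {1..n} (sym_inv n \<tau>) (sym_inv n \<sigma>) \<in> FI_hom n n"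
    using assms by (auto intro!: sym_inv_FI_hom compose_FI_hom)
  fix k assume k: "k \<in> {1..n}"
  define l where "l = sym_inv n \<tau> (sym_inv n \<sigma> k)"
  have l1: "sym_inv n \<sigma> k \<in> {1..n}"
    using FI_homD(3)[OF sym_inv_FI_hom[OF assms(1)] k] .
  then have l: "l \<in> {1..n}"
    using FI_homD(3)[OF sym_inv_FI_hom[OF assms(2)]] by (simp only: l_def)
  have "compose {1..n} \<sigma> \<tau> l = k"
    using l assms k l1 by (simp only: compose_eq l_def sym_inv_right)
  then have "sym_inv n (compose {1..n} \<sigma> \<tau>) k = l"
    using sym_inv_left[OF compose_FI_hom[OF assms(2,1)] l] by simp
  then show "sym_inv n (compose {1..n} \<sigma> \<tau>) k = compose {1..n} (sym_inv n \<tau>) (sym_inv n \<sigma>) k"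
    using k by (simp only: compose_eq l_def)
qed

lemma free_unit_closed:
  assumes w: "w \<in> carrier (space W)"
  shows "free_unit n W w \<in> carrier (obj (free_FI_module n W) n)"
proof -
  have "act W \<tau> (free_unit n W w (compose {1..n} \<sigma> \<tau>)) = free_unit n W w \<sigma>"
    if \<sigma>: "\<sigma> \<in> FI_hom n n" and \<tau>: "\<tau> \<in> FI_hom n n" for \<sigma> \<tau>
  proof -
    note \<sigma>i = sym_inv_FI_hom[OF \<sigma>] and \<tau>i = sym_inv_FI_hom[OF \<tau>]
    have "compose {1..n} \<tau> (compose {1..n} (sym_inv n \<tau>) (sym_inv n \<sigma>)) = sym_inv n \<sigma>"
      by (simp only: compose_compose_FI[OF \<sigma>i, symmetric] compose_sym_inv[OF \<tau>] compose_inc_left[OF \<sigma>i order_refl])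
    then show ?thesis
      using \<sigma> \<tau> \<sigma>i \<tau>i
      by (simp add: free_unit_apply compose_FI_hom sym_inv_compose)
        (simp add: W act_Specht_compose compose_FI_hom)
  qed
  moreover have "free_unit n W w \<sigma> \<in> carrier (space W)" if "\<sigma> \<in> FI_hom n n" for \<sigma>
    using that w sym_inv_FI_hom[OF that] by (simp add: free_unit_apply) (simp add: W act_Specht_closed)
  ultimately show ?thesis
    by (auto simp: carrier_free free_unit_def)
qed

text \<open>The tensor f \<otimes> w in degree k.\<close>

definition generator :: "nat \<Rightarrow> (nat \<Rightarrow> nat) \<Rightarrow> ((nat \<Rightarrow> nat) \<Rightarrow> 'k) \<Rightarrow> (nat \<Rightarrow> nat) \<Rightarrow> (nat \<Rightarrow> nat) \<Rightarrow> 'k" where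
  "generator k f w = arr (free_FI_module n W) n k f (free_unit n W w)"

lemma generator_closed:
  "f \<in> FI_hom n k \<Longrightarrow> w \<in> carrier (space W) \<Longrightarrow> generator k f w \<in> carrier (obj (free_FI_module n W) k)"
  unfolding generator_def by (intro arr_free_closed free_unit_closed)

lemma generator_compose:
  "f \<in> FI_hom n k \<Longrightarrow> \<sigma> \<in> FI_hom n n \<Longrightarrow> generator k f w (compose {1..n} f \<sigma>) = act W (sym_inv n \<sigma>) w"
  by (simp add: generator_def arr_free_compose free_unit_apply)

lemma generator_outside:
  "h \<in> FI_hom n k \<Longrightarrow> h \<notin> compose {1..n} f ` FI_hom n n \<Longrightarrow> generator k f w h = \<zero>\<^bsub>space W\<^esub>"
  by (simp add: generator_def arr_free_outside)

text \<open>In tensor notation, \<sigma> \<otimes> w = id \<otimes> \<sigma> w.\<close>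

lemma arr_free_unit:
  assumes \<sigma>: "\<sigma> \<in> FI_hom n n" and w: "w \<in> carrier (space W)"
  shows "arr (free_FI_module n W) n n \<sigma> (free_unit n W w) = free_unit n W (act W \<sigma> w)"
proof (rule free_eqI[OF arr_free_extensional])
  show "free_unit n W (act W \<sigma> w) \<in> extensional (FI_hom n n)"
    by (simp add: free_unit_def)
  fix h assume h: "h \<in> FI_hom n n"
  note \<sigma>i = sym_inv_FI_hom[OF \<sigma>]
  let ?f = "compose {1..n} (sym_inv n \<sigma>) h"
  have f: "?f \<in> FI_hom n n" using h \<sigma>i by (rule compose_FI_hom)
  have h': "compose {1..n} \<sigma> ?f = h"
    by (simp only: compose_compose_FI[OF h, symmetric] compose_sym_inv[OF \<sigma>] compose_inc_left[OF h order_refl])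
  have inv_inv: "sym_inv n (sym_inv n \<sigma>) = \<sigma>"
  proof (rule FI_hom_eqI[OF sym_inv_FI_hom[OF \<sigma>i] \<sigma>])
    show "sym_inv n (sym_inv n \<sigma>) k = \<sigma> k" if "k \<in> {1..n}" for k
      using sym_inv_left[OF \<sigma>i FI_homD(3)[OF \<sigma> that]] sym_inv_left[OF \<sigma> that] by simp
  qed
  have "arr (free_FI_module n W) n n \<sigma> (free_unit n W w) h = act W (sym_inv n ?f) w"
    using arr_free_compose[OF \<sigma> f, of W "free_unit n W w"] h' f by (simp add: free_unit_apply)
  also have "\<dots> = act W (sym_inv n h) (act W \<sigma> w)"
    using h \<sigma>i \<sigma> sym_inv_FI_hom[OF h] by (simp add: sym_inv_compose inv_inv) (simp add: W act_Specht_compose compose_FI_hom)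
  finally show "arr (free_FI_module n W) n n \<sigma> (free_unit n W w) h = free_unit n W (act W \<sigma> w) h"
    using h by (simp add: free_unit_apply)
qed

lemma free_unit_add:
  "free_unit n W (v \<oplus>\<^bsub>space W\<^esub> w) = free_unit n W v \<oplus>\<^bsub>obj (free_FI_module n W) n\<^esub> free_unit n W w"
  unfolding free_unit_def add_free
  by (rule restrict_ext) (simp add: W act_Specht_add sym_inv_FI_hom)

lemma free_unit_smult:
  "free_unit n W (c \<odot>\<^bsub>space W\<^esub> w) = c \<odot>\<^bsub>obj (free_FI_module n W) n\<^esub> free_unit n W w"
  unfolding free_unit_def smult_free
  by (rule restrict_ext) (simp add: W act_Specht_smult sym_inv_FI_hom)

text \<open>A finite linear combination in degree k, evaluated pointwise on tabloids;
  \<open>free_sum_insert\<close> relates it to the operations of the module.\<close>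

definition free_sum :: "nat \<Rightarrow> ('i \<Rightarrow> 'k) \<Rightarrow> ('i \<Rightarrow> (nat \<Rightarrow> nat) \<Rightarrow> (nat \<Rightarrow> nat) \<Rightarrow> 'k) \<Rightarrow> 'i set \<Rightarrow>
    (nat \<Rightarrow> nat) \<Rightarrow> (nat \<Rightarrow> nat) \<Rightarrow> 'k" where
  "free_sum k c F A = (\<lambda>f\<in>FI_hom n k. \<lambda>t\<in>tabloids n \<mu>. \<Sum>i\<in>A. c i * F i f t)"

lemma free_sum_empty: "free_sum k c F {} = \<zero>\<^bsub>obj (free_FI_module n W) k\<^esub>"
  by (simp add: free_sum_def zero_free W zero_Specht)

lemma free_sum_insert:
  assumes "finite A" and "i \<notin> A"
  shows "free_sum k c F (insert i A) =
    (c i \<odot>\<^bsub>obj (free_FI_module n W) k\<^esub> F i) \<oplus>\<^bsub>obj (free_FI_module n W) k\<^esub> free_sum k c F A"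
  using assms by (auto simp: free_sum_def add_free smult_free W add_Specht smult_Specht fun_eq_iff)

lemma free_sum_closed:
  assumes "finite A" and "\<And>i. i \<in> A \<Longrightarrow> F i \<in> carrier (obj (free_FI_module n W) k)"
  shows "free_sum k c F A \<in> carrier (obj (free_FI_module n W) k)"
  using assms
proof (induction A rule: finite_induct)
  case (insert i A)
  then show ?case
    by (auto simp: free_sum_insert intro!: free_closed)
qed (simp only: free_sum_empty free_closed(1))

lemma linear_mapsD:
  assumes "\<phi> \<in> linear_maps U V"
  shows "v \<in> carrier U \<Longrightarrow> \<phi> v \<in> carrier V"
    and "v \<in> carrier U \<Longrightarrow> w \<in> carrier U \<Longrightarrow> \<phi> (v \<oplus>\<^bsub>U\<^esub> w) = \<phi> v \<oplus>\<^bsub>V\<^esub> \<phi> w"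
    and "v \<in> carrier U \<Longrightarrow> \<phi> (c \<odot>\<^bsub>U\<^esub> v) = c \<odot>\<^bsub>V\<^esub> \<phi> v"
    and "\<phi> \<in> extensional (carrier U)"
  using assms by (auto simp: linear_maps_def LinearCombinations.module_hom_def)

lemma linear_free_sum:
  assumes \<phi>: "\<phi> \<in> linear_maps (obj (free_FI_module n W) k) (class_ring.func_space S)"
    and "finite A" and "\<And>i. i \<in> A \<Longrightarrow> F i \<in> carrier (obj (free_FI_module n W) k)"
  shows "\<phi> (free_sum k c F A) = (\<lambda>y\<in>S. \<Sum>i\<in>A. c i * \<phi> (F i) y)"
  using assms(2,3)
proof (induction A rule: finite_induct)
  \<comment> \<open>Linear maps are characterized by additivity and homogeneity, so the value at
    zero comes from writing zero as a multiple with scalar 0.\<close>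
  case empty
  have "\<zero>\<^bsub>obj (free_FI_module n W) k\<^esub> = 0 \<odot>\<^bsub>obj (free_FI_module n W) k\<^esub> \<zero>\<^bsub>obj (free_FI_module n W) k\<^esub>"
    by (simp add: zero_free smult_free W Specht_zero_smult cong: restrict_cong)
  then have "\<phi> \<zero>\<^bsub>obj (free_FI_module n W) k\<^esub> = (\<lambda>y\<in>S. 0)"
    using linear_mapsD(3)[OF \<phi> free_closed(1), of 0] by simp
  then show ?case by (simp add: free_sum_empty)
next
  case (insert i A)
  then have Fi: "F i \<in> carrier (obj (free_FI_module n W) k)"
    and FA: "free_sum k c F A \<in> carrier (obj (free_FI_module n W) k)"
    and IH: "\<phi> (free_sum k c F A) = (\<lambda>y\<in>S. \<Sum>i\<in>A. c i * \<phi> (F i) y)"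
    by (blast intro: free_sum_closed)+
  have "\<phi> (free_sum k c F (insert i A)) =
      (c i \<odot>\<^bsub>class_ring.func_space S\<^esub> \<phi> (F i)) \<oplus>\<^bsub>class_ring.func_space S\<^esub> \<phi> (free_sum k c F A)"
    unfolding free_sum_insert[OF insert.hyps]
    by (simp only: linear_mapsD(2)[OF \<phi> free_closed(3)[OF Fi] FA] linear_mapsD(3)[OF \<phi> Fi])
  then show ?case
    using insert.hyps by (auto simp: IH fun_eq_iff)
qed

text \<open>F is 1/n! times the sum of the tensors f \<otimes> F(f) over all injections f. At an
  injection h only the f in the orbit of h under right translation contribute; there are n! of them,
  and by equivariance each contributes F(h).\<close>

lemma free_decomposition:
  assumes "(of_nat (card (FI_hom n n)) :: 'k) \<noteq> 0"
    and F: "F \<in> carrier (obj (free_FI_module n W) k)"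
  shows "F = free_sum k (\<lambda>_. 1 / of_nat (card (FI_hom n n))) (\<lambda>f. generator k f (F f)) (FI_hom n k)"
proof (rule free_eqI[OF carrier_freeD(1)[OF F]])
  note F' = carrier_freeD[OF F]
  show "free_sum k (\<lambda>_. 1 / of_nat (card (FI_hom n n))) (\<lambda>f. generator k f (F f)) (FI_hom n k) \<in> extensional (FI_hom n k)"
    by (simp add: free_sum_def)
  fix h assume h: "h \<in> FI_hom n k"
  define B where "B = (\<lambda>\<sigma>. compose {1..n} h \<sigma>) ` FI_hom n n"
  have B: "B \<subseteq> FI_hom n k" using h by (auto simp: B_def)
  have "card B = card (FI_hom n n)"
    unfolding B_def using inj_on_compose_left[OF h] by (rule card_image)
  have gen: "generator k f (F f) h = (if f \<in> B then F h else \<zero>\<^bsub>space W\<^esub>)" if f: "f \<in> FI_hom n k" for f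
  proof (cases "f \<in> B")
    case True
    then obtain \<sigma> where \<sigma>: "\<sigma> \<in> FI_hom n n" "f = compose {1..n} h \<sigma>" by (auto simp: B_def)
    note \<sigma>i = sym_inv_FI_hom[OF \<sigma>(1)]
    have h': "h = compose {1..n} f (sym_inv n \<sigma>)"
      by (simp only: \<sigma>(2) compose_compose_FI[OF \<sigma>i] compose_sym_inv[OF \<sigma>(1)] compose_inc_right[OF FI_homD(2)[OF h]])
    have "generator k f (F f) h = act W (sym_inv n (sym_inv n \<sigma>)) (F f)"
      using generator_compose[OF f \<sigma>i] h' by metis
    also have "\<dots> = act W (sym_inv n (sym_inv n \<sigma>)) (act W (sym_inv n \<sigma>) (F h))"
      using F'(3)[OF f \<sigma>i] h' by simp
    also have "\<dots> = F h"
      using F'(2)[OF h] \<sigma>i sym_inv_FI_hom[OF \<sigma>i] compose_sym_inv(1)[OF \<sigma>i]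
      by (simp add: W act_Specht_compose act_Specht_inc)
    finally show ?thesis using True by simp
  next
    case False
    have "h \<notin> compose {1..n} f ` FI_hom n n"
    proof
      assume "h \<in> compose {1..n} f ` FI_hom n n"
      then obtain \<sigma> where \<sigma>: "\<sigma> \<in> FI_hom n n" "h = compose {1..n} f \<sigma>" by auto
      have "f = compose {1..n} h (sym_inv n \<sigma>)"
        by (simp only: \<sigma>(2) compose_compose_FI[OF sym_inv_FI_hom[OF \<sigma>(1)]] compose_sym_inv[OF \<sigma>(1)]
            compose_inc_right[OF FI_homD(2)[OF f]])
      then show False using False sym_inv_FI_hom[OF \<sigma>(1)] by (auto simp: B_def)
    qed
    then show ?thesis using False generator_outside[OF h] by simp
  qed
  show "F h = free_sum k (\<lambda>_. 1 / of_nat (card (FI_hom n n))) (\<lambda>f. generator k f (F f)) (FI_hom n k) h"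
  proof (rule extensionalityI)
    show "F h \<in> extensional (tabloids n \<mu>)"
      using F'(2)[OF h] Specht_extensional unfolding W by blast
    show "free_sum k (\<lambda>_. 1 / of_nat (card (FI_hom n n))) (\<lambda>f. generator k f (F f)) (FI_hom n k) h \<in>
        extensional (tabloids n \<mu>)"
      using h by (simp add: free_sum_def)
    fix t assume t: "t \<in> tabloids n \<mu>"
    have "(\<Sum>f\<in>FI_hom n k. generator k f (F f) h t) = (\<Sum>f\<in>FI_hom n k. if f \<in> B then F h t else 0)"
      using t by (intro sum.cong refl) (simp add: gen W zero_Specht)
    also have "\<dots> = of_nat (card (FI_hom n n)) * F h t"
      using B \<open>card B = card (FI_hom n n)\<close> by (simp add: sum.If_cases Int_absorb1)
    finally show "F h t = free_sum k (\<lambda>_. 1 / of_nat (card (FI_hom n n))) (\<lambda>f. generator k f (F f)) (FI_hom n k) h t"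
      using t h assms(1) by (simp add: free_sum_def sum_divide_distrib[symmetric])
  qed
qed

end

section \<open>Morphisms out of free modules on Specht modules\<close>

lemma FI_HomD:
  assumes "\<phi> \<in> carrier (FI_Hom U V)"
  shows "\<phi> m \<in> linear_maps (obj U m) (obj V m)"
    and "f \<in> FI_hom m n \<Longrightarrow> v \<in> carrier (obj U m) \<Longrightarrow> \<phi> n (arr U m n f v) = arr V m n f (\<phi> m v)"
  using assms by (auto simp: FI_Hom_def)

lemma card_sym_nonzero: "(of_nat (card (FI_hom n n)) :: 'k::field_char_0) \<noteq> 0"
  using inc_FI_hom[of n n] by (auto simp: card_eq_0_iff)

lemma free_induct [consumes 1, case_names generator zero add smult]:
  fixes n :: nat and \<mu> :: "nat list" and W :: "('k::field_char_0, (nat \<Rightarrow> nat) \<Rightarrow> 'k) sym_rep"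
  defines "W \<equiv> Specht n \<mu>"
  assumes F: "F \<in> carrier (obj (free_FI_module n W) k)"
    and gen: "\<And>f w. f \<in> FI_hom n k \<Longrightarrow> w \<in> carrier (space W) \<Longrightarrow> Q (generator n \<mu> k f w)"
    and zero: "Q \<zero>\<^bsub>obj (free_FI_module n W) k\<^esub>"
    and add: "\<And>F G. F \<in> carrier (obj (free_FI_module n W) k) \<Longrightarrow> G \<in> carrier (obj (free_FI_module n W) k) \<Longrightarrow>
      Q F \<Longrightarrow> Q G \<Longrightarrow> Q (F \<oplus>\<^bsub>obj (free_FI_module n W) k\<^esub> G)"
    and smult: "\<And>c F. F \<in> carrier (obj (free_FI_module n W) k) \<Longrightarrow> Q F \<Longrightarrow>
      Q (c \<odot>\<^bsub>obj (free_FI_module n W) k\<^esub> F)"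
  shows "Q F"
proof -
  have "Q (free_sum n \<mu> k c G A)"
    if "finite A" "\<And>f. f \<in> A \<Longrightarrow> G f \<in> carrier (obj (free_FI_module n W) k)" "\<And>f. f \<in> A \<Longrightarrow> Q (G f)"
    for A c and G :: "_ \<Rightarrow> _ \<Rightarrow> _ \<Rightarrow> 'k"
    using that
  proof (induction A rule: finite_induct)
    case empty
    then show ?case using zero by (simp only: W_def free_sum_empty)
  next
    case (insert f A)
    then have "Q (c f \<odot>\<^bsub>obj (free_FI_module n W) k\<^esub> G f)" "Q (free_sum n \<mu> k c G A)"
      "c f \<odot>\<^bsub>obj (free_FI_module n W) k\<^esub> G f \<in> carrier (obj (free_FI_module n W) k)"
      "free_sum n \<mu> k c G A \<in> carrier (obj (free_FI_module n W) k)"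
      unfolding W_def by (blast intro: smult[unfolded W_def] free_sum_closed free_closed)+
    then show ?case
      using free_sum_insert[OF insert.hyps, where n = n and \<mu> = \<mu> and k = k and c = c and F = G] add
      by (simp only: W_def)
  qed
  then show ?thesis
    using free_decomposition[OF card_sym_nonzero, of F n \<mu> k] F gen carrier_freeD(2)[OF F]
      generator_closed[of _ n k _ \<mu>]
    by (metis (no_types, lifting) W_def finite_FI_hom)
qed

text \<open>The row vector generates the Specht module under permutations, and f \<otimes> w is the
  image of id \<otimes> w under f. Hypothesis \<open>V\<close> stands in for module axioms on the
  values of V: it gives equality at zero, where both morphisms are scalar multiples with scalar
  0.\<close>

lemma free_hom_eq:
  fixes V :: "('k::field_char_0, 'v) FI_module"
  assumes \<phi>: "\<phi> \<in> carrier (FI_Hom (free_FI_module n (Specht n \<mu>)) V)"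
    and \<psi>: "\<psi> \<in> carrier (FI_Hom (free_FI_module n (Specht n \<mu>)) V)"
    and T: "T \<in> tableaux n \<mu>" and \<mu>: "sorted_wrt (\<ge>) \<mu>"
    and V: "\<And>k v w. v \<in> carrier (obj V k) \<Longrightarrow> w \<in> carrier (obj V k) \<Longrightarrow>
      (0 :: 'k) \<odot>\<^bsub>obj V k\<^esub> v = 0 \<odot>\<^bsub>obj V k\<^esub> w"
    and eq: "\<phi> n (free_unit n (Specht n \<mu>) (row_vector n \<mu> T)) =
      \<psi> n (free_unit n (Specht n \<mu>) (row_vector n \<mu> T))"
  shows "\<phi> = \<psi>"
proof
  fix k
  let ?W = "Specht n \<mu> :: ('k, _) sym_rep" and ?u = "row_vector n \<mu> T :: _ \<Rightarrow> 'k"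
  let ?M = "free_FI_module n ?W"
  have u: "?u \<in> Specht_carrier n \<mu>" using T by (rule row_vector_in_Specht)
  note lin = linear_mapsD[OF FI_HomD(1)[OF \<phi>]] linear_mapsD[OF FI_HomD(1)[OF \<psi>]]
  have unit: "\<phi> n (free_unit n ?W w) = \<psi> n (free_unit n ?W w)" if "w \<in> Specht_carrier n \<mu>" for w
    using that T \<mu>
  proof (induction rule: Specht_cyclic_induct)
    case (act \<sigma>)
    have "free_unit n ?W (act ?W \<sigma> ?u) = arr ?M n n \<sigma> (free_unit n ?W ?u)"
      using arr_free_unit[OF act u] by simp
    then show ?case
      unfolding act_Specht[symmetric]
      using FI_HomD(2)[OF \<phi> act free_unit_closed[OF u]] FI_HomD(2)[OF \<psi> act free_unit_closed[OF u]] eq by simp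
  next
    case (add v w)
    then show ?case
      unfolding add_Specht[symmetric] free_unit_add by (simp add: lin free_unit_closed)
  next
    case (smult c v)
    then show ?case
      unfolding smult_Specht[symmetric] free_unit_smult by (simp add: lin free_unit_closed)
  qed
  have "\<phi> k F = \<psi> k F" if "F \<in> carrier (obj ?M k)" for F
    using that
  proof (induction rule: free_induct)
    case (generator f w)
    then show ?case
      unfolding generator_def
      using FI_HomD(2)[OF \<phi> generator(1) free_unit_closed] FI_HomD(2)[OF \<psi> generator(1) free_unit_closed] unit
      by simp
  next
    case zero
    let ?z = "\<zero>\<^bsub>obj ?M k\<^esub>"
    have "?z = 0 \<odot>\<^bsub>obj ?M k\<^esub> ?z"
      by (simp add: zero_free smult_free Specht_zero_smult cong: restrict_cong)
    moreover have "\<phi> k (0 \<odot>\<^bsub>obj ?M k\<^esub> ?z) = \<psi> k (0 \<odot>\<^bsub>obj ?M k\<^esub> ?z)"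
      by (simp only: lin(3)[OF free_closed(1)] lin(7)[OF free_closed(1)]
          V[OF lin(1)[OF free_closed(1)] lin(5)[OF free_closed(1)]])
    ultimately show ?case by simp
  qed (simp_all add: lin)
  then show "\<phi> k = \<psi> k"
    using lin(4,8) by (intro extensionalityI[of "\<phi> k" "carrier (obj ?M k)"])
qed

section \<open>Padded partitions\<close>

lemma card_diagram: "card (diagram \<nu>) = sum_list \<nu>"
proof -
  have "diagram \<nu> = (SIGMA i:{..<length \<nu>}. {..<\<nu> ! i})"
    by (auto simp: diagram_def)
  then show ?thesis
    by (simp add: sum_list_sum_nth atLeast0LessThan)
qed

lemma sorted_padded:
  assumes "is_partition \<nu>" and "pad_bound \<nu> \<le> n"
  shows "sorted_wrt (\<ge>) (padded \<nu> n)"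
  using assms by (cases \<nu>) (auto simp: is_partition_def padded_def pad_bound_def)

lemma sum_list_le_pad_bound: "sum_list \<nu> \<le> pad_bound \<nu>"
  by (simp add: pad_bound_def)

lemma diagram_padded:
  "diagram (padded \<nu> n) = (\<lambda>j. (0, j)) ` {..<n - sum_list \<nu>} \<union> map_prod Suc id ` diagram \<nu>"
proof (rule Set.set_eqI)
  fix b
  show "b \<in> diagram (padded \<nu> n) \<longleftrightarrow>
      b \<in> (\<lambda>j. (0, j)) ` {..<n - sum_list \<nu>} \<union> map_prod Suc id ` diagram \<nu>"
    by (cases b; cases "fst b") (force simp: diagram_def padded_def)+
qed

definition lower_entries :: "nat list \<Rightarrow> nat \<times> nat \<Rightarrow> nat" where
  "lower_entries \<nu> = (SOME \<beta>. bij_betw \<beta> (diagram \<nu>) {1..sum_list \<nu>})"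

lemma lower_entries: "bij_betw (lower_entries \<nu>) (diagram \<nu>) {1..sum_list \<nu>}"
proof -
  have "\<exists>\<beta>. bij_betw \<beta> (diagram \<nu>) {1..sum_list \<nu>}"
    using finite_same_card_bij[of "diagram \<nu>" "{1..sum_list \<nu>}"] by (simp add: card_diagram)
  then show ?thesis unfolding lower_entries_def by (rule someI_ex)
qed

text \<open>The tabloids of \<open>padded_tableau\<close> for all n at once. That the labelling does
  not depend on n allows the row groups for n and n + 1 to be compared.\<close>

definition row_of :: "nat list \<Rightarrow> nat \<Rightarrow> nat" where
  "row_of \<nu> k = (if k \<le> sum_list \<nu> then Suc (fst (inv_into (diagram \<nu>) (lower_entries \<nu>) k)) else 0)"

text \<open>The entries \<open>1, \<dots>, |\<nu>|\<close> fill the rows below the first one in a way not depending on \<open>n\<close>, the other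
  entries fill the first row.\<close>

definition padded_tableau :: "nat list \<Rightarrow> nat \<Rightarrow> nat \<times> nat \<Rightarrow> nat" where
  "padded_tableau \<nu> n = (\<lambda>(i, j)\<in>diagram (padded \<nu> n).
     case i of 0 \<Rightarrow> Suc (sum_list \<nu> + j) | Suc i' \<Rightarrow> lower_entries \<nu> (i', j))"

lemma padded_tableau:
  assumes n: "sum_list \<nu> \<le> n"
  shows "padded_tableau \<nu> n \<in> tableaux n (padded \<nu> n)"
    and "k \<in> {1..n} \<Longrightarrow> tabloid n (padded \<nu> n) (padded_tableau \<nu> n) k = row_of \<nu> k"
proof -
  let ?m = "sum_list \<nu>"
  define T where "T = (\<lambda>(i, j). case i of 0 \<Rightarrow> Suc (?m + j) | Suc i' \<Rightarrow> lower_entries \<nu> (i', j))"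
  have pt: "padded_tableau \<nu> n = restrict T (diagram (padded \<nu> n))"
    by (simp add: padded_tableau_def T_def)
  have "bij_betw T ((\<lambda>j. (0, j)) ` {..<n - ?m}) {Suc ?m..n}"
    by (rule bij_betw_byWitness[of _ "\<lambda>k. (0, k - Suc ?m)"]) (use n in \<open>auto simp: T_def\<close>)
  moreover have "bij_betw T (map_prod Suc id ` diagram \<nu>) {1..?m}"
  proof -
    have "bij_betw (T \<circ> map_prod Suc id) (diagram \<nu>) {1..?m}"
      using lower_entries[of \<nu>] by (simp add: T_def o_def case_prod_beta map_prod_def cong: bij_betw_cong)
    then show ?thesis
      by (subst bij_betw_comp_iff[of "map_prod Suc id" "diagram \<nu>", OF inj_on_imp_bij_betw])
        (auto simp: inj_on_def)
  qed
  ultimately have "bij_betw T (diagram (padded \<nu> n)) ({Suc ?m..n} \<union> {1..?m})"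
    unfolding diagram_padded by (rule bij_betw_combine) auto
  moreover have "{Suc ?m..n} \<union> {1..?m} = {1..n}" using n by auto
  ultimately have "bij_betw (padded_tableau \<nu> n) (diagram (padded \<nu> n)) {1..n}"
    unfolding pt by (simp only: bij_betw_restrict_eq)
  then show tab: "padded_tableau \<nu> n \<in> tableaux n (padded \<nu> n)"
    by (simp add: tableaux_def pt)
  interpret P: tableau n "padded \<nu> n" "padded_tableau \<nu> n" using tab by (rule tableauI)
  assume "k \<in> {1..n}"
  then obtain b where b: "b \<in> diagram (padded \<nu> n)" "k = padded_tableau \<nu> n b"
    by (rule P.entryE)
  then have k: "k = T b" by (simp add: pt)
  from b(1) have "row_of \<nu> (T b) = fst b"
    unfolding diagram_padded
  proof
    assume "b \<in> map_prod Suc id ` diagram \<nu>"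
    then obtain i j where ij: "(i, j) \<in> diagram \<nu>" "b = (Suc i, j)" by auto
    then have "lower_entries \<nu> (i, j) \<in> {1..?m}"
      using lower_entries[of \<nu>] unfolding bij_betw_def by blast
    then show "row_of \<nu> (T b) = fst b"
      using ij lower_entries[of \<nu>] by (simp add: T_def row_of_def bij_betw_def inv_into_f_f)
  qed (auto simp: T_def row_of_def)
  then show "tabloid n (padded \<nu> n) (padded_tableau \<nu> n) k = row_of \<nu> k"
    using b k by simp
qed

lemma stabilizer_padded_tableau:
  assumes "sum_list \<nu> \<le> n"
  shows "stabilizer n (tabloid n (padded \<nu> n) (padded_tableau \<nu> n)) = stabilizer n (row_of \<nu>)"
proof -
  have "(\<forall>k\<in>{1..n}. tabloid n (padded \<nu> n) (padded_tableau \<nu> n) (\<rho> k) =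
        tabloid n (padded \<nu> n) (padded_tableau \<nu> n) k) \<longleftrightarrow>
      (\<forall>k\<in>{1..n}. row_of \<nu> (\<rho> k) = row_of \<nu> k)" if "\<rho> \<in> FI_hom n n" for \<rho>
    using FI_homD(3)[OF that] by (intro ball_cong refl) (simp add: padded_tableau[OF assms])
  then show ?thesis
    by (auto simp: stabilizer_def)
qed

lemma Fix_le_iff:
  assumes \<sigma>: "\<sigma> \<in> Fix N n" and k: "k \<in> {1..n}"
  shows "\<sigma> k \<le> N \<longleftrightarrow> k \<le> N"
proof
  assume *: "\<sigma> k \<le> N"
  have "\<sigma> k \<in> {1..n}" using FI_homD(3)[OF Fix_FI_hom[OF \<sigma>] k] .
  then have "\<sigma> (\<sigma> k) = \<sigma> k" using \<sigma> * by (simp add: Fix_def)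
  then have "\<sigma> k = k"
    using inj_onD[OF FI_homD(1)[OF Fix_FI_hom[OF \<sigma>]]] \<open>\<sigma> k \<in> {1..n}\<close> k by blast
  then show "k \<le> N" using * by simp
next
  assume "k \<le> N"
  then show "\<sigma> k \<le> N" using \<sigma> k by (simp add: Fix_def)
qed

text \<open>All entries beyond the size of \<nu> lie in the first row.\<close>

lemma Fix_subset_stabilizer: "Fix (sum_list \<nu>) n \<subseteq> stabilizer n (row_of \<nu>)"
proof
  fix \<sigma> assume \<sigma>: "\<sigma> \<in> Fix (sum_list \<nu>) n"
  have "row_of \<nu> (\<sigma> k) = row_of \<nu> k" if k: "k \<in> {1..n}" for k
  proof (cases "k \<le> sum_list \<nu>")
    case True
    then show ?thesis using \<sigma> k by (simp add: Fix_def)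
  next
    case False
    then show ?thesis using Fix_le_iff[OF \<sigma> k] by (simp add: row_of_def)
  qed
  then show "\<sigma> \<in> stabilizer n (row_of \<nu>)"
    using \<sigma> by (simp add: stabilizer_def Fix_def)
qed

definition row_inv :: "nat list \<Rightarrow> nat \<Rightarrow> (nat \<Rightarrow> nat) \<Rightarrow> 'k::field" where
  "row_inv \<nu> n = row_vector n (padded \<nu> n) (padded_tableau \<nu> n)"

lemma row_inv_closed: "sum_list \<nu> \<le> n \<Longrightarrow> row_inv \<nu> n \<in> Specht_carrier n (padded \<nu> n)"
  unfolding row_inv_def by (intro row_vector_in_Specht padded_tableau)

lemma act_row_inv:
  "sum_list \<nu> \<le> n \<Longrightarrow> \<rho> \<in> stabilizer n (row_of \<nu>) \<Longrightarrow> act (Sp \<nu> n) \<rho> (row_inv \<nu> n) = row_inv \<nu> n"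
  unfolding row_inv_def act_Specht
  by (rule row_vector_invariant) (simp add: stabilizer_padded_tableau)

section \<open>The transition maps of the system\<close>

text \<open>The image of \<open>row_inv\<close> in the free module on \<open>Sp \<nu> n\<close> is invariant under the row group, hence determined
  by its value at the inclusion of \<open>[n]\<close> into \<open>[n + 1]\<close>: at the injections that miss an entry of a lower row
  it is fixed by the permutations of \<open>n + 1 - |\<nu>|\<close> points, hence 0.\<close>

lemma transition_formula:
  fixes \<iota> :: "nat \<Rightarrow> 'k::field_char_0 free_Specht_elem \<Rightarrow> 'k free_Specht_elem"
  assumes \<nu>: "is_partition \<nu>" and n: "pad_bound \<nu> \<le> n"
    and \<iota>: "\<iota> \<in> carrier (FI_Hom (M_Sp \<nu> (Suc n)) (M_Sp \<nu> n))"
    and \<iota>0: "\<iota> \<noteq> \<zero>\<^bsub>FI_Hom (M_Sp \<nu> (Suc n)) (M_Sp \<nu> n :: ('k, 'k free_Specht_elem) FI_module)\<^esub>"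
  obtains c where "c \<noteq> 0" and
    "\<iota> (Suc n) (free_unit (Suc n) (Sp \<nu> (Suc n)) (row_inv \<nu> (Suc n))) =
      free_sum n (padded \<nu> n) (Suc n) (\<lambda>_. c)
        (\<lambda>\<rho>. generator n (padded \<nu> n) (Suc n) (compose {1..n} \<rho> (inc n)) (row_inv \<nu> n)) (Fix (sum_list \<nu>) (Suc n))"
proof -
  let ?m = "sum_list \<nu>" and ?N = "Suc n" and ?\<mu> = "padded \<nu> n"
  let ?W = "Sp \<nu> n :: ('k, _) sym_rep" and ?W' = "Sp \<nu> (Suc n) :: ('k, _) sym_rep"
  let ?u = "row_inv \<nu> n :: _ \<Rightarrow> 'k" and ?u' = "row_inv \<nu> (Suc n) :: _ \<Rightarrow> 'k"
  let ?R = "stabilizer n (row_of \<nu>)" and ?R' = "stabilizer ?N (row_of \<nu>)"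
  have m: "?m \<le> n" using n sum_list_le_pad_bound le_trans by blast
  note sorted = sorted_padded[OF \<nu> n] and T = padded_tableau(1)[OF m]
  have u: "?u \<in> Specht_carrier n ?\<mu>" using m by (rule row_inv_closed)
  have u': "?u' \<in> Specht_carrier ?N (padded \<nu> ?N)" using m by (intro row_inv_closed) simp
  define F where "F = \<iota> ?N (free_unit ?N ?W' ?u')"
  have F: "F \<in> carrier (obj (M_Sp \<nu> n) ?N)"
    unfolding F_def using linear_mapsD(1)[OF FI_HomD(1)[OF \<iota>] free_unit_closed[OF u']] .
  note F' = carrier_freeD[OF F]
  have inc: "inc n \<in> FI_hom n ?N" by (rule inc_FI_hom) simp
  \<comment> \<open>The row group fixes \<open>row_inv\<close>, hence it fixes F; in terms of
    functions on injections, fixing F is invariance under left translation.\<close>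
  have F_left: "F (compose {1..n} \<rho> h) = F h" if \<rho>: "\<rho> \<in> ?R'" and h: "h \<in> FI_hom n ?N" for \<rho> h
  proof -
    note \<rho>' = stabilizer_FI_hom[OF \<rho>]
    have "arr (M_Sp \<nu> n) ?N ?N \<rho> F = \<iota> ?N (arr (M_Sp \<nu> ?N) ?N ?N \<rho> (free_unit ?N ?W' ?u'))"
      unfolding F_def using FI_HomD(2)[OF \<iota> \<rho>' free_unit_closed[OF u']] by simp
    also have "arr (M_Sp \<nu> ?N) ?N ?N \<rho> (free_unit ?N ?W' ?u') = free_unit ?N ?W' ?u'"
    proof -
      have "act ?W' \<rho> ?u' = ?u'" using m \<rho> by (intro act_row_inv) simp_all
      then show ?thesis using arr_free_unit[OF \<rho>' u'] by simp
    qed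
    finally have "arr (M_Sp \<nu> n) ?N ?N \<rho> F = F" by (simp only: F_def)
    then show ?thesis
      using arr_free_compose[OF \<rho>' h, of ?W F] by simp
  qed
  have F_low: "F h = \<zero>\<^bsub>space ?W\<^esub>"
    if h: "h \<in> FI_hom n ?N" and j: "j \<in> {1..?N}" "j \<notin> h ` {1..n}" "j \<le> ?m" for h j
  proof -
    \<comment> \<open>Since h misses some j \<le> m, it takes all values m + 1, ..., n + 1. So A has
      n + 1 - m elements, one more than the first row of \<open>padded \<nu> n\<close>.\<close>
    define A where "A = {k \<in> {1..n}. ?m < h k}"
    have "h ` {1..n} = {1..?N} - {j}"
    proof (rule card_subset_eq)
      show "h ` {1..n} \<subseteq> {1..?N} - {j}" using FI_homD(3)[OF h] j(2) by blast
      show "card (h ` {1..n}) = card ({1..?N} - {j})"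
        using j(1) card_image[OF FI_homD(1)[OF h]] by simp
    qed simp
    moreover have "h ` A = h ` {1..n} \<inter> {?m<..}" by (auto simp: A_def)
    ultimately have "h ` A = {?m<..?N}" using j(3) by auto
    then have "card A = ?N - ?m"
    proof -
      have "A \<subseteq> {1..n}" by (auto simp: A_def)
      then show ?thesis
        using card_image[OF inj_on_subset[OF FI_homD(1)[OF h], of A]] \<open>h ` A = {?m<..?N}\<close> by simp
    qed
    then have "card A > ?\<mu> ! 0" using m by (simp add: padded_def)
    \<comment> \<open>A permutation supported on A changes h only where its values lie beyond m.
      Right translation of h by it equals left translation by some \<rho> in \<open>Fix\<close>,
      under which F is invariant.\<close>
    moreover have "Specht_act n ?\<mu> \<sigma> (F h) = F h"
      if \<sigma>: "\<sigma> \<in> FI_hom n n" and outside: "\<forall>k\<in>{1..n} - A. \<sigma> k = k" for \<sigma>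
    proof -
      have "h i = compose {1..n} h \<sigma> i" if i: "i \<in> {1..n}" "h i \<le> ?m \<or> compose {1..n} h \<sigma> i \<le> ?m" for i
      proof -
        have \<sigma>i: "\<sigma> i \<in> {1..n}" using FI_homD(3)[OF \<sigma> i(1)] .
        have "\<sigma> i = i"
        proof (cases "h i \<le> ?m")
          case True
          then show ?thesis using outside i(1) by (auto simp: A_def)
        next
          case False
          then have "\<sigma> i \<notin> A" using i by (auto simp: A_def compose_eq)
          then have "\<sigma> (\<sigma> i) = \<sigma> i" using outside \<sigma>i by blast
          then show ?thesis using inj_onD[OF FI_homD(1)[OF \<sigma>]] \<sigma>i i(1) by blast
        qed
        then show ?thesis using i(1) by (simp add: compose_eq)
      qed
      then obtain \<rho> where \<rho>: "\<rho> \<in> Fix ?m ?N" "compose {1..n} \<rho> h = compose {1..n} h \<sigma>"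
        using Fix_transitive[OF h compose_FI_hom[OF \<sigma> h], of ?m] by metis
      then have "F (compose {1..n} h \<sigma>) = F h"
        using F_left[OF _ h, of \<rho>] Fix_subset_stabilizer by auto
      then show ?thesis
        using F'(3)[OF h \<sigma>] by (simp add: act_Specht)
    qed
    ultimately show ?thesis
      unfolding zero_Specht using F'(2)[OF h] sorted
      by (intro Specht_large_invariant[of "F h" n ?\<mu> A]) (auto simp: padded_def A_def)
  qed
  have "Specht_act n ?\<mu> \<sigma> (F (inc n)) = F (inc n)" if \<sigma>: "\<sigma> \<in> ?R" for \<sigma>
  proof -
    note \<sigma>' = stabilizer_FI_hom[OF \<sigma>]
    \<comment> \<open>Extended by the fixed point n + 1, the row permutation \<sigma> commutes with
      the inclusion, and n + 1 lies in the first row.\<close>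
    define \<rho> where "\<rho> = (\<lambda>k\<in>{1..?N}. if k \<in> {1..n} then \<sigma> k else k)"
    have N: "{1..?N} = {1..n} \<union> {?N}" by auto
    have "bij_betw (\<lambda>k. if k \<in> {1..n} then \<sigma> k else k) ({1..n} \<union> {?N}) ({1..n} \<union> {?N})"
      by (rule bij_betw_disjoint_Un[OF FI_hom_bij_betw[OF \<sigma>']]) (auto simp: bij_betw_def)
    then have "bij_betw \<rho> {1..?N} {1..?N}"
      unfolding \<rho>_def N by (simp only: bij_betw_restrict_eq)
    then have \<rho>': "\<rho> \<in> FI_hom ?N ?N" by (rule FI_hom_selfI) (simp add: \<rho>_def)
    have "\<rho> \<in> ?R'"
      using \<sigma> \<rho>' by (auto simp: stabilizer_def \<rho>_def)
    moreover have "compose {1..n} \<rho> (inc n) = compose {1..n} (inc n) \<sigma>"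
      using FI_homD(3)[OF \<sigma>'] by (intro extensionalityI[of _ "{1..n}"]) (auto simp: compose_eq \<rho>_def)
    ultimately have "F (compose {1..n} (inc n) \<sigma>) = F (inc n)"
      using F_left[OF _ inc, of \<rho>] by simp
    then show ?thesis
      using F'(3)[OF inc \<sigma>'] by (simp add: act_Specht)
  qed
  then obtain c0 where c0: "F (inc n) = c0 \<odot>\<^bsub>space ?W\<^esub> ?u"
    using Specht_row_invariant[OF F'(2)[OF inc] T sorted] unfolding smult_Specht row_inv_def
    by (metis stabilizer_padded_tableau[OF m])
  let ?G = "\<lambda>\<rho>. generator n ?\<mu> ?N (compose {1..n} \<rho> (inc n)) ?u"
  \<comment> \<open>The tensor indexed by \<rho> is supported on the right translates of \<rho>
    composed with the inclusion; \<open>hits h\<close> collects the \<rho> whose support contains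
    h.\<close>
  define hits where "hits h = {\<rho> \<in> Fix ?m ?N. h \<in> compose {1..n} (compose {1..n} \<rho> (inc n)) ` FI_hom n n}" for h
  have fin: "finite (Fix ?m ?N)" by (rule finite_subset[OF _ finite_FI_hom]) (auto dest: Fix_FI_hom)
  have \<rho>inc: "compose {1..n} \<rho> (inc n) \<in> FI_hom n ?N" if "\<rho> \<in> Fix ?m ?N" for \<rho>
    using compose_FI_hom[OF inc Fix_FI_hom[OF that]] .
  have G_out: "?G \<rho> h = \<zero>\<^bsub>space ?W\<^esub>" if "\<rho> \<in> Fix ?m ?N" "\<rho> \<notin> hits h" "h \<in> FI_hom n ?N" for \<rho> h
    using that by (intro generator_outside) (auto simp: hits_def)
  have hits_low: "hits h = {}" if h: "h \<in> FI_hom n ?N" and j: "j \<in> {1..?N}" "j \<notin> h ` {1..n}" "j \<le> ?m" for h j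
  proof (rule ccontr)
    assume "hits h \<noteq> {}"
    then obtain \<rho> \<sigma> where \<rho>: "\<rho> \<in> Fix ?m ?N" and \<sigma>: "\<sigma> \<in> FI_hom n n"
      and h': "h = compose {1..n} (compose {1..n} \<rho> (inc n)) \<sigma>" by (auto simp: hits_def)
    have jn: "j \<in> {1..n}" using j m by simp
    have "h (sym_inv n \<sigma> j) = \<rho> j"
      using jn \<sigma> FI_homD(3)[OF sym_inv_FI_hom[OF \<sigma>] jn] by (simp add: h' compose_eq)
    also have "\<rho> j = j" using \<rho> j by (simp add: Fix_def)
    finally show False
      using j(2) FI_homD(3)[OF sym_inv_FI_hom[OF \<sigma>] jn] by (metis imageI)
  qed
  define d where "d = card (hits (inc n))"
  have "inc ?N \<in> hits (inc n)"
    unfolding hits_def using inc_Fix inc_FI_hom[of n n]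
    by (auto intro!: image_eqI[of _ _ "inc n"] simp: compose_def)
  then have d: "d > 0" using fin by (auto simp: d_def card_gt_0_iff hits_def)
  \<comment> \<open>On the supported injections, F and every tensor that hits h take proportional
    values, and the number d of tensors hitting h does not depend on h. These two facts make F a
    multiple of the whole sum.\<close>
  have high: "F h = c0 \<odot>\<^bsub>space ?W\<^esub> act ?W (sym_inv n \<sigma>0) ?u \<and> card (hits h) = d \<and>
      (\<forall>\<rho>\<in>hits h. ?G \<rho> h = act ?W (sym_inv n \<sigma>0) ?u)"
    if \<rho>0: "\<rho>0 \<in> Fix ?m ?N" and \<sigma>0: "\<sigma>0 \<in> FI_hom n n"
      and h: "h = compose {1..n} (compose {1..n} \<rho>0 (inc n)) \<sigma>0" for h \<rho>0 \<sigma>0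
  proof (intro conjI ballI)
    note \<rho>0' = Fix_FI_hom[OF \<rho>0] and \<sigma>0i = sym_inv_FI_hom[OF \<sigma>0]
    have "act ?W \<sigma>0 (F h) = F (compose {1..n} \<rho>0 (inc n))"
      using F'(3)[OF \<rho>inc[OF \<rho>0] \<sigma>0] by (simp add: h)
    also have "\<dots> = c0 \<odot>\<^bsub>space ?W\<^esub> ?u"
      using F_left[OF _ inc, of \<rho>0] Fix_subset_stabilizer \<rho>0 c0 by auto
    finally have "act ?W (sym_inv n \<sigma>0) (act ?W \<sigma>0 (F h)) = c0 \<odot>\<^bsub>space ?W\<^esub> act ?W (sym_inv n \<sigma>0) ?u"
      using \<sigma>0i by (simp add: act_Specht_smult)
    moreover have "F h \<in> Specht_carrier n ?\<mu>"
      unfolding h using F'(2) compose_FI_hom[OF \<sigma>0 \<rho>inc[OF \<rho>0]] by blast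
    ultimately show "F h = c0 \<odot>\<^bsub>space ?W\<^esub> act ?W (sym_inv n \<sigma>0) ?u"
      using \<sigma>0 \<sigma>0i by (simp add: act_Specht_compose compose_sym_inv act_Specht_inc)
    have hits_iff: "\<rho> \<in> hits (inc n) \<Longrightarrow> compose {1..?N} \<rho>0 \<rho> \<in> hits h"
      "\<rho> \<in> hits h \<Longrightarrow> compose {1..?N} (sym_inv ?N \<rho>0) \<rho> \<in> hits (inc n)" for \<rho>
    proof -
      assume "\<rho> \<in> hits (inc n)"
      then obtain \<sigma> where \<rho>: "\<rho> \<in> Fix ?m ?N" and \<sigma>: "\<sigma> \<in> FI_hom n n"
        and i: "inc n = compose {1..n} (compose {1..n} \<rho> (inc n)) \<sigma>" by (auto simp: hits_def)
      have "h = compose {1..n} (compose {1..n} (compose {1..?N} \<rho>0 \<rho>) (inc n)) (compose {1..n} \<sigma> \<sigma>0)"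
        unfolding h by (subst i)
          (simp only: compose_compose_FI[OF inc] compose_compose_FI[OF \<sigma>] compose_compose_FI[OF \<sigma>0]
            compose_compose_FI[OF compose_FI_hom[OF \<sigma>0 \<sigma>]])
      then show "compose {1..?N} \<rho>0 \<rho> \<in> hits h"
        using compose_Fix[OF \<rho>0 \<rho>] compose_FI_hom[OF \<sigma>0 \<sigma>] unfolding hits_def by blast
    next
      assume "\<rho> \<in> hits h"
      then obtain \<sigma> where \<rho>: "\<rho> \<in> Fix ?m ?N" and \<sigma>: "\<sigma> \<in> FI_hom n n"
        and i: "h = compose {1..n} (compose {1..n} \<rho> (inc n)) \<sigma>" by (auto simp: hits_def)
      let ?\<tau> = "compose {1..n} \<sigma> (sym_inv n \<sigma>0)"
      have \<tau>: "?\<tau> \<in> FI_hom n n" using \<sigma>0i \<sigma> by (rule compose_FI_hom)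
      have "compose {1..n} (compose {1..n} (compose {1..?N} (sym_inv ?N \<rho>0) \<rho>) (inc n)) ?\<tau> =
          compose {1..n} (sym_inv ?N \<rho>0) (compose {1..n} h (sym_inv n \<sigma>0))"
        unfolding i by (simp only: compose_compose_FI[OF inc] compose_compose_FI[OF \<tau>] compose_compose_FI[OF \<sigma>0i])
      also have "\<dots> = compose {1..n} (sym_inv ?N \<rho>0) (compose {1..n} \<rho>0 (inc n))"
        unfolding h by (simp only: compose_compose_FI[OF \<sigma>0i] compose_sym_inv[OF \<sigma>0]
            compose_inc_right[OF FI_homD(2)[OF \<rho>inc[OF \<rho>0]]])
      also have "\<dots> = inc n"
        by (simp only: compose_compose_FI[OF inc, symmetric] compose_sym_inv[OF \<rho>0'] compose_inc_left[OF inc order_refl])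
      finally have "inc n \<in> compose {1..n} (compose {1..n} (compose {1..?N} (sym_inv ?N \<rho>0) \<rho>) (inc n)) ` FI_hom n n"
        using \<tau> by (metis imageI)
      then show "compose {1..?N} (sym_inv ?N \<rho>0) \<rho> \<in> hits (inc n)"
        using compose_Fix[OF sym_inv_Fix[OF \<rho>0] \<rho>] unfolding hits_def by blast
    qed
    have hits_FI: "\<rho> \<in> FI_hom ?N ?N" if "\<rho> \<in> hits g" for \<rho> g
      using that Fix_FI_hom by (auto simp: hits_def)
    have canc: "compose {1..?N} (sym_inv ?N \<rho>0) (compose {1..?N} \<rho>0 \<rho>) = \<rho>"
      "compose {1..?N} \<rho>0 (compose {1..?N} (sym_inv ?N \<rho>0) \<rho>) = \<rho>" if "\<rho> \<in> FI_hom ?N ?N" for \<rho>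
      by (simp_all only: compose_compose_FI[OF that, symmetric] compose_sym_inv[OF \<rho>0']
          compose_inc_left[OF that order_refl])
    have "bij_betw (compose {1..?N} \<rho>0) (hits (inc n)) (hits h)"
    proof (rule bij_betw_byWitness[of _ "compose {1..?N} (sym_inv ?N \<rho>0)"])
      show "\<forall>\<rho>\<in>hits (inc n). compose {1..?N} (sym_inv ?N \<rho>0) (compose {1..?N} \<rho>0 \<rho>) = \<rho>"
        "\<forall>\<rho>\<in>hits h. compose {1..?N} \<rho>0 (compose {1..?N} (sym_inv ?N \<rho>0) \<rho>) = \<rho>"
        using canc hits_FI by blast+
    qed (use hits_iff in auto)
    then show "card (hits h) = d" unfolding d_def by (rule bij_betw_same_card[symmetric])
    fix \<rho> assume "\<rho> \<in> hits h"
    then obtain \<sigma> where \<rho>: "\<rho> \<in> Fix ?m ?N" and \<sigma>: "\<sigma> \<in> FI_hom n n"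
      and i: "h = compose {1..n} (compose {1..n} \<rho> (inc n)) \<sigma>" by (auto simp: hits_def)
    note \<sigma>i = sym_inv_FI_hom[OF \<sigma>]
    \<comment> \<open>Two presentations of h differ by \<tau>, which fixes 1, ..., m because both
      \<rho> and \<rho>0 do. Hence \<tau> fixes \<open>row_inv\<close>, and the value at h is the
      same for both.\<close>
    let ?\<tau> = "compose {1..n} \<sigma>0 (sym_inv n \<sigma>)"
    have \<tau>: "?\<tau> \<in> FI_hom n n" using \<sigma>i \<sigma>0 by (rule compose_FI_hom)
    have "?\<tau> k = k" if k: "k \<in> {1..n}" "k \<le> ?m" for k
    proof -
      let ?l = "sym_inv n \<sigma> k"
      have l: "?l \<in> {1..n}" using FI_homD(3)[OF \<sigma>i k(1)] .
      have \<sigma>0l: "\<sigma>0 ?l \<in> {1..n}" using FI_homD(3)[OF \<sigma>0 l] .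
      have "\<rho>0 (\<sigma>0 ?l) = h ?l" using l \<sigma>0l by (simp add: h compose_eq)
      also have "h ?l = \<rho> k" using l k \<sigma> by (simp add: i compose_eq)
      also have "\<rho> k = k" using \<rho> k by (simp add: Fix_def)
      also have "k = \<rho>0 k" using \<rho>0 k by (simp add: Fix_def)
      finally have "\<sigma>0 ?l = k"
        using inj_onD[OF FI_homD(1)[OF \<rho>0'], of "\<sigma>0 ?l" k] \<sigma>0l k by simp
      then show ?thesis using k by (simp add: compose_eq)
    qed
    then have "?\<tau> \<in> Fix ?m n" using \<tau> by (simp add: Fix_def)
    then have act_\<tau>: "act ?W ?\<tau> ?u = ?u" using act_row_inv[OF m] Fix_subset_stabilizer by blast
    have "?G \<rho> h = act ?W (sym_inv n \<sigma>) ?u"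
      unfolding i using \<rho>inc[OF \<rho>] \<sigma> by (rule generator_compose)
    also have "sym_inv n \<sigma> = compose {1..n} (sym_inv n \<sigma>0) ?\<tau>"
      by (simp only: compose_compose_FI[OF \<sigma>i, symmetric] compose_sym_inv[OF \<sigma>0] compose_inc_left[OF \<sigma>i order_refl])
    also have "act ?W \<dots> ?u = act ?W (sym_inv n \<sigma>0) ?u"
      using act_Specht_compose[OF \<sigma>0i \<tau>, of ?\<mu> ?u] act_\<tau> by simp
    finally show "?G \<rho> h = act ?W (sym_inv n \<sigma>0) ?u" .
  qed
  have high_form: "\<exists>\<rho>0\<in>Fix ?m ?N. \<exists>\<sigma>0\<in>FI_hom n n. h = compose {1..n} (compose {1..n} \<rho>0 (inc n)) \<sigma>0"
    if h: "h \<in> FI_hom n ?N" and j: "j \<in> {1..?N}" "j \<notin> h ` {1..n}" "?m < j" for h j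
  proof -
    \<comment> \<open>Exchanging the missed value j with n + 1 moves the image of h into [n]; the
      exchange lies in \<open>Fix\<close> since j > m.\<close>
    define \<rho>0 where "\<rho>0 = tswap ?N j ?N"
    have \<rho>0_eq: "\<rho>0 k = (if k = j then ?N else if k = ?N then j else k)" if "k \<in> {1..?N}" for k
      using that by (auto simp: \<rho>0_def tswap_def Transposition.transpose_def)
    have "\<rho>0 \<in> FI_hom ?N ?N"
      unfolding \<rho>0_def using j by (intro stabilizer_FI_hom[OF tswap_stabilizer[where lab = "\<lambda>_. ()"]]) auto
    then have \<rho>0: "\<rho>0 \<in> Fix ?m ?N" using \<rho>0_eq j m by (auto simp: Fix_def)
    let ?\<sigma> = "compose {1..n} \<rho>0 h"
    have \<sigma>': "?\<sigma> \<in> FI_hom n ?N" using h Fix_FI_hom[OF \<rho>0] by (rule compose_FI_hom)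
    have "?\<sigma> k \<in> {1..n}" if k: "k \<in> {1..n}" for k
    proof -
      have hk: "h k \<in> {1..?N}" "h k \<noteq> j" using FI_homD(3)[OF h k] j k by auto
      show ?thesis using k hk j \<rho>0_eq[OF hk(1)] by (auto simp: compose_eq)
    qed
    then have \<sigma>: "?\<sigma> \<in> FI_hom n n"
      using FI_homD(1,2)[OF \<sigma>'] by (auto simp: FI_hom_def PiE_iff)
    have "h = compose {1..n} (compose {1..n} \<rho>0 (inc n)) ?\<sigma>"
    proof (rule extensionalityI[OF FI_homD(2)[OF h]])
      fix k assume k: "k \<in> {1..n}"
      have hk: "h k \<in> {1..?N}" "h k \<noteq> j" using FI_homD(3)[OF h k] j k by auto
      then show "h k = compose {1..n} (compose {1..n} \<rho>0 (inc n)) ?\<sigma> k"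
        using k j FI_homD(3)[OF \<sigma> k] \<rho>0_eq by (auto simp: compose_eq split: if_splits)
    qed simp
    then show ?thesis using \<rho>0 \<sigma> by blast
  qed
  have missing: "\<exists>j\<in>{1..?N}. j \<notin> h ` {1..n}" if "h \<in> FI_hom n ?N" for h
  proof -
    have "card (h ` {1..n}) < card {1..?N}" using card_image[OF FI_homD(1)[OF that]] by simp
    then show ?thesis by (metis card_mono finite_imageI finite_atLeastAtMost leD subsetI)
  qed
  \<comment> \<open>The factor 1/d corrects for the d equal terms that the sum over
    \<open>Fix\<close> produces at each h in its support.\<close>
  have F_eq: "F = free_sum n ?\<mu> ?N (\<lambda>_. c0 / of_nat d) ?G (Fix ?m ?N)"
  proof (rule free_eqI[OF F'(1)])
    show "free_sum n ?\<mu> ?N (\<lambda>_. c0 / of_nat d) ?G (Fix ?m ?N) \<in> extensional (FI_hom n ?N)"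
      by (simp add: free_sum_def)
    fix h assume h: "h \<in> FI_hom n ?N"
    have split: "(\<Sum>\<rho>\<in>Fix ?m ?N. c * ?G \<rho> h t) = c * (\<Sum>\<rho>\<in>hits h. ?G \<rho> h t)"
      if "t \<in> tabloids n ?\<mu>" for t c
      unfolding sum_distrib_left by (rule sum.mono_neutral_right[OF fin]) (use G_out[OF _ _ h] that in \<open>auto simp: hits_def zero_Specht\<close>)
    have F_ext: "F h \<in> extensional (tabloids n ?\<mu>)" using F'(2)[OF h] by (rule Specht_extensional)
    have "F h t = (\<Sum>\<rho>\<in>Fix ?m ?N. c0 / of_nat d * ?G \<rho> h t)" if t: "t \<in> tabloids n ?\<mu>" for t
    proof -
      obtain j where j: "j \<in> {1..?N}" "j \<notin> h ` {1..n}" using missing[OF h] by blast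
      show ?thesis
      proof (cases "j \<le> ?m")
        case True
        then show ?thesis
          using F_low[OF h j] hits_low[OF h j] t by (simp only: split[OF t]) (simp add: zero_Specht)
      next
        case False
        then obtain \<rho>0 \<sigma>0 where "\<rho>0 \<in> Fix ?m ?N" "\<sigma>0 \<in> FI_hom n n"
          "h = compose {1..n} (compose {1..n} \<rho>0 (inc n)) \<sigma>0" using high_form[OF h j] by auto
        from high[OF this] show ?thesis
          using d t by (simp only: split[OF t]) (simp add: smult_Specht)
      qed
    qed
    then show "F h = free_sum n ?\<mu> ?N (\<lambda>_. c0 / of_nat d) ?G (Fix ?m ?N) h"
      using h by (intro extensionalityI[OF F_ext]) (simp_all add: free_sum_def)
  qed
  \<comment> \<open>If c0 were 0, then \<iota> would agree with the zero morphism on the generator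
    and so be zero by \<open>free_hom_eq\<close>.\<close>
  have "c0 \<noteq> 0"
  proof
    assume "c0 = 0"
    let ?M = "M_Sp \<nu> (Suc n) :: ('k, 'k free_Specht_elem) FI_module"
    let ?M' = "M_Sp \<nu> n :: ('k, 'k free_Specht_elem) FI_module"
    let ?z = "\<lambda>k. \<lambda>v\<in>carrier (obj ?M k). \<zero>\<^bsub>obj ?M' k\<^esub>"
    have F0: "F = \<zero>\<^bsub>obj ?M' ?N\<^esub>"
      unfolding F_eq using \<open>c0 = 0\<close> by (simp add: free_sum_def zero_free zero_Specht cong: restrict_cong)
    have "?z \<in> carrier (FI_Hom ?M ?M')"
    proof -
      have "\<zero>\<^bsub>space ?W\<^esub> \<oplus>\<^bsub>space ?W\<^esub> \<zero>\<^bsub>space ?W\<^esub> = \<zero>\<^bsub>space ?W\<^esub>"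
        "c \<odot>\<^bsub>space ?W\<^esub> \<zero>\<^bsub>space ?W\<^esub> = \<zero>\<^bsub>space ?W\<^esub>" for c
        by (auto simp: add_Specht smult_Specht zero_Specht fun_eq_iff)
      then have "?z k \<in> linear_maps (obj ?M k) (obj ?M' k)" for k
        unfolding linear_maps_def LinearCombinations.module_hom_def
        using free_closed[where 'k = 'k and n = "Suc n" and \<mu> = "padded \<nu> (Suc n)" and k = k]
          free_closed(1)[where 'k = 'k and n = n and \<mu> = ?\<mu> and k = k]
        by (auto simp: zero_free add_free smult_free cong: restrict_cong)
      moreover have "?z l (arr ?M k l f v) = arr ?M' k l f (?z k v)"
        if "f \<in> FI_hom k l" "v \<in> carrier (obj ?M k)" for k l f v
      proof -
        have "inv_into (FI_hom n k) (compose {1..n} f) h \<in> FI_hom n k"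
          if "h \<in> compose {1..n} f ` FI_hom n k" for h
          using that by (rule inv_into_into)
        then have "arr ?M' k l f \<zero>\<^bsub>obj ?M' k\<^esub> = \<zero>\<^bsub>obj ?M' l\<^esub>"
          by (auto simp: arr_free zero_free intro!: restrict_ext)
        then show ?thesis using arr_free_closed[OF that] that by simp
      qed
      ultimately show ?thesis by (simp add: FI_Hom_def)
    qed
    moreover have "?z ?N (free_unit ?N ?W' ?u') = F"
      using free_unit_closed[OF u'] F0 by simp
    ultimately have "\<iota> = ?z"
      using \<iota> padded_tableau(1)[of \<nu> ?N] m sorted_padded[OF \<nu>, of ?N] n
      by (intro free_hom_eq[of \<iota> ?N "padded \<nu> ?N" ?M' ?z "padded_tableau \<nu> ?N"])
        (auto simp: F_def row_inv_def smult_free Specht_zero_smult)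
    then show False using \<iota>0 by (simp add: FI_Hom_def)
  qed
  then show thesis
    using F_eq d by (intro that[of "c0 / of_nat d"]) (auto simp: F_def)
qed

section \<open>Counting related elements\<close>

lemma FI_relationD:
  assumes "FI_relation X Y R"
  shows "(x, y) \<in> R n \<Longrightarrow> x \<in> elems X n" and "(x, y) \<in> R n \<Longrightarrow> y \<in> elems Y n"
    and "f \<in> FI_hom m n \<Longrightarrow> (x, y) \<in> R m \<Longrightarrow> (push X m n f x, push Y m n f y) \<in> R n"
proof -
  have R: "R n \<subseteq> elems X n \<times> elems Y n"
    "f \<in> FI_hom m n \<Longrightarrow> u \<in> R m \<Longrightarrow> map_prod (push X m n f) (push Y m n f) u \<in> R n" for m n f u
    using assms by (auto simp: FI_relation_def FI_subset_def FI_prod_def)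
  show "(x, y) \<in> R n \<Longrightarrow> x \<in> elems X n" "(x, y) \<in> R n \<Longrightarrow> y \<in> elems Y n"
    using R(1) by auto
  show "f \<in> FI_hom m n \<Longrightarrow> (x, y) \<in> R m \<Longrightarrow> (push X m n f x, push Y m n f y) \<in> R n"
    using R(2)[of f m n "(x, y)"] by simp
qed

lemma compose_fixing_inc:
  assumes "f \<in> FI_hom n p" and "N \<le> n" and "\<forall>k\<in>{1..N}. f k = k"
  shows "compose {1..N} f (inc N) = inc N"
  using assms by (auto simp: compose_def)

text \<open>An injection that fixes 1, ..., N takes the image of x to the image of x, and because m
  \<le> N it takes the orbit of y into the orbit of y. The related elements of this orbit therefore
  form a relative subset at level N, although the orbit is taken for \<open>Fix m n\<close>.\<close>

lemma quasi_polynomial_relation_count: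
  assumes X: "FI_set X" and Y: "FI_set Y" "finitely_generated Y" and R: "FI_relation X Y R"
    and m: "m \<le> N" and x: "x \<in> elems X N" and y: "y \<in> elems Y N"
  shows "quasi_polynomial (\<lambda>n. card {z \<in> orb Y m n (up Y N n y). (up X N n x, z) \<in> R n})"
proof -
  interpret X: FI_set X by (rule X)
  interpret Y: FI_set Y by (rule Y)
  let ?D = "\<lambda>n. {z \<in> orb Y m n (up Y N n y). (up X N n x, z) \<in> R n}"
  show ?thesis
  proof (rule Y.quasi_polynomial_relative_subset[OF Y(2), of N])
    show "relative_subset Y N ?D"
      unfolding relative_subset_def
    proof (intro conjI allI impI ballI)
      fix n assume "N \<le> n"
      then show "?D n \<subseteq> elems Y n"
        using Y.orb_closed Y.up_closed y by blast
    next
      fix n p f z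
      assume n: "N \<le> n" "n \<le> p" and f: "f \<in> FI_hom n p" and z: "z \<in> ?D n"
        and fN: "\<forall>k\<in>{1..N}. f k = k"
      obtain \<sigma> where \<sigma>: "\<sigma> \<in> Fix m n" and z': "z = push Y n n \<sigma> (up Y N n y)"
        using z by (auto simp: orb_def)
      note inc = inc_FI_hom[OF n(1)] and \<sigma>' = Fix_FI_hom[OF \<sigma>]
      note \<sigma>inc = compose_FI_hom[OF inc \<sigma>']
      have push: "push Y n p f z = push Y N p (compose {1..N} f (compose {1..N} \<sigma> (inc N))) y"
        by (simp add: z' Y.push_compose[OF \<sigma>inc f y] Y.push_compose[OF inc \<sigma>' y])
      have "push Y n p f z \<in> orb Y m p (up Y N p y)"
        unfolding push
      proof (rule Y.push_in_orb[OF inc_FI_hom compose_FI_hom[OF \<sigma>inc f] y])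
        show "N \<le> p" using n by simp
        fix i assume i: "i \<in> {1..N}"
          and le: "inc N i \<le> m \<or> compose {1..N} f (compose {1..N} \<sigma> (inc N)) i \<le> m"
        have in_n: "i \<in> {1..n}" using i n by simp
        have \<sigma>i: "\<sigma> i \<in> {1..n}" using FI_homD(3)[OF \<sigma>' in_n] .
        have eq: "compose {1..N} f (compose {1..N} \<sigma> (inc N)) i = f (\<sigma> i)"
          using i by (simp add: compose_eq)
        have "i \<le> m"
        proof (rule ccontr)
          assume "\<not> i \<le> m"
          then have f\<sigma>: "f (\<sigma> i) \<le> m" using le eq i by simp
          then have "f (\<sigma> i) \<in> {1..N}" using FI_homD(3)[OF f \<sigma>i] m by simp
          then have "f (f (\<sigma> i)) = f (\<sigma> i)" "f (\<sigma> i) \<in> {1..n}" using fN n by auto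
          then have "f (\<sigma> i) = \<sigma> i" using inj_onD[OF FI_homD(1)[OF f]] \<sigma>i by blast
          then show False using Fix_le_iff[OF \<sigma> in_n] f\<sigma> \<open>\<not> i \<le> m\<close> by simp
        qed
        then show "inc N i = compose {1..N} f (compose {1..N} \<sigma> (inc N)) i"
          using \<sigma> in_n fN i eq by (simp add: Fix_def)
      qed
      moreover have "push X n p f (up X N n x) = up X N p x"
        using X.push_compose[OF inc f x] compose_fixing_inc[OF f n(1) fN] by simp
      then have "(up X N p x, push Y n p f z) \<in> R p"
        using FI_relationD(3)[OF R f, of "up X N n x" z] z by simp
      ultimately show "push Y n p f z \<in> ?D p" by simp
    qed
  qed (rule Y.quasi_polynomial_orb)
qed

section \<open>Linearizations\<close>

lemma obj_linearization: "obj (linearization X :: ('k::field, 'a \<Rightarrow> 'k) FI_module) n = class_ring.func_space (elems X n)"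
  and arr_linearization: "arr (linearization X :: ('k::field, 'a \<Rightarrow> 'k) FI_module) m n f v =
    (\<lambda>y\<in>elems X n. \<Sum>x\<in>{x \<in> elems X m. push X m n f x = y}. v x)"
  by (simp_all add: linearization_def)

lemma arr_linearization_extensional: "arr (linearization X) m n f v \<in> extensional (elems X n)"
  by (simp add: arr_linearization)

context FI_set
begin

abbreviation LX :: "('k::field, 'a \<Rightarrow> 'k) FI_module" where
  "LX \<equiv> linearization X"

lemma arr_linearization_compose:
  assumes f: "f \<in> FI_hom l m" and g: "g \<in> FI_hom m n"
  shows "arr LX l n (compose {1..l} g f) v = arr LX m n g (arr LX l m f v)"
proof -
  have "(\<Sum>z\<in>{z \<in> elems X l. push X l n (compose {1..l} g f) z = y}. v z) =
      (\<Sum>x\<in>{x \<in> elems X m. push X m n g x = y}. \<Sum>z\<in>{z \<in> elems X l. push X l m f z = x}. v z)" for y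
  proof -
    let ?A = "{z \<in> elems X l. push X l n (compose {1..l} g f) z = y}"
    let ?B = "{x \<in> elems X m. push X m n g x = y}"
    have "(\<Sum>x\<in>?B. \<Sum>z\<in>{z \<in> ?A. push X l m f z = x}. v z) = (\<Sum>z\<in>?A. v z)"
      using f g by (intro sum.group) (auto simp: finite_elems push_compose push_closed)
    moreover have "(\<Sum>x\<in>?B. \<Sum>z\<in>{z \<in> ?A. push X l m f z = x}. v z) =
        (\<Sum>x\<in>?B. \<Sum>z\<in>{z \<in> elems X l. push X l m f z = x}. v z)"
      using f g by (intro sum.cong[OF refl] sum.cong[OF _ refl]) (auto simp: push_compose)
    ultimately show ?thesis by (simp only:)
  qed
  then show ?thesis
    unfolding arr_linearization by (intro restrict_ext) (auto intro!: sum.cong)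
qed

lemma arr_linearization_perm:
  assumes \<sigma>: "\<sigma> \<in> FI_hom n n"
  shows "arr LX n n \<sigma> v = (\<lambda>y\<in>elems X n. v (push X n n (sym_inv n \<sigma>) y))"
proof -
  have "{x \<in> elems X n. push X n n \<sigma> x = y} = {push X n n (sym_inv n \<sigma>) y}" if "y \<in> elems X n" for y
    using that \<sigma> by (auto simp: push_sym_inv push_closed sym_inv_FI_hom)
  then show ?thesis
    by (simp add: arr_linearization cong: restrict_cong)
qed

lemma arr_linearization_add:
  "arr LX m n f (\<lambda>x\<in>elems X m. v x + w x) = (\<lambda>y\<in>elems X n. arr LX m n f v y + arr LX m n f w y)"
  by (auto simp: arr_linearization fun_eq_iff sum.distrib)

lemma arr_linearization_smult:
  "arr LX m n f (\<lambda>x\<in>elems X m. c * v x) = (\<lambda>y\<in>elems X n. c * arr LX m n f v y)"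
  by (auto simp: arr_linearization fun_eq_iff sum_distrib_left)

end

text \<open>Averaging over \<open>FI_hom n k\<close> instead of choosing representatives modulo the symmetric group.\<close>

definition free_extend ::
    "nat \<Rightarrow> ('k::field, 'w) sym_rep \<Rightarrow> 'a FI_set \<Rightarrow> ('w \<Rightarrow> 'a \<Rightarrow> 'k) \<Rightarrow> nat \<Rightarrow> ((nat \<Rightarrow> nat) \<Rightarrow> 'w) \<Rightarrow> 'a \<Rightarrow> 'k" where
  "free_extend n W X \<psi> = (\<lambda>k. \<lambda>F\<in>carrier (obj (free_FI_module n W) k). \<lambda>y\<in>elems X k.
     1 / of_nat (card (FI_hom n n)) * (\<Sum>f\<in>FI_hom n k. arr (linearization X) n k f (\<psi> (F f)) y))"

lemma sym_HomD:
  assumes "\<psi> \<in> sym_Hom n U V"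
  shows "\<psi> \<in> linear_maps (space U) (space V)"
    and "\<sigma> \<in> FI_hom n n \<Longrightarrow> u \<in> carrier (space U) \<Longrightarrow> \<psi> (act U \<sigma> u) = act V \<sigma> (\<psi> u)"
  using assms by (auto simp: sym_Hom_def)

lemma rep_at_linearization [simp]:
  "space (rep_at (linearization X :: ('k::field, 'a \<Rightarrow> 'k) FI_module) n) = class_ring.func_space (elems X n)"
  "act (rep_at (linearization X :: ('k::field, 'a \<Rightarrow> 'k) FI_module) n) = arr (linearization X) n n"
  by (simp_all add: rep_at_def obj_linearization)

context FI_set
begin

text \<open>This provides the surjectivity of \<open>free_restrict\<close> that makes the
  \<open>inv_into\<close> in \<open>to_stable\<close> meaningful. Morphisms factor through the
  average because pushing along g relabels the injections, and in degree n each of the n! summands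
  at id \<otimes> w equals \<psi> w.\<close>

lemma free_extend:
  fixes \<psi> :: "((nat \<Rightarrow> nat) \<Rightarrow> 'k::field_char_0) \<Rightarrow> 'a \<Rightarrow> 'k"
  assumes \<psi>: "\<psi> \<in> sym_Hom n (Specht n \<mu>) (rep_at LX n)"
  shows "free_extend n (Specht n \<mu>) X \<psi> \<in> carrier (FI_Hom (free_FI_module n (Specht n \<mu>)) LX)"
    and "free_restrict n (Specht n \<mu>) (free_extend n (Specht n \<mu>) X \<psi>) = \<psi>"
proof -
  let ?W = "Specht n \<mu> :: ('k, _) sym_rep" and ?e = "free_extend n (Specht n \<mu>) X \<psi>"
  let ?M = "free_FI_module n ?W"
  let ?N = "of_nat (card (FI_hom n n)) :: 'k"
  note lin = linear_mapsD[OF sym_HomD(1)[OF \<psi>], simplified]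
  have \<psi>0: "\<psi> \<zero>\<^bsub>space ?W\<^esub> = (\<lambda>x\<in>elems X n. 0)"
    using lin(3)[OF Specht_zero_closed, of 0] by (simp add: Specht_zero_smult)
  have lin_e: "?e k \<in> linear_maps (obj ?M k) (obj LX k)" for k
    unfolding linear_maps_def LinearCombinations.module_hom_def
  proof (intro IntI CollectI conjI allI impI Pi_I)
    fix F G assume "F \<in> carrier (obj ?M k) \<and> G \<in> carrier (obj ?M k)"
    then have F: "F \<in> carrier (obj ?M k)" and G: "G \<in> carrier (obj ?M k)" by auto
    have "(\<Sum>f\<in>FI_hom n k. arr LX n k f (\<psi> ((F \<oplus>\<^bsub>obj ?M k\<^esub> G) f)) y) =
        (\<Sum>f\<in>FI_hom n k. arr LX n k f (\<psi> (F f)) y) + (\<Sum>f\<in>FI_hom n k. arr LX n k f (\<psi> (G f)) y)"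
      if "y \<in> elems X k" for y
      using that carrier_freeD(2)[OF F] carrier_freeD(2)[OF G]
      by (simp add: add_free lin arr_linearization_add sum.distrib)
    then show "?e k (F \<oplus>\<^bsub>obj ?M k\<^esub> G) = ?e k F \<oplus>\<^bsub>obj LX k\<^esub> ?e k G"
      using F G free_closed(2)[OF F G]
      by (simp add: free_extend_def obj_linearization distrib_left[symmetric] del: times_divide_eq_left cong: restrict_cong)
  next
    fix c :: 'k and F assume "c \<in> carrier class_ring \<and> F \<in> carrier (obj ?M k)"
    then have F: "F \<in> carrier (obj ?M k)" by auto
    have "(\<Sum>f\<in>FI_hom n k. arr LX n k f (\<psi> ((c \<odot>\<^bsub>obj ?M k\<^esub> F) f)) y) =
        c * (\<Sum>f\<in>FI_hom n k. arr LX n k f (\<psi> (F f)) y)" if "y \<in> elems X k" for y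
      using that carrier_freeD(2)[OF F]
      by (simp add: smult_free lin arr_linearization_smult sum_distrib_left)
    then show "?e k (c \<odot>\<^bsub>obj ?M k\<^esub> F) = c \<odot>\<^bsub>obj LX k\<^esub> ?e k F"
      using F free_closed(3)[OF F, of c]
      by (simp add: free_extend_def obj_linearization mult.left_commute del: times_divide_eq_left cong: restrict_cong)
  qed (simp_all add: free_extend_def obj_linearization)
  moreover have "?e l (arr ?M k l g F) = arr LX k l g (?e k F)"
    if g: "g \<in> FI_hom k l" and F: "F \<in> carrier (obj ?M k)" for k l g F
  proof (rule extensionalityI[OF _ arr_linearization_extensional])
    show "?e l (arr ?M k l g F) \<in> extensional (elems X l)"
      using arr_free_closed[OF g F] by (simp add: free_extend_def)
    fix y assume y: "y \<in> elems X l"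
    let ?I = "compose {1..n} g ` FI_hom n k"
    have "(\<Sum>h\<in>FI_hom n l. arr LX n l h (\<psi> (arr ?M k l g F h)) y) =
        (\<Sum>h\<in>?I. arr LX n l h (\<psi> (arr ?M k l g F h)) y)"
    proof (rule sum.mono_neutral_right)
      show "?I \<subseteq> FI_hom n l" using compose_FI_hom[OF _ g] by blast
      show "\<forall>h\<in>FI_hom n l - ?I. arr LX n l h (\<psi> (arr ?M k l g F h)) y = 0"
        using y by (auto simp: arr_free_outside \<psi>0 arr_linearization)
    qed simp
    also have "\<dots> = (\<Sum>f\<in>FI_hom n k. arr LX n l (compose {1..n} g f) (\<psi> (F f)) y)"
      using inj_on_compose_left[OF g] by (simp add: sum.reindex arr_free_compose[OF g])
    also have "\<dots> = (\<Sum>f\<in>FI_hom n k. arr LX k l g (arr LX n k f (\<psi> (F f))) y)"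
      by (simp add: arr_linearization_compose[OF _ g])
    also have "\<dots> = (\<Sum>x\<in>{x \<in> elems X k. push X k l g x = y}. \<Sum>f\<in>FI_hom n k. arr LX n k f (\<psi> (F f)) x)"
      using y by (subst sum.swap) (simp add: arr_linearization[of X k l])
    finally have "?e l (arr ?M k l g F) y =
        1 / ?N * (\<Sum>x\<in>{x \<in> elems X k. push X k l g x = y}. \<Sum>f\<in>FI_hom n k. arr LX n k f (\<psi> (F f)) x)"
      using y arr_free_closed[OF g F] by (simp add: free_extend_def)
    also have "\<dots> = (\<Sum>x\<in>{x \<in> elems X k. push X k l g x = y}. ?e k F x)"
      unfolding sum_distrib_left using F by (intro sum.cong refl) (simp add: free_extend_def sum_divide_distrib)
    finally show "?e l (arr ?M k l g F) y = arr LX k l g (?e k F) y"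
      using y by (simp add: arr_linearization[of X k l])
  qed
  ultimately show "?e \<in> carrier (FI_Hom ?M LX)"
    by (simp add: FI_Hom_def)
  show "free_restrict n ?W ?e = \<psi>"
  proof (rule extensionalityI)
    show "\<psi> \<in> extensional (Specht_carrier n \<mu>)" using lin(4) .
    show "free_restrict n ?W ?e \<in> extensional (Specht_carrier n \<mu>)"
      by (simp add: free_restrict_def)
    fix w :: "(nat \<Rightarrow> nat) \<Rightarrow> 'k" assume w: "w \<in> Specht_carrier n \<mu>"
    have "arr LX n n \<sigma> (\<psi> (free_unit n ?W w \<sigma>)) = \<psi> w" if \<sigma>: "\<sigma> \<in> FI_hom n n" for \<sigma>
    proof -
      note \<sigma>i = sym_inv_FI_hom[OF \<sigma>]
      have "arr LX n n \<sigma> (\<psi> (free_unit n ?W w \<sigma>)) = \<psi> (act ?W \<sigma> (act ?W (sym_inv n \<sigma>) w))"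
        using sym_HomD(2)[OF \<psi> \<sigma> act_Specht_closed[OF w \<sigma>i]] by (simp add: free_unit_apply[OF \<sigma>])
      also have "\<dots> = \<psi> w"
        using \<sigma> \<sigma>i w by (simp add: act_Specht_compose compose_sym_inv act_Specht_inc)
      finally show ?thesis .
    qed
    then have "?e n (free_unit n ?W w) = (\<lambda>y\<in>elems X n. \<psi> w y)"
      using free_unit_closed[OF w] card_sym_nonzero[of n, where 'k = 'k]
      by (simp add: free_extend_def cong: restrict_cong)
    also have "\<dots> = \<psi> w"
      using lin(1)[OF w] by (rule extensional_restrict)
    finally show "free_restrict n ?W ?e w = \<psi> w"
      using w by (simp add: free_restrict_def compose_eq)
  qed
qed

lemma free_restrict_in_sym_Hom:
  fixes \<phi> :: "nat \<Rightarrow> ((nat \<Rightarrow> nat) \<Rightarrow> (nat \<Rightarrow> nat) \<Rightarrow> 'k::field_char_0) \<Rightarrow> 'a \<Rightarrow> 'k"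
  assumes \<phi>: "\<phi> \<in> carrier (FI_Hom (free_FI_module n (Specht n \<mu>)) LX)"
  shows "free_restrict n (Specht n \<mu>) \<phi> \<in> sym_Hom n (Specht n \<mu>) (rep_at LX n)"
proof -
  let ?W = "Specht n \<mu> :: ('k, _) sym_rep"
  note lin = linear_mapsD[OF FI_HomD(1)[OF \<phi>, of n], unfolded obj_linearization]
  have app: "free_restrict n ?W \<phi> w = \<phi> n (free_unit n ?W w)" if "w \<in> Specht_carrier n \<mu>" for w
    using that by (simp add: free_restrict_def compose_eq)
  have "free_restrict n ?W \<phi> \<in> linear_maps (space ?W) (class_ring.func_space (elems X n))"
    unfolding linear_maps_def LinearCombinations.module_hom_def
  proof (intro IntI CollectI conjI allI impI Pi_I)
    fix v w :: "(nat \<Rightarrow> nat) \<Rightarrow> 'k" assume "v \<in> Specht_carrier n \<mu> \<and> w \<in> Specht_carrier n \<mu>"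
    then show "free_restrict n ?W \<phi> (v \<oplus>\<^bsub>space ?W\<^esub> w) =
        free_restrict n ?W \<phi> v \<oplus>\<^bsub>class_ring.func_space (elems X n)\<^esub> free_restrict n ?W \<phi> w"
      using lin(2)[OF free_unit_closed free_unit_closed, of v w]
      by (simp add: app Specht_add_closed free_unit_add)
  next
    fix c :: 'k and v :: "(nat \<Rightarrow> nat) \<Rightarrow> 'k" assume "c \<in> carrier class_ring \<and> v \<in> Specht_carrier n \<mu>"
    then show "free_restrict n ?W \<phi> (c \<odot>\<^bsub>space ?W\<^esub> v) =
        c \<odot>\<^bsub>class_ring.func_space (elems X n)\<^esub> free_restrict n ?W \<phi> v"
      using lin(3)[OF free_unit_closed, of v c]
      by (simp add: app Specht_smult_closed free_unit_smult)
  next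
    fix w :: "(nat \<Rightarrow> nat) \<Rightarrow> 'k" assume "w \<in> Specht_carrier n \<mu>"
    then show "free_restrict n ?W \<phi> w \<in> carrier (class_ring.func_space (elems X n))"
      using lin(1)[OF free_unit_closed, of w] by (simp add: app)
  qed (simp add: free_restrict_def)
  moreover have "free_restrict n ?W \<phi> (act ?W \<sigma> w) = arr LX n n \<sigma> (free_restrict n ?W \<phi> w)"
    if "\<sigma> \<in> FI_hom n n" "w \<in> Specht_carrier n \<mu>" for \<sigma> w
    using that FI_HomD(2)[OF \<phi> that(1) free_unit_closed[OF that(2)]] arr_free_unit[OF that]
    by (simp add: app act_Specht_closed)
  ultimately show ?thesis
    by (simp add: sym_Hom_def)
qed

section \<open>Coordinates on invariant vectors\<close>

text \<open>The invariant vector \<open>v\<close> is the combination of the averages of the orbits with these coordinates.\<close>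

definition coord :: "nat \<Rightarrow> nat \<Rightarrow> nat \<Rightarrow> ('a \<Rightarrow> 'k::field) \<Rightarrow> 'a \<Rightarrow> 'k" where
  "coord m N n v x = (if x \<in> elems X N then \<Sum>z\<in>orb X m n (up X N n x). v z else 0)"

definition invariant :: "nat \<Rightarrow> nat \<Rightarrow> ('a \<Rightarrow> 'k::field) \<Rightarrow> bool" where
  "invariant m n v \<longleftrightarrow> v \<in> extensional (elems X n) \<and> (\<forall>\<sigma>\<in>Fix m n. arr LX n n \<sigma> v = v)"

lemma invariant_orb:
  assumes v: "invariant m n v" and x: "x \<in> elems X n" and z: "z \<in> orb X m n x"
  shows "v z = v x"
proof -
  obtain \<sigma> where \<sigma>: "\<sigma> \<in> Fix m n" "z = push X n n \<sigma> x" using z by (auto simp: orb_def)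
  note \<sigma>' = Fix_FI_hom[OF \<sigma>(1)]
  have "arr LX n n \<sigma> v z = v x"
    using \<sigma>' x by (simp add: arr_linearization_perm \<sigma>(2) push_closed push_sym_inv)
  then show ?thesis using v \<sigma> by (simp add: invariant_def)
qed

text \<open>An invariant vector is constant on orbits, so its coordinate is the orbit size times the
  value, and orbit sizes are invertible in characteristic zero. By stability every element of degree
  n lies in the orbit of some element coming from degree N.\<close>

lemma coord_inj:
  fixes v w :: "'a \<Rightarrow> 'k::field_char_0"
  assumes st: "stable_from X m N" and n: "N \<le> n"
    and v: "invariant m n v" and w: "invariant m n w" and eq: "coord m N n v = coord m N n w"
  shows "v = w"
proof (rule extensionalityI)
  show "v \<in> extensional (elems X n)" "w \<in> extensional (elems X n)"
    using v w by (auto simp: invariant_def)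
  fix z assume "z \<in> elems X n"
  then obtain x where x: "x \<in> elems X N" "z \<in> orb X m n (up X N n x)"
    using stable_fromD(1)[OF st order_refl n] by blast
  have upx: "up X N n x \<in> elems X n" using n x(1) by (rule up_closed)
  have sum: "coord m N n u x = of_nat (card (orb X m n (up X N n x))) * u z" if "invariant m n u" for u :: "'a \<Rightarrow> 'k"
  proof -
    have "u y = u z" if "y \<in> orb X m n (up X N n x)" for y
      using invariant_orb[OF \<open>invariant m n u\<close> upx] that x(2) by simp
    then show ?thesis using x(1) by (simp add: coord_def)
  qed
  have "(of_nat (card (orb X m n (up X N n x))) :: 'k) \<noteq> 0"
    using x(2) by (auto simp: card_eq_0_iff)
  then show "v z = w z"
    using sum[OF v] sum[OF w] eq by simp
qed

text \<open>By stability the elements of degree n that the inclusion sends into the orbit of x are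
  exactly those in the orbit of x in degree n. Composition with \<rho> does not affect this, so each
  summand preserves the orbit sum and the total factor is c times the number of summands.\<close>

lemma coord_transition:
  fixes v :: "'a \<Rightarrow> 'k::field"
  assumes st: "stable_from X m N" and n: "N \<le> n"
    and v': "v' = (\<lambda>y\<in>elems X (Suc n). \<Sum>\<rho>\<in>Fix m (Suc n). c * arr LX n (Suc n) (compose {1..n} \<rho> (inc n)) v y)"
  shows "coord m N (Suc n) v' x = c * of_nat (card (Fix m (Suc n))) * coord m N n v x"
proof (cases "x \<in> elems X N")
  case x: True
  let ?O = "orb X m (Suc n) (up X N (Suc n) x)"
  have inc: "inc n \<in> FI_hom n (Suc n)" by (rule inc_FI_hom) simp
  have upx: "up X N (Suc n) x \<in> elems X (Suc n)" using n x by (intro up_closed) auto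
  have O: "?O \<subseteq> elems X (Suc n)" using upx by (rule orb_closed)
  have up_up: "up X n (Suc n) (up X N n x) = up X N (Suc n) x" using n x by (intro up_up) auto
  have mem: "up X n (Suc n) z \<in> ?O \<longleftrightarrow> z \<in> orb X m n (up X N n x)" if z: "z \<in> elems X n" for z
  proof
    assume "up X n (Suc n) z \<in> ?O"
    then show "z \<in> orb X m n (up X N n x)"
      using stable_fromD(2)[OF st n, of "Suc n" "up X N n x" z] up_up up_closed[OF n x] z by simp
  next
    assume "z \<in> orb X m n (up X N n x)"
    then show "up X n (Suc n) z \<in> ?O"
      using up_orb[OF _ up_closed[OF n x], of "Suc n" z m] up_up by simp
  qed
  have "(\<Sum>y\<in>?O. arr LX n (Suc n) (compose {1..n} \<rho> (inc n)) v y) = (\<Sum>z\<in>orb X m n (up X N n x). v z)"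
    if \<rho>: "\<rho> \<in> Fix m (Suc n)" for \<rho>
  proof -
    let ?f = "compose {1..n} \<rho> (inc n)"
    note \<rho>' = Fix_FI_hom[OF \<rho>]
    have push: "push X n (Suc n) ?f z = push X (Suc n) (Suc n) \<rho> (up X n (Suc n) z)" if "z \<in> elems X n" for z
      using push_compose[OF inc \<rho>' that] .
    have iff: "push X n (Suc n) ?f z \<in> ?O \<longleftrightarrow> z \<in> orb X m n (up X N n x)" if z: "z \<in> elems X n" for z
    proof -
      have "up X n (Suc n) z \<in> elems X (Suc n)" using z by (intro up_closed) auto
      then have "up X n (Suc n) z = push X (Suc n) (Suc n) (sym_inv (Suc n) \<rho>) (push X n (Suc n) ?f z)"
        by (simp add: push[OF z] push_sym_inv \<rho>')
      then show ?thesis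
        using push_Fix_orb[OF \<rho> upx] push_Fix_orb[OF sym_inv_Fix[OF \<rho>] upx] push[OF z] mem[OF z] by metis
    qed
    have "(\<Sum>y\<in>?O. arr LX n (Suc n) ?f v y) =
        (\<Sum>y\<in>?O. \<Sum>z\<in>{z \<in> orb X m n (up X N n x). push X n (Suc n) ?f z = y}. v z)"
    proof (rule sum.cong[OF refl])
      fix y assume y: "y \<in> ?O"
      have "{z \<in> elems X n. push X n (Suc n) ?f z = y} =
          {z \<in> orb X m n (up X N n x). push X n (Suc n) ?f z = y}"
        using iff y orb_closed[OF up_closed[OF n x], of m] by blast
      then show "arr LX n (Suc n) ?f v y =
          (\<Sum>z\<in>{z \<in> orb X m n (up X N n x). push X n (Suc n) ?f z = y}. v z)"
        using y O by (auto simp: arr_linearization)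
    qed
    also have "\<dots> = (\<Sum>z\<in>orb X m n (up X N n x). v z)"
      using iff orb_closed[OF up_closed[OF n x], of m] by (intro sum.group) auto
    finally show ?thesis .
  qed
  moreover have "(\<Sum>y\<in>?O. v' y) =
      (\<Sum>\<rho>\<in>Fix m (Suc n). c * (\<Sum>y\<in>?O. arr LX n (Suc n) (compose {1..n} \<rho> (inc n)) v y))"
    unfolding sum_distrib_left using O by (subst sum.swap) (auto simp: v' intro!: sum.cong)
  ultimately show ?thesis
    using x by (simp add: coord_def)
qed (simp add: coord_def)

lemma sum_over_orbits:
  assumes st: "stable_from X m N" and n: "N \<le> n"
    and T: "T \<subseteq> elems X N" and T1: "\<And>x. x \<in> elems X N \<Longrightarrow> \<exists>!t. t \<in> T \<and> x \<in> orb X m N t"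
  shows "(\<Sum>x\<in>elems X n. f x) = (\<Sum>t\<in>T. \<Sum>x\<in>orb X m n (up X N n t). f x :: 'k::field)"
proof -
  have "elems X n = (\<Union>t\<in>T. orb X m n (up X N n t))"
    by (rule orbit_partition(1)[OF st n T T1])
  moreover have "orb X m n (up X N n s) \<inter> orb X m n (up X N n t) = {}" if "s \<in> T" "t \<in> T" "s \<noteq> t" for s t
    by (rule orbit_partition(2)[OF st n T T1 that])
  moreover have "finite T" using T finite_elems by (rule finite_subset)
  ultimately show ?thesis
    using sum.UNION_disjoint[of T "\<lambda>t. orb X m n (up X N n t)" f] by simp
qed

end

lemma rel_map_equivariant:
  fixes v :: "'a \<Rightarrow> 'k::field"
  assumes X: "FI_set X" and Y: "FI_set Y" and R: "FI_relation X Y R" and \<sigma>: "\<sigma> \<in> FI_hom n n"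
  shows "rel_map X Y R n (arr (linearization X) n n \<sigma> v) = arr (linearization Y) n n \<sigma> (rel_map X Y R n v)"
proof -
  interpret X: FI_set X by (rule X)
  interpret Y: FI_set Y by (rule Y)
  note \<sigma>i = sym_inv_FI_hom[OF \<sigma>]
  have "(\<Sum>x\<in>{x \<in> elems X n. (x, y) \<in> R n}. v (push X n n (sym_inv n \<sigma>) x)) =
      (\<Sum>x\<in>{x \<in> elems X n. (x, push Y n n (sym_inv n \<sigma>) y) \<in> R n}. v x)" if y: "y \<in> elems Y n" for y
  proof (rule sum.reindex_bij_witness[of _ "push X n n \<sigma>" "push X n n (sym_inv n \<sigma>)"])
    fix x assume x: "x \<in> {x \<in> elems X n. (x, y) \<in> R n}"
    then show "push X n n \<sigma> (push X n n (sym_inv n \<sigma>) x) = x" using \<sigma> by (simp add: X.push_sym_inv)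
    show "push X n n (sym_inv n \<sigma>) x \<in> {x \<in> elems X n. (x, push Y n n (sym_inv n \<sigma>) y) \<in> R n}"
      using x FI_relationD(3)[OF R \<sigma>i] \<sigma>i by (auto simp: X.push_closed)
  next
    fix x assume x: "x \<in> {x \<in> elems X n. (x, push Y n n (sym_inv n \<sigma>) y) \<in> R n}"
    then show "push X n n (sym_inv n \<sigma>) (push X n n \<sigma> x) = x" using \<sigma> by (simp add: X.push_sym_inv)
    show "push X n n \<sigma> x \<in> {x \<in> elems X n. (x, y) \<in> R n}"
      using x FI_relationD(3)[OF R \<sigma>, of x "push Y n n (sym_inv n \<sigma>) y"] \<sigma> y
      by (auto simp: X.push_closed Y.push_sym_inv)
  qed auto
  then show ?thesis
    using \<sigma>i by (auto simp: fun_eq_iff rel_map_def X.arr_linearization_perm[OF \<sigma>] Y.arr_linearization_perm[OF \<sigma>]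
        Y.push_closed intro!: sum.cong)
qed

lemma rel_map_extensional: "rel_map X Y R n v \<in> extensional (elems Y n)"
  by (simp add: rel_map_def)

text \<open>Double counting: after exchanging the sums, the weight of x is the number of elements of
  the orbit of y related to x. Since the relation and the orbit are both stable under
  \<open>Fix m n\<close>, this number is constant on orbits of x.\<close>

lemma coord_rel_map:
  fixes v :: "'a \<Rightarrow> 'k::field"
  assumes X: "FI_set X" and Y: "FI_set Y" and R: "FI_relation X Y R"
    and st: "stable_from X m N" and n: "N \<le> n"
    and T: "T \<subseteq> elems X N" and T1: "\<And>x. x \<in> elems X N \<Longrightarrow> \<exists>!t. t \<in> T \<and> x \<in> orb X m N t"
    and y: "y \<in> elems Y N"
  shows "FI_set.coord Y m N n (rel_map X Y R n v) y =
    (\<Sum>t\<in>T. of_nat (card {z \<in> orb Y m n (up Y N n y). (up X N n t, z) \<in> R n}) * FI_set.coord X m N n v t)"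
proof -
  interpret X: FI_set X by (rule X)
  interpret Y: FI_set Y by (rule Y)
  let ?O = "orb Y m n (up Y N n y)"
  define K where "K x = card {z \<in> ?O. (x, z) \<in> R n}" for x
  have upy: "up Y N n y \<in> elems Y n" using n y by (rule Y.up_closed)
  have O: "?O \<subseteq> elems Y n" using upy by (rule Y.orb_closed)
  have K: "K x' = K x" if x: "x \<in> elems X n" and x': "x' \<in> orb X m n x" for x x'
  proof -
    obtain \<sigma> where \<sigma>: "\<sigma> \<in> Fix m n" "x' = push X n n \<sigma> x" using x' by (auto simp: orb_def)
    note \<sigma>' = Fix_FI_hom[OF \<sigma>(1)] and \<sigma>i = sym_inv_Fix[OF \<sigma>(1)]
    have "bij_betw (push Y n n \<sigma>) {z \<in> ?O. (x, z) \<in> R n} {z \<in> ?O. (x', z) \<in> R n}"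
    proof (rule bij_betw_byWitness[of _ "push Y n n (sym_inv n \<sigma>)"])
      show "push Y n n \<sigma> ` {z \<in> ?O. (x, z) \<in> R n} \<subseteq> {z \<in> ?O. (x', z) \<in> R n}"
        using Y.push_Fix_orb[OF \<sigma>(1) upy] FI_relationD(3)[OF R \<sigma>'] \<sigma>(2) by auto
      have "x = push X n n (sym_inv n \<sigma>) x'"
        using \<sigma> \<sigma>' x by (simp add: X.push_sym_inv)
      then show "push Y n n (sym_inv n \<sigma>) ` {z \<in> ?O. (x', z) \<in> R n} \<subseteq> {z \<in> ?O. (x, z) \<in> R n}"
        using Y.push_Fix_orb[OF \<sigma>i upy] FI_relationD(3)[OF R Fix_FI_hom[OF \<sigma>i]] by auto
    qed (use O \<sigma>' in \<open>auto simp: Y.push_sym_inv subset_iff\<close>)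
    then show ?thesis unfolding K_def by (rule bij_betw_same_card[symmetric])
  qed
  have "Y.coord m N n (rel_map X Y R n v) y = (\<Sum>z\<in>?O. \<Sum>x\<in>{x \<in> elems X n. (x, z) \<in> R n}. v x)"
    using y O by (auto simp: Y.coord_def rel_map_def intro!: sum.cong)
  also have "\<dots> = (\<Sum>z\<in>?O. \<Sum>x\<in>elems X n. if (x, z) \<in> R n then v x else 0)"
    by (simp add: sum.inter_filter[symmetric] X.finite_elems)
  also have "\<dots> = (\<Sum>x\<in>elems X n. \<Sum>z\<in>?O. if (x, z) \<in> R n then v x else 0)"
    by (rule sum.swap)
  also have "\<dots> = (\<Sum>x\<in>elems X n. of_nat (K x) * v x)"
    by (simp add: sum.inter_filter[symmetric] K_def)
  also have "\<dots> = (\<Sum>t\<in>T. \<Sum>x\<in>orb X m n (up X N n t). of_nat (K x) * v x)"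
    by (rule X.sum_over_orbits[OF st n T T1])
  also have "\<dots> = (\<Sum>t\<in>T. of_nat (K (up X N n t)) * X.coord m N n v t)"
  proof (rule sum.cong[OF refl])
    fix t assume "t \<in> T"
    then have t: "t \<in> elems X N" using T by blast
    have "K x = K (up X N n t)" if "x \<in> orb X m n (up X N n t)" for x
      using K[OF X.up_closed[OF n t] that] .
    then show "(\<Sum>x\<in>orb X m n (up X N n t). of_nat (K x) * v x) = of_nat (K (up X N n t)) * X.coord m N n v t"
      using t by (simp add: X.coord_def sum_distrib_left)
  qed
  finally show ?thesis by (simp add: K_def)
qed

section \<open>Vector spaces embedded in function spaces\<close>

text \<open>An injective map to functions that respects the operations pulls the vector space axioms
  back to M. For the direct limit this replaces a verification on classes.\<close>

locale function_embedding =
  fixes M :: "('k::field, 'v) module" and \<Phi> :: "'v \<Rightarrow> 'i \<Rightarrow> 'k"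
  assumes zero_closed: "\<zero>\<^bsub>M\<^esub> \<in> carrier M"
    and add_closed: "v \<in> carrier M \<Longrightarrow> w \<in> carrier M \<Longrightarrow> v \<oplus>\<^bsub>M\<^esub> w \<in> carrier M"
    and smult_closed: "v \<in> carrier M \<Longrightarrow> c \<odot>\<^bsub>M\<^esub> v \<in> carrier M"
    and embed_zero: "\<Phi> \<zero>\<^bsub>M\<^esub> = (\<lambda>i. 0)"
    and embed_add: "v \<in> carrier M \<Longrightarrow> w \<in> carrier M \<Longrightarrow> \<Phi> (v \<oplus>\<^bsub>M\<^esub> w) = (\<lambda>i. \<Phi> v i + \<Phi> w i)"
    and embed_smult: "v \<in> carrier M \<Longrightarrow> \<Phi> (c \<odot>\<^bsub>M\<^esub> v) = (\<lambda>i. c * \<Phi> v i)"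
    and embed_inj: "inj_on \<Phi> (carrier M)"
begin

lemma eqI: "v \<in> carrier M \<Longrightarrow> w \<in> carrier M \<Longrightarrow> \<Phi> v = \<Phi> w \<Longrightarrow> v = w"
  using embed_inj by (rule inj_onD)

sublocale V: vectorspace "class_ring :: 'k ring" M
proof (rule vs_criteria)
  show "\<forall>v\<in>carrier M. \<exists>w\<in>carrier M. v \<oplus>\<^bsub>M\<^esub> w = \<zero>\<^bsub>M\<^esub>"
  proof
    fix v assume v: "v \<in> carrier M"
    have "v \<oplus>\<^bsub>M\<^esub> ((- 1) \<odot>\<^bsub>M\<^esub> v) = \<zero>\<^bsub>M\<^esub>"
      using v by (intro eqI) (simp_all add: zero_closed add_closed smult_closed embed_zero embed_add embed_smult)
    then show "\<exists>w\<in>carrier M. v \<oplus>\<^bsub>M\<^esub> w = \<zero>\<^bsub>M\<^esub>"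
      using v smult_closed by blast
  qed
qed (auto intro!: class_field eqI simp: zero_closed add_closed smult_closed embed_zero embed_add embed_smult algebra_simps)

lemma embed_lincomb:
  assumes "finite A" and "A \<subseteq> carrier M"
  shows "\<Phi> (V.lincomb a A) = (\<lambda>i. \<Sum>v\<in>A. a v * \<Phi> v i)"
  using assms
proof (induction A rule: finite_induct)
  case empty
  then show ?case by (simp add: V.lincomb_def embed_zero)
next
  case (insert v A)
  then have "V.lincomb a (A \<union> {v}) = (a v \<odot>\<^bsub>M\<^esub> v) \<oplus>\<^bsub>M\<^esub> V.lincomb a A"
    by (intro V.lincomb_insert) auto
  moreover have "V.lincomb a A \<in> carrier M"
    using insert.prems by (intro V.lincomb_closed) auto
  ultimately show ?case
    using insert by (simp add: embed_add embed_smult smult_closed)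
qed

text \<open>Extend the dual basis from the image of the embedding to the whole function space.\<close>

lemma basis_coefficients:
  assumes C: "V.basis C" and S: "finite S" "\<And>v i. v \<in> carrier M \<Longrightarrow> i \<notin> S \<Longrightarrow> \<Phi> v i = 0"
  shows "finite C" and "\<exists>A. \<forall>v\<in>carrier M. v = V.lincomb (\<lambda>c. \<Sum>i\<in>S. A c i * \<Phi> v i) C"
proof -
  let ?s = "\<lambda>(c::'k) (f::'i \<Rightarrow> 'k) i. c * f i"
  interpret F: vector_space ?s
    by unfold_locales (auto simp: fun_eq_iff algebra_simps)
  interpret K: vector_space "(*) :: 'k \<Rightarrow> 'k \<Rightarrow> 'k"
    by unfold_locales (auto simp: algebra_simps)
  interpret P: vector_space_pair ?s "(*) :: 'k \<Rightarrow> 'k \<Rightarrow> 'k" ..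
  have CM: "C \<subseteq> carrier M" and gen: "V.span C = carrier M" and indep: "\<not> V.lin_dep C"
    using C by (auto simp: V.basis_def)
  have sum_apply: "(\<Sum>x\<in>A. g x) i = (\<Sum>x\<in>A. g x i)" for A and g :: "'x \<Rightarrow> 'i \<Rightarrow> 'k" and i
    by (induction A rule: infinite_finite_induct) auto
  have inj: "inj_on \<Phi> C" using embed_inj CM by (rule inj_on_subset)
  have F_indep: "F.independent (\<Phi> ` C)"
  proof
    assume "F.dependent (\<Phi> ` C)"
    then obtain t u where t: "finite t" "t \<subseteq> \<Phi> ` C" "(\<Sum>v\<in>t. ?s (u v) v) = 0" "\<exists>v\<in>t. u v \<noteq> 0"
      unfolding F.dependent_explicit by blast
    obtain A where A: "A \<subseteq> C" "t = \<Phi> ` A" using t(2) by (auto simp: subset_image_iff)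
    have injA: "inj_on \<Phi> A" using inj A(1) by (rule inj_on_subset)
    have finA: "finite A" using t(1) A(2) injA by (simp add: finite_image_iff)
    have AM: "A \<subseteq> carrier M" using A(1) CM by blast
    have "(\<Sum>v\<in>A. u (\<Phi> v) * \<Phi> v i) = 0" for i
      using fun_cong[OF t(3), of i] by (simp add: A(2) sum.reindex[OF injA] sum_apply)
    then have "\<Phi> (V.lincomb (u \<circ> \<Phi>) A) = \<Phi> \<zero>\<^bsub>M\<^esub>"
      by (simp add: embed_lincomb[OF finA AM] embed_zero)
    then have "V.lincomb (u \<circ> \<Phi>) A = \<zero>\<^bsub>M\<^esub>"
      using AM by (intro eqI) (auto simp: zero_closed)
    moreover obtain v where "v \<in> A" "u (\<Phi> v) \<noteq> 0" using t(4) A(2) by auto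
    ultimately have "V.lin_dep C"
      unfolding V.lin_dep_def using finA A(1)
      by (intro exI[of _ A] exI[of _ "u \<circ> \<Phi>"] exI[of _ v]) auto
    then show False using indep by simp
  qed
  define e where "e i = (\<lambda>j. if j = i then 1 else 0 :: 'k)" for i :: 'i
  have expand: "\<Phi> v = (\<Sum>i\<in>S. ?s (\<Phi> v i) (e i))" if "v \<in> carrier M" for v
  proof
    fix j
    have "(\<Sum>i\<in>S. \<Phi> v i * e i j) = (\<Sum>i\<in>S. if i = j then \<Phi> v i else 0)"
      by (intro sum.cong refl) (simp add: e_def)
    also have "\<dots> = \<Phi> v j" using S that by (simp add: sum.delta)
    finally show "\<Phi> v j = (\<Sum>i\<in>S. ?s (\<Phi> v i) (e i)) j" by (simp add: sum_apply)
  qed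
  have "\<Phi> ` C \<subseteq> F.span (e ` S)"
  proof
    fix f assume "f \<in> \<Phi> ` C"
    then obtain v where v: "v \<in> carrier M" "f = \<Phi> v" using CM by blast
    have "(\<Sum>i\<in>S. ?s (\<Phi> v i) (e i)) \<in> F.span (e ` S)"
      by (intro F.span_sum F.span_scale F.span_base) auto
    then show "f \<in> F.span (e ` S)" using expand[OF v(1)] v(2) by simp
  qed
  \<comment> \<open>The image of C is independent and lies in the span of the finitely many unit
    vectors e i with i in S.\<close>
  then have "finite (\<Phi> ` C)"
    using F.independent_span_bound[OF _ F_indep] S(1) by blast
  then show fin: "finite C" using inj by (simp add: finite_image_iff)
  have "\<exists>g. Vector_Spaces.linear ?s (*) g \<and> (\<forall>c'\<in>C. g (\<Phi> c') = (if c' = c then 1 else 0))" if "c \<in> C" for c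
  proof -
    obtain g where g: "Vector_Spaces.linear ?s (*) g"
      "\<forall>f\<in>\<Phi> ` C. g f = (if f = \<Phi> c then 1 else (0 :: 'k))"
      using P.linear_independent_extend[OF F_indep, of "\<lambda>f. if f = \<Phi> c then 1 else 0"] by blast
    then have "\<forall>c'\<in>C. g (\<Phi> c') = (if c' = c then 1 else 0)"
      using inj_onD[OF inj] that by auto
    then show ?thesis using g(1) by blast
  qed
  then obtain g where lin: "\<And>c. c \<in> C \<Longrightarrow> Vector_Spaces.linear ?s (*) (g c)"
    and dual: "\<And>c c'. c \<in> C \<Longrightarrow> c' \<in> C \<Longrightarrow> g c (\<Phi> c') = (if c' = c then 1 else 0)"
    by metis
  have lin_sum: "g c (\<Sum>i\<in>A. ?s (a i) (f i)) = (\<Sum>i\<in>A. a i * g c (f i))"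
    if "c \<in> C" for c A and a :: "'x \<Rightarrow> 'k" and f :: "'x \<Rightarrow> 'i \<Rightarrow> 'k"
    by (simp only: P.linear_sum[OF lin[OF that]] P.linear_scale[OF lin[OF that]])
  have "v = V.lincomb (\<lambda>c. \<Sum>i\<in>S. g c (e i) * \<Phi> v i) C" if v: "v \<in> carrier M" for v
  proof -
    obtain a where a: "v = V.lincomb a C"
      using v gen V.finite_span[OF fin CM] by auto
    have "\<Phi> v = (\<Sum>c\<in>C. ?s (a c) (\<Phi> c))"
      unfolding a by (auto simp: embed_lincomb[OF fin CM] sum_apply fun_eq_iff)
    then have "g c (\<Phi> v) = a c" if "c \<in> C" for c
      using lin_sum[OF that, of a \<Phi> C] dual[OF that] fin that by (simp add: if_distrib sum.delta cong: if_cong)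
    moreover have "g c (\<Phi> v) = (\<Sum>i\<in>S. g c (e i) * \<Phi> v i)" if "c \<in> C" for c
      using lin_sum[OF that, of "\<Phi> v" e S] expand[OF v] by (simp add: mult.commute)
    ultimately have "a c = (\<Sum>i\<in>S. g c (e i) * \<Phi> v i)" if "c \<in> C" for c
      using that by simp
    then show ?thesis
      unfolding a using CM by (intro V.lincomb_cong) (auto simp: a[symmetric])
  qed
  \<comment> \<open>The coefficients are the values of the extended dual functionals on the unit
    vectors, and so do not depend on v.\<close>
  then show "\<exists>A. \<forall>v\<in>carrier M. v = V.lincomb (\<lambda>c. \<Sum>i\<in>S. A c i * \<Phi> v i) C"
    by (intro exI[of _ "\<lambda>c i. g c (e i)"]) blast
qed

end

section \<open>Direct limits with compatible coordinates\<close>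

text \<open>The limit starts at N0, but injective coordinates compatible with the transition maps
  are available only from N1 on. Elements of lower degree are first transported there.\<close>

locale coordinate_system =
  fixes N0 N1 :: nat and H :: "nat \<Rightarrow> ('k::field, 'h) module" and t :: "nat \<Rightarrow> 'h \<Rightarrow> 'h"
    and L :: "nat \<Rightarrow> 'h \<Rightarrow> 'i \<Rightarrow> 'k"
  assumes N01: "N0 \<le> N1"
    and H_zero: "N0 \<le> n \<Longrightarrow> \<zero>\<^bsub>H n\<^esub> \<in> carrier (H n)"
    and H_add: "N0 \<le> n \<Longrightarrow> x \<in> carrier (H n) \<Longrightarrow> y \<in> carrier (H n) \<Longrightarrow> x \<oplus>\<^bsub>H n\<^esub> y \<in> carrier (H n)"
    and H_smult: "N0 \<le> n \<Longrightarrow> x \<in> carrier (H n) \<Longrightarrow> c \<odot>\<^bsub>H n\<^esub> x \<in> carrier (H n)"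
    and H_zero_smult: "N0 \<le> n \<Longrightarrow> x \<in> carrier (H n) \<Longrightarrow> 0 \<odot>\<^bsub>H n\<^esub> x = \<zero>\<^bsub>H n\<^esub>"
    and t_closed: "N0 \<le> n \<Longrightarrow> x \<in> carrier (H n) \<Longrightarrow> t n x \<in> carrier (H (Suc n))"
    and t_add: "N0 \<le> n \<Longrightarrow> x \<in> carrier (H n) \<Longrightarrow> y \<in> carrier (H n) \<Longrightarrow>
      t n (x \<oplus>\<^bsub>H n\<^esub> y) = t n x \<oplus>\<^bsub>H (Suc n)\<^esub> t n y"
    and t_smult: "N0 \<le> n \<Longrightarrow> x \<in> carrier (H n) \<Longrightarrow> t n (c \<odot>\<^bsub>H n\<^esub> x) = c \<odot>\<^bsub>H (Suc n)\<^esub> t n x"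
    and L_inj: "N1 \<le> n \<Longrightarrow> inj_on (L n) (carrier (H n))"
    and L_t: "N1 \<le> n \<Longrightarrow> x \<in> carrier (H n) \<Longrightarrow> L (Suc n) (t n x) = L n x"
    and L_add: "N1 \<le> n \<Longrightarrow> x \<in> carrier (H n) \<Longrightarrow> y \<in> carrier (H n) \<Longrightarrow>
      L n (x \<oplus>\<^bsub>H n\<^esub> y) = (\<lambda>i. L n x i + L n y i)"
    and L_smult: "N1 \<le> n \<Longrightarrow> x \<in> carrier (H n) \<Longrightarrow> L n (c \<odot>\<^bsub>H n\<^esub> x) = (\<lambda>i. c * L n x i)"
begin

lemma transport_closed: "N0 \<le> n \<Longrightarrow> x \<in> carrier (H n) \<Longrightarrow> transport t n d x \<in> carrier (H (n + d))"
  by (induction d) (auto intro: t_closed)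

lemma transport_transport: "transport t n (d + e) x = transport t (n + d) e (transport t n d x)"
  by (induction e) (simp_all add: add.assoc)

lemma transport_add:
  assumes "N0 \<le> n" and "x \<in> carrier (H n)" and "y \<in> carrier (H n)"
  shows "transport t n d (x \<oplus>\<^bsub>H n\<^esub> y) = transport t n d x \<oplus>\<^bsub>H (n + d)\<^esub> transport t n d y"
  using assms transport_closed by (induction d) (simp_all add: t_add)

lemma transport_smult:
  assumes "N0 \<le> n" and "x \<in> carrier (H n)"
  shows "transport t n d (c \<odot>\<^bsub>H n\<^esub> x) = c \<odot>\<^bsub>H (n + d)\<^esub> transport t n d x"
  using assms transport_closed by (induction d) (simp_all add: t_smult)

text \<open>With truncated subtraction, n + (N1 - n) is the maximum of n and N1.\<close>

definition val :: "nat \<Rightarrow> 'h \<Rightarrow> 'i \<Rightarrow> 'k" where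
  "val n x = L (n + (N1 - n)) (transport t n (N1 - n) x)"

lemma L_transport:
  assumes "N1 \<le> n" and "x \<in> carrier (H n)"
  shows "L (n + d) (transport t n d x) = L n x"
  using assms transport_closed N01 by (induction d) (auto simp: L_t)

lemma val_eq_L: "N1 \<le> n \<Longrightarrow> val n x = L n x"
  by (simp add: val_def)

lemma val_eq:
  assumes n: "N0 \<le> n" and x: "x \<in> carrier (H n)" and p: "n \<le> p" "N1 \<le> p"
  shows "val n x = L p (transport t n (p - n) x)"
proof -
  define d where "d = N1 - n"
  define e where "e = p - n - d"
  have de: "p - n = d + e" "n + d + e = p" "N1 \<le> n + d" using p by (auto simp: d_def e_def)
  have "L (n + d + e) (transport t (n + d) e (transport t n d x)) = L (n + d) (transport t n d x)"
    using de(3) transport_closed[OF n x] by (rule L_transport)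
  then show ?thesis
    by (simp add: val_def d_def[symmetric] de transport_transport)
qed

lemma val_transport:
  assumes n: "N0 \<le> n" and x: "x \<in> carrier (H n)"
  shows "val (n + d) (transport t n d x) = val n x"
proof -
  define p where "p = max (n + d) N1"
  have p: "n + d \<le> p" "N1 \<le> p" by (auto simp: p_def)
  have "val (n + d) (transport t n d x) = L p (transport t (n + d) (p - (n + d)) (transport t n d x))"
    using n p by (intro val_eq transport_closed x) auto
  also have "\<dots> = L p (transport t n (p - n) x)"
    using p transport_transport[of n d "p - (n + d)" x] by simp
  also have "\<dots> = val n x"
    using val_eq[OF n x, of p] p by simp
  finally show ?thesis .
qed

lemma val_add:
  assumes n: "N0 \<le> n" and x: "x \<in> carrier (H n)" and y: "y \<in> carrier (H n)"
  shows "val n (x \<oplus>\<^bsub>H n\<^esub> y) = (\<lambda>i. val n x i + val n y i)"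
  unfolding val_def transport_add[OF assms] by (intro L_add transport_closed assms) simp

lemma val_smult:
  assumes n: "N0 \<le> n" and x: "x \<in> carrier (H n)"
  shows "val n (c \<odot>\<^bsub>H n\<^esub> x) = (\<lambda>i. c * val n x i)"
  unfolding val_def transport_smult[OF assms] by (intro L_smult transport_closed assms) simp

text \<open>Both elements can be compared in a common degree beyond N1, where coordinates are
  injective. Equality in the limit is thus decided by coordinates.\<close>

lemma limit_rel_iff:
  assumes n: "N0 \<le> n" "x \<in> carrier (H n)" and m: "N0 \<le> m" "y \<in> carrier (H m)"
  shows "((n, x), (m, y)) \<in> limit_rel N0 H t \<longleftrightarrow> val n x = val m y"
proof
  assume "((n, x), (m, y)) \<in> limit_rel N0 H t"
  then obtain p where p: "n \<le> p" "m \<le> p" "transport t n (p - n) x = transport t m (p - m) y"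
    by (auto simp: limit_rel_def)
  then show "val n x = val m y"
    using val_transport[OF n, of "p - n"] val_transport[OF m, of "p - m"] by simp
next
  assume eq: "val n x = val m y"
  define p where "p = max (max n m) N1"
  have p: "n \<le> p" "m \<le> p" "N1 \<le> p" by (auto simp: p_def)
  have "transport t n (p - n) x \<in> carrier (H p)" "transport t m (p - m) y \<in> carrier (H p)"
    using transport_closed[OF n, of "p - n"] transport_closed[OF m, of "p - m"] p by simp_all
  then have "transport t n (p - n) x = transport t m (p - m) y"
    using eq val_eq[OF n p(1,3)] val_eq[OF m p(2,3)] inj_onD[OF L_inj[OF p(3)]] by simp
  then show "((n, x), (m, y)) \<in> limit_rel N0 H t"
    using assms p by (auto simp: limit_rel_def)
qed

lemma limit_rel_dom:
  "((n, x), (m, y)) \<in> limit_rel N0 H t \<Longrightarrow>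
    N0 \<le> n \<and> N0 \<le> m \<and> x \<in> carrier (H n) \<and> y \<in> carrier (H m)"
  by (auto simp: limit_rel_def)

abbreviation cls :: "nat \<Rightarrow> 'h \<Rightarrow> (nat \<times> 'h) set" where
  "cls \<equiv> limit_class N0 H t"

abbreviation lim :: "('k, (nat \<times> 'h) set) module" where
  "lim \<equiv> direct_limit N0 H t"

lemma mem_cls_iff:
  assumes n: "N0 \<le> n" "x \<in> carrier (H n)"
  shows "(m, y) \<in> cls n x \<longleftrightarrow> N0 \<le> m \<and> y \<in> carrier (H m) \<and> val n x = val m y"
proof -
  have "(m, y) \<in> cls n x \<longleftrightarrow> ((n, x), (m, y)) \<in> limit_rel N0 H t"
    by (simp add: limit_class_def)
  then show ?thesis
    using limit_rel_iff[OF n, of m y] limit_rel_dom[of n x m y] by blast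
qed

lemma cls_eq_iff:
  assumes n: "N0 \<le> n" "x \<in> carrier (H n)" and m: "N0 \<le> m" "y \<in> carrier (H m)"
  shows "cls n x = cls m y \<longleftrightarrow> val n x = val m y"
proof
  assume "cls n x = cls m y"
  then show "val n x = val m y"
    using mem_cls_iff[OF n, of m y] mem_cls_iff[OF m, of m y] m by simp
next
  assume "val n x = val m y"
  then show "cls n x = cls m y"
    using mem_cls_iff[OF n] mem_cls_iff[OF m] by auto
qed

lemma carrier_lim: "A \<in> carrier lim \<longleftrightarrow> (\<exists>n x. N0 \<le> n \<and> x \<in> carrier (H n) \<and> A = cls n x)"
  by (auto simp: direct_limit_def quotient_def limit_class_def)

lemma cls_in_lim: "N0 \<le> n \<Longrightarrow> x \<in> carrier (H n) \<Longrightarrow> cls n x \<in> carrier lim"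
  by (auto simp: carrier_lim)

lemma cls_transport:
  assumes n: "N0 \<le> n" "x \<in> carrier (H n)"
  shows "cls (n + d) (transport t n d x) = cls n x"
  using n by (subst cls_eq_iff) (auto simp: val_transport transport_closed)

definition coords :: "(nat \<times> 'h) set \<Rightarrow> 'i \<Rightarrow> 'k" where
  "coords A = (case SOME u. u \<in> A of (n, x) \<Rightarrow> val n x)"

lemma coords_cls:
  assumes n: "N0 \<le> n" "x \<in> carrier (H n)"
  shows "coords (cls n x) = val n x"
proof -
  have "(n, x) \<in> cls n x" using mem_cls_iff[OF n] n by simp
  then have "(SOME u. u \<in> cls n x) \<in> cls n x" by (rule someI)
  then show ?thesis
    using mem_cls_iff[OF n] by (auto simp: coords_def split: prod.split)
qed

text \<open>All representatives of the two classes have the same coordinates, hence so do their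
  sums, and the union in the definition runs over a single class.\<close>

lemma add_lim:
  assumes x: "N0 \<le> n" "x \<in> carrier (H n)" and y: "y \<in> carrier (H n)"
  shows "cls n x \<oplus>\<^bsub>lim\<^esub> cls n y = cls n (x \<oplus>\<^bsub>H n\<^esub> y)"
proof -
  have "{cls p (x' \<oplus>\<^bsub>H p\<^esub> y') | p x' y'. (p, x') \<in> cls n x \<and> (p, y') \<in> cls n y} = {cls n (x \<oplus>\<^bsub>H n\<^esub> y)}"
  proof (intro equalityI subsetI)
    fix A assume "A \<in> {cls p (x' \<oplus>\<^bsub>H p\<^esub> y') | p x' y'. (p, x') \<in> cls n x \<and> (p, y') \<in> cls n y}"
    then obtain p x' y' where A: "A = cls p (x' \<oplus>\<^bsub>H p\<^esub> y')" "(p, x') \<in> cls n x" "(p, y') \<in> cls n y"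
      by blast
    then have p: "N0 \<le> p" "x' \<in> carrier (H p)" "y' \<in> carrier (H p)" "val n x = val p x'" "val n y = val p y'"
      using mem_cls_iff x y by auto
    then show "A \<in> {cls n (x \<oplus>\<^bsub>H n\<^esub> y)}"
      using x y by (simp add: A(1) cls_eq_iff H_add val_add)
  next
    fix A assume "A \<in> {cls n (x \<oplus>\<^bsub>H n\<^esub> y)}"
    then have "A = cls n (x \<oplus>\<^bsub>H n\<^esub> y)" "(n, x) \<in> cls n x" "(n, y) \<in> cls n y"
      using mem_cls_iff x y by auto
    then show "A \<in> {cls p (x' \<oplus>\<^bsub>H p\<^esub> y') | p x' y'. (p, x') \<in> cls n x \<and> (p, y') \<in> cls n y}"
      by blast
  qed
  then show ?thesis by (simp add: direct_limit_def)
qed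

lemma smult_lim:
  assumes x: "N0 \<le> n" "x \<in> carrier (H n)"
  shows "c \<odot>\<^bsub>lim\<^esub> cls n x = cls n (c \<odot>\<^bsub>H n\<^esub> x)"
proof -
  have "{cls p (c \<odot>\<^bsub>H p\<^esub> x') | p x'. (p, x') \<in> cls n x} = {cls n (c \<odot>\<^bsub>H n\<^esub> x)}"
  proof (intro equalityI subsetI)
    fix A assume "A \<in> {cls p (c \<odot>\<^bsub>H p\<^esub> x') | p x'. (p, x') \<in> cls n x}"
    then obtain p x' where A: "A = cls p (c \<odot>\<^bsub>H p\<^esub> x')" "(p, x') \<in> cls n x" by blast
    then have "N0 \<le> p" "x' \<in> carrier (H p)" "val n x = val p x'"
      using mem_cls_iff x by auto
    then show "A \<in> {cls n (c \<odot>\<^bsub>H n\<^esub> x)}"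
      using x by (simp add: A(1) cls_eq_iff H_smult val_smult)
  next
    fix A assume "A \<in> {cls n (c \<odot>\<^bsub>H n\<^esub> x)}"
    then have "A = cls n (c \<odot>\<^bsub>H n\<^esub> x)" "(n, x) \<in> cls n x"
      using mem_cls_iff x by auto
    then show "A \<in> {cls p (c \<odot>\<^bsub>H p\<^esub> x') | p x'. (p, x') \<in> cls n x}" by blast
  qed
  then show ?thesis by (simp add: direct_limit_def)
qed

lemma common_representatives:
  assumes "A \<in> carrier lim" and "B \<in> carrier lim"
  obtains n x y where "N0 \<le> n" and "x \<in> carrier (H n)" and "y \<in> carrier (H n)" and "A = cls n x" and "B = cls n y"
proof -
  obtain n x where x: "N0 \<le> n" "x \<in> carrier (H n)" "A = cls n x" using assms(1) carrier_lim by blast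
  obtain m y where y: "N0 \<le> m" "y \<in> carrier (H m)" "B = cls m y" using assms(2) carrier_lim by blast
  define p where "p = max n m"
  have p: "n + (p - n) = p" "m + (p - m) = p" by (auto simp: p_def)
  show thesis
  proof (rule that)
    show "N0 \<le> p" using x by (simp add: p_def)
    show "transport t n (p - n) x \<in> carrier (H p)" "transport t m (p - m) y \<in> carrier (H p)"
      using transport_closed[OF x(1,2), of "p - n"] transport_closed[OF y(1,2), of "p - m"] p by simp_all
    show "A = cls p (transport t n (p - n) x)" "B = cls p (transport t m (p - m) y)"
      using cls_transport[OF x(1,2), of "p - n"] cls_transport[OF y(1,2), of "p - m"] p x y by simp_all
  qed
qed

sublocale lim: function_embedding lim coords
proof
  have z: "\<zero>\<^bsub>lim\<^esub> = cls N0 \<zero>\<^bsub>H N0\<^esub>" by (simp add: direct_limit_def)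
  show "\<zero>\<^bsub>lim\<^esub> \<in> carrier lim" unfolding z by (intro cls_in_lim H_zero) auto
  have "val N0 \<zero>\<^bsub>H N0\<^esub> = (\<lambda>i. 0)"
    using val_smult[OF order_refl H_zero[OF order_refl], of 0] H_zero_smult[OF order_refl H_zero[OF order_refl]]
    by simp
  then show "coords \<zero>\<^bsub>lim\<^esub> = (\<lambda>i. 0)" unfolding z by (simp add: coords_cls H_zero)
next
  fix A B assume "A \<in> carrier lim" "B \<in> carrier lim"
  then obtain n x y where n: "N0 \<le> n" "x \<in> carrier (H n)" "y \<in> carrier (H n)" "A = cls n x" "B = cls n y"
    by (rule common_representatives)
  then show "A \<oplus>\<^bsub>lim\<^esub> B \<in> carrier lim" by (simp add: add_lim cls_in_lim H_add)
  show "coords (A \<oplus>\<^bsub>lim\<^esub> B) = (\<lambda>i. coords A i + coords B i)"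
    using n by (simp add: add_lim coords_cls H_add val_add)
next
  fix c A assume "A \<in> carrier lim"
  then obtain n x where n: "N0 \<le> n" "x \<in> carrier (H n)" "A = cls n x" using carrier_lim by blast
  then show "c \<odot>\<^bsub>lim\<^esub> A \<in> carrier lim" by (simp add: smult_lim cls_in_lim H_smult)
  show "coords (c \<odot>\<^bsub>lim\<^esub> A) = (\<lambda>i. c * coords A i)"
    using n by (simp add: smult_lim coords_cls H_smult val_smult)
next
  show "inj_on coords (carrier lim)"
  proof (rule inj_onI)
    fix A B assume "A \<in> carrier lim" "B \<in> carrier lim" and eq: "coords A = coords B"
    then obtain n x y where n: "N0 \<le> n" "x \<in> carrier (H n)" "y \<in> carrier (H n)" "A = cls n x" "B = cls n y"
      using common_representatives by blast
    then show "A = B" using eq by (simp add: coords_cls cls_eq_iff)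
  qed
qed

end


section \<open>Morphisms from the free modules of the system\<close>

lemma linear_mapsI:
  fixes U :: "('k::field, 'v) module"
  assumes "\<And>v. v \<in> carrier U \<Longrightarrow> \<phi> v \<in> carrier V"
    and "\<And>v w. v \<in> carrier U \<Longrightarrow> w \<in> carrier U \<Longrightarrow> \<phi> (v \<oplus>\<^bsub>U\<^esub> w) = \<phi> v \<oplus>\<^bsub>V\<^esub> \<phi> w"
    and "\<And>c v. v \<in> carrier U \<Longrightarrow> \<phi> (c \<odot>\<^bsub>U\<^esub> v) = c \<odot>\<^bsub>V\<^esub> \<phi> v"
    and "\<phi> \<in> extensional (carrier U)"
  shows "\<phi> \<in> linear_maps U V"
  using assms by (auto simp: linear_maps_def LinearCombinations.module_hom_def)

lemma linear_maps_compose: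
  fixes U :: "('k::field, 'u) module"
  assumes \<phi>: "\<phi> \<in> linear_maps V W" and \<psi>: "\<psi> \<in> linear_maps U V"
    and "\<And>v w. v \<in> carrier U \<Longrightarrow> w \<in> carrier U \<Longrightarrow> v \<oplus>\<^bsub>U\<^esub> w \<in> carrier U"
    and "\<And>c v. v \<in> carrier U \<Longrightarrow> c \<odot>\<^bsub>U\<^esub> v \<in> carrier U"
  shows "compose (carrier U) \<phi> \<psi> \<in> linear_maps U W"
  using assms(3,4) linear_mapsD[OF \<phi>] linear_mapsD[OF \<psi>]
  by (intro linear_mapsI) (simp_all add: compose_eq)

lemma FI_Hom_apply:
  shows "v \<in> carrier (obj V m) \<Longrightarrow> (\<phi> \<oplus>\<^bsub>FI_Hom V W\<^esub> \<psi>) m v = \<phi> m v \<oplus>\<^bsub>obj W m\<^esub> \<psi> m v"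
    and "v \<in> carrier (obj V m) \<Longrightarrow> (c \<odot>\<^bsub>FI_Hom V W\<^esub> \<phi>) m v = c \<odot>\<^bsub>obj W m\<^esub> \<phi> m v"
    and "v \<in> carrier (obj V m) \<Longrightarrow> \<zero>\<^bsub>FI_Hom V W\<^esub> m v = \<zero>\<^bsub>obj W m\<^esub>"
  by (simp_all add: FI_Hom_def)

lemma FI_HomI:
  assumes "\<And>m. \<phi> m \<in> linear_maps (obj V m) (obj W m)"
    and "\<And>m n f v. f \<in> FI_hom m n \<Longrightarrow> v \<in> carrier (obj V m) \<Longrightarrow> \<phi> n (arr V m n f v) = arr W m n f (\<phi> m v)"
  shows "\<phi> \<in> carrier (FI_Hom V W)"
  using assms by (simp add: FI_Hom_def)

lemma (in FI_set) FI_Hom_closed: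
  fixes \<phi> \<psi> :: "nat \<Rightarrow> ((nat \<Rightarrow> nat) \<Rightarrow> (nat \<Rightarrow> nat) \<Rightarrow> 'k::field) \<Rightarrow> 'a \<Rightarrow> 'k"
    and n :: nat and \<mu> :: "nat list"
  defines "U \<equiv> free_FI_module n (Specht n \<mu>)"
  shows "\<zero>\<^bsub>FI_Hom U LX\<^esub> \<in> carrier (FI_Hom U (LX :: ('k, 'a \<Rightarrow> 'k) FI_module))"
    and "\<phi> \<in> carrier (FI_Hom U LX) \<Longrightarrow> \<psi> \<in> carrier (FI_Hom U LX) \<Longrightarrow> \<phi> \<oplus>\<^bsub>FI_Hom U LX\<^esub> \<psi> \<in> carrier (FI_Hom U LX)"
    and "\<phi> \<in> carrier (FI_Hom U LX) \<Longrightarrow> c \<odot>\<^bsub>FI_Hom U LX\<^esub> \<phi> \<in> carrier (FI_Hom U LX)"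
    and "\<phi> \<in> carrier (FI_Hom U LX) \<Longrightarrow> 0 \<odot>\<^bsub>FI_Hom U LX\<^esub> \<phi> = \<zero>\<^bsub>FI_Hom U (LX :: ('k, 'a \<Rightarrow> 'k) FI_module)\<^esub>"
proof -
  have add: "v \<oplus>\<^bsub>obj U m\<^esub> w \<in> carrier (obj U m)" if "v \<in> carrier (obj U m)" "w \<in> carrier (obj U m)" for m v w
    using that unfolding U_def by (rule free_closed)
  have smult: "c \<odot>\<^bsub>obj U m\<^esub> v \<in> carrier (obj U m)" if "v \<in> carrier (obj U m)" for m c v
    using that unfolding U_def by (rule free_closed)
  have arr: "arr U m p f v \<in> carrier (obj U p)" if "f \<in> FI_hom m p" "v \<in> carrier (obj U m)" for m p f v
    using that unfolding U_def by (rule arr_free_closed)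
  have ext: "\<zero>\<^bsub>FI_Hom U LX\<^esub> m \<in> extensional (carrier (obj U m))"
    "(\<phi> \<oplus>\<^bsub>FI_Hom U LX\<^esub> \<psi>) m \<in> extensional (carrier (obj U m))"
    "(c \<odot>\<^bsub>FI_Hom U LX\<^esub> \<phi>) m \<in> extensional (carrier (obj U m))" for m c
    by (simp_all add: FI_Hom_def)
  show "\<zero>\<^bsub>FI_Hom U LX\<^esub> \<in> carrier (FI_Hom U (LX :: ('k, 'a \<Rightarrow> 'k) FI_module))"
    by (intro FI_HomI linear_mapsI)
      (auto simp: ext FI_Hom_apply add smult arr obj_linearization arr_linearization intro!: restrict_ext)
  show "\<phi> \<oplus>\<^bsub>FI_Hom U LX\<^esub> \<psi> \<in> carrier (FI_Hom U LX)"
    if \<phi>: "\<phi> \<in> carrier (FI_Hom U LX)" and \<psi>: "\<psi> \<in> carrier (FI_Hom U LX)"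
  proof (intro FI_HomI linear_mapsI)
    note lin = linear_mapsD(1-3)[OF FI_HomD(1)[OF \<phi>]] linear_mapsD(1-3)[OF FI_HomD(1)[OF \<psi>]]
    fix m p f v w and c :: 'k
    assume v: "v \<in> carrier (obj U m)"
    show "(\<phi> \<oplus>\<^bsub>FI_Hom U LX\<^esub> \<psi>) m v \<in> carrier (obj LX m)"
      using v by (simp add: FI_Hom_apply obj_linearization)
    show "(\<phi> \<oplus>\<^bsub>FI_Hom U LX\<^esub> \<psi>) m (v \<oplus>\<^bsub>obj U m\<^esub> w) =
        (\<phi> \<oplus>\<^bsub>FI_Hom U LX\<^esub> \<psi>) m v \<oplus>\<^bsub>obj LX m\<^esub> (\<phi> \<oplus>\<^bsub>FI_Hom U LX\<^esub> \<psi>) m w" if "w \<in> carrier (obj U m)"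
      using v that by (auto simp: FI_Hom_apply add lin obj_linearization fun_eq_iff)
    show "(\<phi> \<oplus>\<^bsub>FI_Hom U LX\<^esub> \<psi>) m (c \<odot>\<^bsub>obj U m\<^esub> v) = c \<odot>\<^bsub>obj LX m\<^esub> (\<phi> \<oplus>\<^bsub>FI_Hom U LX\<^esub> \<psi>) m v"
      using v by (auto simp: FI_Hom_apply smult lin obj_linearization fun_eq_iff distrib_left)
    show "(\<phi> \<oplus>\<^bsub>FI_Hom U LX\<^esub> \<psi>) p (arr U m p f v) = arr LX m p f ((\<phi> \<oplus>\<^bsub>FI_Hom U LX\<^esub> \<psi>) m v)"
      if f: "f \<in> FI_hom m p"
      using v f by (simp add: FI_Hom_apply arr FI_HomD(2)[OF \<phi>] FI_HomD(2)[OF \<psi>] obj_linearization arr_linearization_add)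
  qed (rule ext)
  show "c \<odot>\<^bsub>FI_Hom U LX\<^esub> \<phi> \<in> carrier (FI_Hom U LX)" if \<phi>: "\<phi> \<in> carrier (FI_Hom U LX)"
  proof (intro FI_HomI linear_mapsI)
    note lin = linear_mapsD(1-3)[OF FI_HomD(1)[OF \<phi>]]
    fix m p f v w and d :: 'k
    assume v: "v \<in> carrier (obj U m)"
    show "(c \<odot>\<^bsub>FI_Hom U LX\<^esub> \<phi>) m v \<in> carrier (obj LX m)"
      using v by (simp add: FI_Hom_apply obj_linearization)
    show "(c \<odot>\<^bsub>FI_Hom U LX\<^esub> \<phi>) m (v \<oplus>\<^bsub>obj U m\<^esub> w) =
        (c \<odot>\<^bsub>FI_Hom U LX\<^esub> \<phi>) m v \<oplus>\<^bsub>obj LX m\<^esub> (c \<odot>\<^bsub>FI_Hom U LX\<^esub> \<phi>) m w" if "w \<in> carrier (obj U m)"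
      using v that by (auto simp: FI_Hom_apply add lin obj_linearization fun_eq_iff distrib_left)
    show "(c \<odot>\<^bsub>FI_Hom U LX\<^esub> \<phi>) m (d \<odot>\<^bsub>obj U m\<^esub> v) = d \<odot>\<^bsub>obj LX m\<^esub> (c \<odot>\<^bsub>FI_Hom U LX\<^esub> \<phi>) m v"
      using v by (auto simp: FI_Hom_apply smult lin obj_linearization fun_eq_iff)
    show "(c \<odot>\<^bsub>FI_Hom U LX\<^esub> \<phi>) p (arr U m p f v) = arr LX m p f ((c \<odot>\<^bsub>FI_Hom U LX\<^esub> \<phi>) m v)"
      if f: "f \<in> FI_hom m p"
      using v f by (simp add: FI_Hom_apply arr FI_HomD(2)[OF \<phi>] obj_linearization arr_linearization_smult)
  qed (rule ext)
  show "0 \<odot>\<^bsub>FI_Hom U LX\<^esub> \<phi> = \<zero>\<^bsub>FI_Hom U (LX :: ('k, 'a \<Rightarrow> 'k) FI_module)\<^esub>"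
    by (simp add: FI_Hom_def obj_linearization)
qed

context FI_set
begin

lemma coord_restrict:
  assumes "N \<le> n"
  shows "coord m N n (restrict v (elems X n)) x = coord m N n v x"
proof (cases "x \<in> elems X N")
  case True
  then have "orb X m n (up X N n x) \<subseteq> elems X n"
    using assms by (intro orb_closed up_closed)
  then show ?thesis by (auto simp: coord_def intro!: sum.cong)
qed (simp add: coord_def)

lemma coord_add:
  assumes "N \<le> n"
  shows "coord m N n (\<lambda>y\<in>elems X n. v y + w y) x = coord m N n v x + coord m N n w x"
  unfolding coord_restrict[OF assms] by (simp add: coord_def sum.distrib)

lemma coord_smult:
  assumes "N \<le> n"
  shows "coord m N n (\<lambda>y\<in>elems X n. c * v y) x = c * coord m N n v x"
  unfolding coord_restrict[OF assms] by (simp add: coord_def sum_distrib_left)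

end

section \<open>The given system with its scalars made explicit\<close>

text \<open>The nonvanishing of \<iota> n is turned into a formula for its value on the generator,
  with an unspecified nonzero scalar s n.\<close>

locale normalized_system =
  fixes \<nu> :: "nat list" and \<iota> :: "nat \<Rightarrow> nat \<Rightarrow> 'k::field_char_0 free_Specht_elem \<Rightarrow> 'k free_Specht_elem"
    and s :: "nat \<Rightarrow> 'k"
  assumes part: "is_partition \<nu>"
    and \<iota>: "pad_bound \<nu> \<le> n \<Longrightarrow> \<iota> n \<in> carrier (FI_Hom (M_Sp \<nu> (Suc n)) (M_Sp \<nu> n))"
    and s: "pad_bound \<nu> \<le> n \<Longrightarrow> s n \<noteq> 0"
    and \<iota>_formula: "pad_bound \<nu> \<le> n \<Longrightarrow>
      \<iota> n (Suc n) (free_unit (Suc n) (Sp \<nu> (Suc n)) (row_inv \<nu> (Suc n))) =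
        free_sum n (padded \<nu> n) (Suc n) (\<lambda>_. s n)
          (\<lambda>\<rho>. generator n (padded \<nu> n) (Suc n) (compose {1..n} \<rho> (inc n)) (row_inv \<nu> n)) (Fix (sum_list \<nu>) (Suc n))"

lemma normalized_system_exists:
  fixes \<iota> :: "nat \<Rightarrow> nat \<Rightarrow> 'k::field_char_0 free_Specht_elem \<Rightarrow> 'k free_Specht_elem"
  assumes \<nu>: "is_partition \<nu>" and \<iota>: "Specht_system \<nu> \<iota>"
  obtains s where "normalized_system \<nu> \<iota> s"
proof -
  have "\<exists>c. c \<noteq> 0 \<and> \<iota> n (Suc n) (free_unit (Suc n) (Sp \<nu> (Suc n)) (row_inv \<nu> (Suc n))) =
      free_sum n (padded \<nu> n) (Suc n) (\<lambda>_. c)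
        (\<lambda>\<rho>. generator n (padded \<nu> n) (Suc n) (compose {1..n} \<rho> (inc n)) (row_inv \<nu> n)) (Fix (sum_list \<nu>) (Suc n))"
    if n: "pad_bound \<nu> \<le> n" for n
  proof -
    have "\<iota> n \<in> carrier (FI_Hom (M_Sp \<nu> (Suc n)) (M_Sp \<nu> n))"
      "\<iota> n \<noteq> \<zero>\<^bsub>FI_Hom (M_Sp \<nu> (Suc n)) (M_Sp \<nu> n :: ('k, 'k free_Specht_elem) FI_module)\<^esub>"
      using \<iota> n by (auto simp: Specht_system_def)
    then show ?thesis
      using transition_formula[OF \<nu> n] by blast
  qed
  then obtain s where "\<And>n. pad_bound \<nu> \<le> n \<Longrightarrow> s n \<noteq> 0 \<and>
    \<iota> n (Suc n) (free_unit (Suc n) (Sp \<nu> (Suc n)) (row_inv \<nu> (Suc n))) =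
      free_sum n (padded \<nu> n) (Suc n) (\<lambda>_. s n)
        (\<lambda>\<rho>. generator n (padded \<nu> n) (Suc n) (compose {1..n} \<rho> (inc n)) (row_inv \<nu> n)) (Fix (sum_list \<nu>) (Suc n))"
    by metis
  then have "normalized_system \<nu> \<iota> s"
    using \<nu> \<iota> by unfold_locales (auto simp: Specht_system_def)
  then show thesis by (rule that)
qed

context normalized_system
begin

text \<open>The accumulated factors by which \<open>coord_transition\<close> multiplies coordinates
  between \<open>pad_bound \<nu>\<close> and n. They involve the system and the groups
  \<open>Fix\<close>, but no FI-set.\<close>

definition scaling :: "nat \<Rightarrow> 'k" where
  "scaling n = (\<Prod>i\<in>{pad_bound \<nu>..<n}. s i * of_nat (card (Fix (sum_list \<nu>) (Suc i))))"

lemma card_Fix_nonzero: "(of_nat (card (Fix N n)) :: 'k) \<noteq> 0"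
proof -
  have "finite (Fix N n)" by (rule finite_subset[OF _ finite_FI_hom]) (auto dest: Fix_FI_hom)
  then show ?thesis using inc_Fix[of n N] by (auto simp: card_eq_0_iff)
qed

lemma scaling_nonzero: "scaling n \<noteq> 0"
  using s card_Fix_nonzero by (simp add: scaling_def)

lemma scaling_Suc:
  "pad_bound \<nu> \<le> n \<Longrightarrow> scaling (Suc n) = scaling n * (s n * of_nat (card (Fix (sum_list \<nu>) (Suc n))))"
  by (simp add: scaling_def)

definition unit_value :: "nat \<Rightarrow> (nat \<Rightarrow> 'k free_Specht_elem \<Rightarrow> 'a \<Rightarrow> 'k) \<Rightarrow> 'a \<Rightarrow> 'k" where
  "unit_value n \<phi> = \<phi> n (free_unit n (Sp \<nu> n) (row_inv \<nu> n))"

lemma sum_list_le: "pad_bound \<nu> \<le> n \<Longrightarrow> sum_list \<nu> \<le> n"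
  using sum_list_le_pad_bound le_trans by blast

lemma unit_closed:
  "pad_bound \<nu> \<le> n \<Longrightarrow>
    free_unit n (Sp \<nu> n) (row_inv \<nu> n) \<in> carrier (obj (M_Sp \<nu> n :: ('k, 'k free_Specht_elem) FI_module) n)"
  by (intro free_unit_closed row_inv_closed sum_list_le)

lemma unit_value_inj:
  assumes n: "pad_bound \<nu> \<le> n"
    and "\<phi> \<in> carrier (FI_Hom (M_Sp \<nu> n) (linearization X))" "\<psi> \<in> carrier (FI_Hom (M_Sp \<nu> n) (linearization X))"
    and "unit_value n \<phi> = unit_value n \<psi>"
  shows "\<phi> = \<psi>"
  using assms(2,3) padded_tableau(1)[OF sum_list_le[OF n]] sorted_padded[OF part n]
  by (rule free_hom_eq) (use assms(4) in \<open>simp_all add: obj_linearization unit_value_def row_inv_def\<close>)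

lemma unit_value_invariant:
  assumes X: "FI_set X" and n: "pad_bound \<nu> \<le> n" and \<phi>: "\<phi> \<in> carrier (FI_Hom (M_Sp \<nu> n) (linearization X))"
  shows "FI_set.invariant X (sum_list \<nu>) n (unit_value n \<phi>)"
proof -
  interpret FI_set X by (rule X)
  have "unit_value n \<phi> \<in> extensional (elems X n)"
    using linear_mapsD(1)[OF FI_HomD(1)[OF \<phi>] unit_closed[OF n]] by (simp add: unit_value_def obj_linearization)
  moreover have "arr LX n n \<sigma> (unit_value n \<phi>) = unit_value n \<phi>" if \<sigma>: "\<sigma> \<in> Fix (sum_list \<nu>) n" for \<sigma>
  proof -
    note m = sum_list_le[OF n]
    have "act (Sp \<nu> n) \<sigma> (row_inv \<nu> n :: _ \<Rightarrow> 'k) = row_inv \<nu> n"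
      using act_row_inv[OF m] Fix_subset_stabilizer \<sigma> by blast
    then show ?thesis
      unfolding unit_value_def
      using FI_HomD(2)[OF \<phi> Fix_FI_hom[OF \<sigma>] unit_closed[OF n]] arr_free_unit[OF Fix_FI_hom[OF \<sigma>] row_inv_closed[OF m, where 'a = 'k]]
      by simp
  qed
  ultimately show ?thesis by (simp add: invariant_def)
qed

lemma precompose_apply:
  "v \<in> carrier (obj (M_Sp \<nu> (Suc n) :: ('k, 'k free_Specht_elem) FI_module) m) \<Longrightarrow>
    precompose \<nu> \<iota> n \<phi> m v = \<phi> m (\<iota> n m v)"
  by (simp add: precompose_def FI_comp_def compose_eq)

lemma precompose_closed:
  assumes X: "FI_set X" and n: "pad_bound \<nu> \<le> n" and \<phi>: "\<phi> \<in> carrier (FI_Hom (M_Sp \<nu> n) (linearization X))"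
  shows "precompose \<nu> \<iota> n \<phi> \<in> carrier (FI_Hom (M_Sp \<nu> (Suc n)) (linearization X))"
proof (rule FI_HomI)
  show "precompose \<nu> \<iota> n \<phi> m \<in> linear_maps (obj (M_Sp \<nu> (Suc n)) m) (obj (linearization X) m)" for m
    unfolding precompose_def FI_comp_def
    by (rule linear_maps_compose[OF FI_HomD(1)[OF \<phi>] FI_HomD(1)[OF \<iota>[OF n]]]) (rule free_closed; assumption)+
  fix m p f and v :: "'k free_Specht_elem"
  assume f: "f \<in> FI_hom m p" and v: "v \<in> carrier (obj (M_Sp \<nu> (Suc n)) m)"
  show "precompose \<nu> \<iota> n \<phi> p (arr (M_Sp \<nu> (Suc n)) m p f v) = arr (linearization X) m p f (precompose \<nu> \<iota> n \<phi> m v)"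
    using FI_HomD(2)[OF \<iota>[OF n] f v] FI_HomD(2)[OF \<phi> f linear_mapsD(1)[OF FI_HomD(1)[OF \<iota>[OF n]] v]]
    by (simp add: precompose_apply[OF v] precompose_apply[OF arr_free_closed[OF f v]])
qed

text \<open>A morphism \<phi> takes f \<otimes> u to the image under f of its value at id \<otimes>
  u, so the formula for \<iota> n becomes a sum of pushforwards of the kind treated in
  \<open>coord_transition\<close>.\<close>

lemma unit_value_precompose:
  assumes X: "FI_set X" and n: "pad_bound \<nu> \<le> n" and \<phi>: "\<phi> \<in> carrier (FI_Hom (M_Sp \<nu> n) (linearization X))"
  shows "unit_value (Suc n) (precompose \<nu> \<iota> n \<phi>) =
    (\<lambda>y\<in>elems X (Suc n). \<Sum>\<rho>\<in>Fix (sum_list \<nu>) (Suc n).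
       s n * arr (linearization X) n (Suc n) (compose {1..n} \<rho> (inc n)) (unit_value n \<phi>) y)"
proof -
  have n': "pad_bound \<nu> \<le> Suc n" using n by simp
  have fin: "finite (Fix (sum_list \<nu>) (Suc n))"
    by (rule finite_subset[OF _ finite_FI_hom]) (auto dest: Fix_FI_hom)
  have inc: "inc n \<in> FI_hom n (Suc n)" by (rule inc_FI_hom) simp
  have u: "row_inv \<nu> n \<in> (Specht_carrier n (padded \<nu> n) :: (_ \<Rightarrow> 'k) set)"
    using sum_list_le[OF n] by (rule row_inv_closed)
  have f: "compose {1..n} \<rho> (inc n) \<in> FI_hom n (Suc n)" if "\<rho> \<in> Fix (sum_list \<nu>) (Suc n)" for \<rho>
    using compose_FI_hom[OF inc Fix_FI_hom[OF that]] .
  let ?G = "\<lambda>\<rho>. generator n (padded \<nu> n) (Suc n) (compose {1..n} \<rho> (inc n)) (row_inv \<nu> n) :: 'k free_Specht_elem"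
  have "unit_value (Suc n) (precompose \<nu> \<iota> n \<phi>) =
      \<phi> (Suc n) (free_sum n (padded \<nu> n) (Suc n) (\<lambda>_. s n) ?G (Fix (sum_list \<nu>) (Suc n)))"
    by (simp add: unit_value_def precompose_apply[OF unit_closed[OF n']] \<iota>_formula[OF n])
  also have "\<dots> = (\<lambda>y\<in>elems X (Suc n). \<Sum>\<rho>\<in>Fix (sum_list \<nu>) (Suc n). s n * \<phi> (Suc n) (?G \<rho>) y)"
  proof -
    have lin: "\<phi> (Suc n) \<in> linear_maps (obj (M_Sp \<nu> n) (Suc n)) (class_ring.func_space (elems X (Suc n)))"
      using FI_HomD(1)[OF \<phi>, of "Suc n"] unfolding obj_linearization .
    have gen: "?G \<rho> \<in> carrier (obj (M_Sp \<nu> n) (Suc n))" if "\<rho> \<in> Fix (sum_list \<nu>) (Suc n)" for \<rho>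
      using f[OF that] u by (rule generator_closed)
    show ?thesis
      using lin fin gen by (rule linear_free_sum[where c = "\<lambda>_. s n" and F = ?G])
  qed
  also have "\<dots> = (\<lambda>y\<in>elems X (Suc n). \<Sum>\<rho>\<in>Fix (sum_list \<nu>) (Suc n).
       s n * arr (linearization X) n (Suc n) (compose {1..n} \<rho> (inc n)) (unit_value n \<phi>) y)"
    unfolding generator_def unit_value_def
    by (intro restrict_ext sum.cong refl) (simp add: FI_HomD(2)[OF \<phi> f unit_closed[OF n]])
  finally show ?thesis .
qed

definition stable_coord :: "'a FI_set \<Rightarrow> nat \<Rightarrow> nat \<Rightarrow> (nat \<Rightarrow> 'k free_Specht_elem \<Rightarrow> 'a \<Rightarrow> 'k) \<Rightarrow> 'a \<Rightarrow> 'k" where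
  "stable_coord X N n \<phi> x = FI_set.coord X (sum_list \<nu>) N n (unit_value n \<phi>) x / scaling n"

lemma coordinate_system:
  fixes X :: "'a FI_set"
  assumes X: "FI_set X" and st: "stable_from X (sum_list \<nu>) N" and N: "pad_bound \<nu> \<le> N"
  shows "coordinate_system (pad_bound \<nu>) N (\<lambda>n. FI_Hom (M_Sp \<nu> n) (linearization X))
    (precompose \<nu> \<iota>) (stable_coord X N)"
proof -
  interpret FI_set X by (rule X)
  let ?H = "\<lambda>n. FI_Hom (M_Sp \<nu> n) (LX :: ('k, 'a \<Rightarrow> 'k) FI_module)"
  have \<iota>_closed: "\<iota> n m v \<in> carrier (obj (M_Sp \<nu> n) m)"
    if "pad_bound \<nu> \<le> n" "v \<in> carrier (obj (M_Sp \<nu> (Suc n)) m)" for n m v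
    using linear_mapsD(1)[OF FI_HomD(1)[OF \<iota>[OF that(1)]] that(2)] .
  show ?thesis
  proof
    show "pad_bound \<nu> \<le> N" by (rule N)
  next
    fix n \<phi> \<psi> assume n: "pad_bound \<nu> \<le> n" and \<phi>: "\<phi> \<in> carrier (?H n)" and \<psi>: "\<psi> \<in> carrier (?H n)"
    show "\<phi> \<oplus>\<^bsub>?H n\<^esub> \<psi> \<in> carrier (?H n)" using \<phi> \<psi> by (rule FI_Hom_closed)
    show "precompose \<nu> \<iota> n (\<phi> \<oplus>\<^bsub>?H n\<^esub> \<psi>) = precompose \<nu> \<iota> n \<phi> \<oplus>\<^bsub>?H (Suc n)\<^esub> precompose \<nu> \<iota> n \<psi>"
      using \<iota>_closed[OF n]
      by (simp add: precompose_def FI_comp_def FI_Hom_def compose_def cong: restrict_cong)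
  next
    fix n \<phi> and c :: 'k assume n: "pad_bound \<nu> \<le> n" and \<phi>: "\<phi> \<in> carrier (?H n)"
    show "c \<odot>\<^bsub>?H n\<^esub> \<phi> \<in> carrier (?H n)" using \<phi> by (rule FI_Hom_closed)
    show "0 \<odot>\<^bsub>?H n\<^esub> \<phi> = \<zero>\<^bsub>?H n\<^esub>" using \<phi> by (rule FI_Hom_closed)
    show "precompose \<nu> \<iota> n \<phi> \<in> carrier (?H (Suc n))" using X n \<phi> by (rule precompose_closed)
    show "precompose \<nu> \<iota> n (c \<odot>\<^bsub>?H n\<^esub> \<phi>) = c \<odot>\<^bsub>?H (Suc n)\<^esub> precompose \<nu> \<iota> n \<phi>"
      using \<iota>_closed[OF n]
      by (simp add: precompose_def FI_comp_def FI_Hom_def compose_def cong: restrict_cong)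
  next
    fix n assume "pad_bound \<nu> \<le> n"
    show "\<zero>\<^bsub>?H n\<^esub> \<in> carrier (?H n)" by (rule FI_Hom_closed)
  next
    fix n assume n: "N \<le> n"
    then have n': "pad_bound \<nu> \<le> n" using N by simp
    show "inj_on (stable_coord X N n) (carrier (?H n))"
    proof (rule inj_onI)
      fix \<phi> \<psi> assume \<phi>: "\<phi> \<in> carrier (?H n)" and \<psi>: "\<psi> \<in> carrier (?H n)"
        and eq: "stable_coord X N n \<phi> = stable_coord X N n \<psi>"
      have "coord (sum_list \<nu>) N n (unit_value n \<phi>) = coord (sum_list \<nu>) N n (unit_value n \<psi>)"
      proof
        fix x show "coord (sum_list \<nu>) N n (unit_value n \<phi>) x = coord (sum_list \<nu>) N n (unit_value n \<psi>) x"
          using fun_cong[OF eq, of x] scaling_nonzero[of n] by (simp add: stable_coord_def)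
      qed
      then have "unit_value n \<phi> = unit_value n \<psi>"
        by (rule coord_inj[OF st n unit_value_invariant[OF X n' \<phi>] unit_value_invariant[OF X n' \<psi>]])
      then show "\<phi> = \<psi>" by (rule unit_value_inj[OF n' \<phi> \<psi>])
    qed
  next
    fix n \<phi> assume n: "N \<le> n" and \<phi>: "\<phi> \<in> carrier (?H n)"
    then have n': "pad_bound \<nu> \<le> n" using N by simp
    \<comment> \<open>The factor from \<open>coord_transition\<close> is exactly the last factor of
      \<open>scaling (Suc n)\<close>.\<close>
    show "stable_coord X N (Suc n) (precompose \<nu> \<iota> n \<phi>) = stable_coord X N n \<phi>"
      using coord_transition[OF st n unit_value_precompose[OF X n' \<phi>]] s[OF n'] card_Fix_nonzero
        scaling_nonzero[of n]
      by (simp add: fun_eq_iff stable_coord_def scaling_Suc[OF n'])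
  next
    fix n \<phi> \<psi> assume n: "N \<le> n" and \<phi>: "\<phi> \<in> carrier (?H n)" and \<psi>: "\<psi> \<in> carrier (?H n)"
    then have n': "pad_bound \<nu> \<le> n" using N by simp
    have "unit_value n (\<phi> \<oplus>\<^bsub>?H n\<^esub> \<psi>) = (\<lambda>x\<in>elems X n. unit_value n \<phi> x + unit_value n \<psi> x)"
      unfolding unit_value_def FI_Hom_apply(1)[OF unit_closed[OF n']] obj_linearization
      by (rule add_func_space)
    then have "coord (sum_list \<nu>) N n (unit_value n (\<phi> \<oplus>\<^bsub>?H n\<^esub> \<psi>)) x =
        coord (sum_list \<nu>) N n (unit_value n \<phi>) x + coord (sum_list \<nu>) N n (unit_value n \<psi>) x" for x
      by (simp only: coord_add[OF n])
    then show "stable_coord X N n (\<phi> \<oplus>\<^bsub>?H n\<^esub> \<psi>) = (\<lambda>i. stable_coord X N n \<phi> i + stable_coord X N n \<psi> i)"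
      by (simp add: stable_coord_def fun_eq_iff add_divide_distrib)
  next
    fix n \<phi> and c :: 'k assume n: "N \<le> n" and \<phi>: "\<phi> \<in> carrier (?H n)"
    then have n': "pad_bound \<nu> \<le> n" using N by simp
    have "unit_value n (c \<odot>\<^bsub>?H n\<^esub> \<phi>) = (\<lambda>x\<in>elems X n. c * unit_value n \<phi> x)"
      unfolding unit_value_def FI_Hom_apply(2)[OF unit_closed[OF n']] obj_linearization
      by (rule smult_func_space)
    then have "coord (sum_list \<nu>) N n (unit_value n (c \<odot>\<^bsub>?H n\<^esub> \<phi>)) x =
        c * coord (sum_list \<nu>) N n (unit_value n \<phi>) x" for x
      by (simp only: coord_smult[OF n])
    then show "stable_coord X N n (c \<odot>\<^bsub>?H n\<^esub> \<phi>) = (\<lambda>i. c * stable_coord X N n \<phi> i)"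
      by (simp add: stable_coord_def fun_eq_iff)
  qed
qed

text \<open>Replaces the choice made by \<open>inv_into\<close> by a morphism about which only its
  value on the generator is recorded; coordinates depend on nothing else.\<close>

lemma to_stable:
  assumes X: "FI_set X" and n: "pad_bound \<nu> \<le> n" and \<psi>: "\<psi> \<in> sym_Hom n (Sp \<nu> n) (rep_at (linearization X) n)"
  obtains \<phi> where "\<phi> \<in> carrier (FI_Hom (M_Sp \<nu> n) (linearization X))"
    and "to_stable \<nu> \<iota> (linearization X) n \<psi> =
      limit_class (pad_bound \<nu>) (\<lambda>n. FI_Hom (M_Sp \<nu> n) (linearization X)) (precompose \<nu> \<iota>) n \<phi>"
    and "unit_value n \<phi> = \<psi> (row_inv \<nu> n)"
proof -
  interpret FI_set X by (rule X)
  let ?W = "Sp \<nu> n :: ('k, (nat \<Rightarrow> nat) \<Rightarrow> 'k) sym_rep"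
  let ?\<phi> = "inv_into (carrier (FI_Hom (M_Sp \<nu> n) LX)) (free_restrict n ?W) \<psi>"
  have "\<psi> \<in> free_restrict n ?W ` carrier (FI_Hom (M_Sp \<nu> n) LX)"
    using free_extend[OF \<psi>] by (metis imageI)
  then have \<phi>: "?\<phi> \<in> carrier (FI_Hom (M_Sp \<nu> n) LX)" "free_restrict n ?W ?\<phi> = \<psi>"
    by (rule inv_into_into, rule f_inv_into_f)
  have "unit_value n ?\<phi> = free_restrict n ?W ?\<phi> (row_inv \<nu> n)"
    using row_inv_closed[OF sum_list_le[OF n], where 'a = 'k]
    by (simp add: unit_value_def free_restrict_def compose_eq)
  then show thesis
    using \<phi> by (intro that[of ?\<phi>]) (auto simp: to_stable_def)
qed

end

section \<open>Polynomiality\<close>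

lemma poly_map_poly_of_int: "poly (map_poly of_int p) (of_nat n :: 'k::field_char_0) = of_int (poly p (int n))"
  by (induction p) (simp_all add: map_poly_pCons)

lemma quasi_polynomial_poly:
  assumes "quasi_polynomial a"
  obtains q :: "'k::field_char_0 poly" where "\<forall>\<^sub>F n in sequentially. of_nat (a n) = poly q (of_nat n)"
proof -
  obtain p c where c: "c \<noteq> 0" and ev: "\<forall>\<^sub>F n in sequentially. c * int (a n) = poly p (int n)"
    using assms unfolding quasi_polynomial_def by blast
  have "\<forall>\<^sub>F n in sequentially. of_nat (a n) = poly (Polynomial.smult (1 / of_int c) (map_poly of_int p)) (of_nat n :: 'k)"
    using ev
  proof eventually_elim
    case (elim n)
    have "(of_int c :: 'k) * of_nat (a n) = of_int (poly p (int n))"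
      by (metis elim of_int_mult of_int_of_nat_eq)
    then show ?case using c by (simp add: poly_map_poly_of_int field_simps)
  qed
  then show thesis by (rule that)
qed

lemma stable_from_mono: "stable_from X m N \<Longrightarrow> N \<le> N' \<Longrightarrow> stable_from X m N'"
  unfolding stable_from_def by (meson le_trans)

text \<open>The coordinates of a class in the limit do not change with n, so n enters only through
  the counts of related elements in orbits. Finiteness of B gives one threshold for all basis
  vectors.\<close>

theorem theoremB:
  fixes X :: "'a FI_set" and Y :: "'b FI_set"
    and R :: "nat \<Rightarrow> ('a \<times> 'b) set"
    and \<nu> :: "nat list"
    and \<iota> :: "nat \<Rightarrow> nat \<Rightarrow> 'k::field_char_0 free_Specht_elem \<Rightarrow> 'k free_Specht_elem"
  assumes "FI_set X" and "finitely_generated X"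
    and "FI_set Y" and "finitely_generated Y"
    and "FI_relation X Y R"
    and "is_partition \<nu>"
    and "Specht_system \<nu> \<iota>"
    and "vectorspace.basis class_ring (stable_mult \<nu> \<iota> (linearization X)) B"
    and "vectorspace.basis class_ring (stable_mult \<nu> \<iota> (linearization Y)) C"
  shows "\<exists>P :: _ \<Rightarrow> _ \<Rightarrow> 'k poly. \<forall>\<^sub>F n in sequentially. \<forall>b\<in>B.
           stable_rel_map \<nu> \<iota> X Y R n b =
             LinearCombinations.module.lincomb (stable_mult \<nu> \<iota> (linearization Y))
               (\<lambda>c. poly (P b c) (of_nat n)) C"
proof -
  note X = assms(1) and Y = assms(3) and R = assms(5)
  interpret X: FI_set X by (rule X)
  interpret Y: FI_set Y by (rule Y)
  let ?m = "sum_list \<nu>"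
  obtain s where "normalized_system \<nu> \<iota> s"
    using normalized_system_exists[OF assms(6,7)] by blast
  then interpret normalized_system \<nu> \<iota> s .
  obtain NX where NX: "stable_from X ?m NX" using X.stable_from_exists[OF assms(2)] by blast
  obtain NY where NY: "stable_from Y ?m NY" using Y.stable_from_exists[OF assms(4)] by blast
  \<comment> \<open>One level at which the orbits of both FI-sets are stable and the padded
    partitions exist.\<close>
  define N where "N = max (pad_bound \<nu>) (max NX NY)"
  have N: "pad_bound \<nu> \<le> N" by (simp add: N_def)
  have stX: "stable_from X ?m N" and stY: "stable_from Y ?m N"
    using stable_from_mono[OF NX] stable_from_mono[OF NY] by (auto simp: N_def)
  have mN: "?m \<le> N" using sum_list_le[OF N] .
  let ?HX = "\<lambda>n. FI_Hom (M_Sp \<nu> n) (linearization X :: ('k, 'a \<Rightarrow> 'k) FI_module)"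
  let ?HY = "\<lambda>n. FI_Hom (M_Sp \<nu> n) (linearization Y :: ('k, 'b \<Rightarrow> 'k) FI_module)"
  interpret CX: coordinate_system "pad_bound \<nu>" N ?HX "precompose \<nu> \<iota>" "stable_coord X N"
    by (rule coordinate_system[OF X stX N])
  interpret CY: coordinate_system "pad_bound \<nu>" N ?HY "precompose \<nu> \<iota>" "stable_coord Y N"
    by (rule coordinate_system[OF Y stY N])
  have suppX: "CX.coords A x = 0" if "A \<in> carrier CX.lim" "x \<notin> elems X N" for A x
    using that by (auto simp: CX.carrier_lim CX.coords_cls CX.val_def stable_coord_def X.coord_def)
  have suppY: "CY.coords A y = 0" if "A \<in> carrier CY.lim" "y \<notin> elems Y N" for A y
    using that by (auto simp: CY.carrier_lim CY.coords_cls CY.val_def stable_coord_def Y.coord_def)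
  have B: "CX.lim.V.basis B" and C: "CY.lim.V.basis C"
    using assms(8,9) by (simp_all add: stable_mult_def)
  \<comment> \<open>Coordinates vanish outside the finite set of elements of degree N, so the limit
    is finite-dimensional.\<close>
  have finB: "finite B"
    using B X.finite_elems suppX by (rule CX.lim.basis_coefficients(1))
  have BX: "B \<subseteq> carrier CX.lim" using B by (simp add: CX.lim.V.basis_def)
  have "\<exists>A. \<forall>v\<in>carrier CY.lim. v = CY.lim.V.lincomb (\<lambda>c. \<Sum>y\<in>elems Y N. A c y * CY.coords v y) C"
    using C Y.finite_elems suppY by (rule CY.lim.basis_coefficients(2))
  then obtain A where A: "\<forall>v\<in>carrier CY.lim.
      v = CY.lim.V.lincomb (\<lambda>c. \<Sum>y\<in>elems Y N. A c y * CY.coords v y) C" ..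
  obtain T where T: "T \<subseteq> elems X N" and T1: "\<And>x. x \<in> elems X N \<Longrightarrow> \<exists>!t. t \<in> T \<and> x \<in> orb X ?m N t"
    using X.transversal_exists[of N ?m] by blast
  have finT: "finite T" using T X.finite_elems by (rule finite_subset)
  define K where "K t y n = card {z \<in> orb Y ?m n (up Y N n y). (up X N n t, z) \<in> R n}" for t y n
  have "\<exists>q :: 'k poly. \<forall>\<^sub>F n in sequentially. of_nat (K t y n) = poly q (of_nat n)"
    if "t \<in> T" "y \<in> elems Y N" for t y
  proof -
    have "quasi_polynomial (K t y)"
      unfolding K_def using T that by (intro quasi_polynomial_relation_count[OF X Y assms(4) R mN]) auto
    then show ?thesis using quasi_polynomial_poly by blast
  qed
  then obtain q :: "'a \<Rightarrow> 'b \<Rightarrow> 'k poly" where q: "\<And>t y. t \<in> T \<Longrightarrow> y \<in> elems Y N \<Longrightarrow>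
      \<forall>\<^sub>F n in sequentially. of_nat (K t y n) = poly (q t y) (of_nat n)"
    by metis
  then have ev_q: "\<forall>\<^sub>F n in sequentially. \<forall>t\<in>T. \<forall>y\<in>elems Y N. of_nat (K t y n) = poly (q t y) (of_nat n)"
    by (intro eventually_ball_finite finT Y.finite_elems ballI)
  \<comment> \<open>Every class has a representative in all large degrees; as B is finite, one bound
    serves all its elements.\<close>
  have ev_b: "\<forall>\<^sub>F n in sequentially. \<forall>b\<in>B. \<exists>\<phi>\<in>carrier (?HX n). b = CX.cls n \<phi>"
  proof (intro eventually_ball_finite finB ballI)
    fix b assume "b \<in> B"
    then obtain n0 \<phi> where \<phi>: "pad_bound \<nu> \<le> n0" "\<phi> \<in> carrier (?HX n0)" "b = CX.cls n0 \<phi>"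
      using BX CX.carrier_lim by blast
    show "\<forall>\<^sub>F n in sequentially. \<exists>\<phi>\<in>carrier (?HX n). b = CX.cls n \<phi>"
      using eventually_ge_at_top[of n0]
    proof eventually_elim
      case (elim n)
      then show ?case
        using CX.transport_closed[OF \<phi>(1,2), of "n - n0"] CX.cls_transport[OF \<phi>(1,2), of "n - n0"] \<phi>(3)
        by auto
    qed
  qed
  \<comment> \<open>The fixed coordinates of b are multiplied by the matrix of counting polynomials
    and then converted by A into coefficients with respect to C. Only the q t y carry the dependence
    on n.\<close>
  define P where "P b c = (\<Sum>y\<in>elems Y N. Polynomial.smult (A c y)
    (\<Sum>t\<in>T. Polynomial.smult (CX.coords b t) (q t y)))" for b c
  have "\<forall>\<^sub>F n in sequentially. \<forall>b\<in>B. stable_rel_map \<nu> \<iota> X Y R n b =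
      CY.lim.V.lincomb (\<lambda>c. poly (P b c) (of_nat n)) C"
    using ev_q ev_b eventually_ge_at_top[of N]
  proof eventually_elim
    case (elim n)
    then have n: "N \<le> n" "pad_bound \<nu> \<le> n" using N by auto
    let ?W = "Sp \<nu> n :: ('k, (nat \<Rightarrow> nat) \<Rightarrow> 'k) sym_rep" and ?u = "row_inv \<nu> n :: _ \<Rightarrow> 'k"
    have u: "?u \<in> Specht_carrier n (padded \<nu> n)" using sum_list_le[OF n(2)] by (rule row_inv_closed)
    show ?case
    proof
      fix b assume b: "b \<in> B"
      let ?to = "to_stable \<nu> \<iota> (linearization X) n"
      let ?S = "sym_Hom n ?W (rep_at (linearization X) n)"
      obtain \<phi> where \<phi>: "\<phi> \<in> carrier (?HX n)" "b = CX.cls n \<phi>" using elim(2) b by blast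
      have \<phi>': "free_restrict n ?W \<phi> \<in> ?S" using \<phi>(1) by (rule X.free_restrict_in_sym_Hom)
      \<comment> \<open>This shows that b lies in the image of the canonical map, so that
        \<open>inv_into\<close> in \<open>stable_rel_map\<close> yields a genuine preimage \<psi>.
        Later steps use only that \<psi> is mapped to b.\<close>
      have "?to (free_restrict n ?W \<phi>) = b"
      proof -
        obtain \<phi>1 where \<phi>1: "\<phi>1 \<in> carrier (?HX n)" "?to (free_restrict n ?W \<phi>) = CX.cls n \<phi>1"
          "unit_value n \<phi>1 = free_restrict n ?W \<phi> ?u"
          using to_stable[OF X n(2) \<phi>'] by blast
        have "unit_value n \<phi>1 = unit_value n \<phi>"
          unfolding \<phi>1(3) using u by (simp add: free_restrict_def compose_eq unit_value_def)
        then have "\<phi>1 = \<phi>" using unit_value_inj[OF n(2) \<phi>1(1) \<phi>(1)] by simp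
        then show ?thesis using \<phi>1(2) \<phi>(2) by simp
      qed
      then have "b \<in> ?to ` ?S" using \<phi>' by (metis imageI)
      define \<psi> where "\<psi> = inv_into ?S ?to b"
      have \<psi>: "\<psi> \<in> ?S" "?to \<psi> = b"
        unfolding \<psi>_def using \<open>b \<in> ?to ` ?S\<close> by (rule inv_into_into, rule f_inv_into_f)
      obtain \<chi> where \<chi>: "\<chi> \<in> carrier (?HX n)" "?to \<psi> = CX.cls n \<chi>" "unit_value n \<chi> = \<psi> ?u"
        using to_stable[OF X n(2) \<psi>(1)] by blast
      have coords_b: "CX.coords b t = X.coord ?m N n (\<psi> ?u) t / scaling n" for t
        using \<chi> n by (simp add: \<psi>(2)[symmetric] CX.coords_cls CX.val_eq_L stable_coord_def)
      define \<theta> where "\<theta> = compose (Specht_carrier n (padded \<nu> n)) (rel_map X Y R n) \<psi>"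
      note lin = linear_mapsD[OF sym_HomD(1)[OF \<psi>(1)], simplified]
      have "\<theta> \<in> linear_maps (space ?W) (class_ring.func_space (elems Y n))"
      proof (rule linear_mapsI)
        fix v w and c :: 'k assume v: "v \<in> carrier (space ?W)"
        show "\<theta> v \<in> carrier (class_ring.func_space (elems Y n))"
          using v by (simp add: \<theta>_def compose_eq rel_map_extensional)
        show "\<theta> (v \<oplus>\<^bsub>space ?W\<^esub> w) = \<theta> v \<oplus>\<^bsub>class_ring.func_space (elems Y n)\<^esub> \<theta> w"
          if w: "w \<in> carrier (space ?W)"
          using v w by (auto simp: \<theta>_def compose_eq Specht_add_closed lin rel_map_def sum.distrib fun_eq_iff)
        show "\<theta> (c \<odot>\<^bsub>space ?W\<^esub> v) = c \<odot>\<^bsub>class_ring.func_space (elems Y n)\<^esub> \<theta> v"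
          using v by (auto simp: \<theta>_def compose_eq Specht_smult_closed lin rel_map_def sum_distrib_left fun_eq_iff)
      qed (simp add: \<theta>_def)
      moreover have "\<theta> (act ?W \<sigma> w) = arr (linearization Y) n n \<sigma> (\<theta> w)"
        if "\<sigma> \<in> FI_hom n n" "w \<in> carrier (space ?W)" for \<sigma> w
        using that sym_HomD(2)[OF \<psi>(1) that] rel_map_equivariant[OF X Y R that(1)]
        by (simp add: \<theta>_def compose_eq act_Specht_closed)
      ultimately have "\<theta> \<in> sym_Hom n ?W (rep_at (linearization Y) n)"
        by (simp add: sym_Hom_def)
      then obtain \<omega> where \<omega>: "\<omega> \<in> carrier (?HY n)" "to_stable \<nu> \<iota> (linearization Y) n \<theta> = CY.cls n \<omega>"
        "unit_value n \<omega> = \<theta> ?u"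
        using to_stable[OF Y n(2)] by blast
      have image: "stable_rel_map \<nu> \<iota> X Y R n b = CY.cls n \<omega>"
        unfolding stable_rel_map_def \<psi>_def[symmetric] \<theta>_def[symmetric] by (rule \<omega>(2))
      have "CY.coords (CY.cls n \<omega>) y = (\<Sum>t\<in>T. CX.coords b t * poly (q t y) (of_nat n))" if y: "y \<in> elems Y N" for y
      proof -
        have "CY.coords (CY.cls n \<omega>) y = Y.coord ?m N n (rel_map X Y R n (\<psi> ?u)) y / scaling n"
          using \<omega>(1,3) n u by (simp add: CY.coords_cls CY.val_eq_L stable_coord_def \<theta>_def compose_eq)
        also have "\<dots> = (\<Sum>t\<in>T. of_nat (K t y n) * X.coord ?m N n (\<psi> ?u) t) / scaling n"
          unfolding K_def by (simp only: coord_rel_map[OF X Y R stX n(1) T T1 y])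
        \<comment> \<open>The division by \<open>scaling n\<close> on the side of Y is the one
          contained in the coordinates of b on the side of X, which is where the unknown scalars
          disappear.\<close>
        also have "\<dots> = (\<Sum>t\<in>T. CX.coords b t * poly (q t y) (of_nat n))"
          unfolding sum_divide_distrib using elim(1) y
          by (intro sum.cong refl) (simp add: coords_b)
        finally show ?thesis .
      qed
      then have "(\<Sum>y\<in>elems Y N. A c y * CY.coords (CY.cls n \<omega>) y) = poly (P b c) (of_nat n)" for c
        by (simp add: P_def poly_sum)
      then show "stable_rel_map \<nu> \<iota> X Y R n b = CY.lim.V.lincomb (\<lambda>c. poly (P b c) (of_nat n)) C"
        using bspec[OF A CY.cls_in_lim[OF n(2) \<omega>(1)]] by (simp add: image)
    qed
  qed
  then show ?thesis
    unfolding stable_mult_def by (intro exI[of _ P])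
qed

end
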